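(* Let $V$ be a vector space over $\Bbbk$ with ordered basis $\mathcal{B}=\{x_1,\ldots,x_n\}$, let $\mu\in M(n,\Bbbk)$ be multiplicatively antisymmetric, and let $\phi:V\times V\to\Bbbk$ be a $\mu$-symmetric bilinear form relative to $\mathcal{B}$ such that the skew Clifford algebra $\mathrm{sCl}(V,\mu,\phi)$ is nontrivial. Then: (1) any $\mathbb{Z}_2$-graded PBW deformation of the quantum exterior algebra $\Lambda_\mu(V)$ is a nontrivial skew Clifford algebra; and (2) $\mathrm{sCl}(V,\mu,\phi)$ is a PBW deformation of a quantum exterior algebra $\Lambda_{\mu'}(V')$, where $V'$ is a subspace of $V$ (spanned by a subset $\mathcal{B}'$ of $\mathcal{B}$) and $\mu'$ is the corresponding multiplicatively antisymmetric submatrix of $\mu$ (the submatrix with rows and columns indexed by $\mathcal{B}'$).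
   Context: $\Bbbk$ is a field with $\mathrm{char}(\Bbbk)\neq 2$, $n\geq 1$. A matrix $\mu=(\mu_{ij})\in M(n,\Bbbk)$ is multiplicatively antisymmetric if $\mu_{ij}\mu_{ji}=\mu_{ii}=1$ for all $i,j$. A bilinear form $\phi:V\times V\to\Bbbk$ is $\mu$-symmetric (relative to $\{x_1,\ldots,x_n\}$) if $\phi(x_i,x_j)=\mu_{ij}\phi(x_j,x_i)$ for all $i,j$. The skew Clifford algebra $\mathrm{sCl}(V,\mu,\phi)$ is the quotient of the tensor algebra $T(V)$ by the two-sided ideal generated by all elements $x_i\otimes x_j+\mu_{ij}\,x_j\otimes x_i-2\phi(x_i,x_j)\cdot 1$, for all $i,j$. It is called trivial if its dimension is $0$, and nontrivial otherwise. The quantum exterior algebra is $\Lambda_\mu(V)=\mathrm{sCl}(V,\mu,0)$. Deformations: Let $F^iT=\bigoplus_{j\le i}T^j(V)$ be the natural filtration on $T(V)$ and let $\pi:F^2T\to V\otimes V$ be the projection onto $V\otimes V$. A nonhomogeneous quadratic algebra is an algebra $R=T(V)/\langle P\rangle$, where $P\subset F^2T$ is a subspace. It is obtained by deforming the relations of $\Lambda_\mu(V)$ when $\Lambda_\mu(V)=T(V)/\langle\pi(P)\rangle$. Such an $R$ inherits a filtration from $T(V)$, with associated graded algebra $\mathrm{gr}(R)$, and there is a natural projection $\Lambda_\mu(V)\to\mathrm{gr}(R)$. $R$ is called a PBW deformation of $\Lambda_\mu(V)$ if this natural projection is an isomorphism. It is called $\mathbb{Z}_2$-graded if the relations are compatible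 with the $\mathbb{Z}_2$-grading of $T(V)$ in which each $x_i$ is odd, with elements of $P$ having even degree (i.e. $P\subset \Bbbk\cdot 1\oplus (V\otimes V)$). Algebras are identified up to isomorphism: "$R$ is a PBW deformation of $\Lambda_{\mu'}(V')$" means that $R$ is isomorphic to an algebra $T(V')/\langle P\rangle$ that is a PBW deformation of $\Lambda_{\mu'}(V')$. *)

theory Defs
  imports Complex_Main "HOL-Algebra.QuotRing" "HOL-Algebra.Module"
begin

section \<open>Algebras over a field\<close>

text \<open>
  The locale \<^verbatim>\<open>algebra\<close> of HOL-Algebra only covers commutative algebras. Associative unital
  algebras over the field \<^typ>\<open>'k\<close> are therefore records of the library type
  \<^verbatim>\<open>('k, 'a) module\<close> (a ring record together with a scalar multiplication) subject to the following
  axioms. The trivial algebra is allowed.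
\<close>

locale k_algebra = ring A for A :: "('k::field, 'a) module" (structure) +
  assumes smult_closed: "x \<in> carrier A \<Longrightarrow> c \<odot> x \<in> carrier A"
    and smult_l_distr: "x \<in> carrier A \<Longrightarrow> (c + d) \<odot> x = c \<odot> x \<oplus> d \<odot> x"
    and smult_r_distr: "\<lbrakk>x \<in> carrier A; y \<in> carrier A\<rbrakk> \<Longrightarrow> c \<odot> (x \<oplus> y) = c \<odot> x \<oplus> c \<odot> y"
    and smult_assoc: "x \<in> carrier A \<Longrightarrow> (c * d) \<odot> x = c \<odot> (d \<odot> x)"
    and smult_one: "x \<in> carrier A \<Longrightarrow> 1 \<odot> x = x"
    and smult_mult_left:
      "\<lbrakk>x \<in> carrier A; y \<in> carrier A\<rbrakk> \<Longrightarrow> (c \<odot> x) \<otimes> y = c \<odot> (x \<otimes> y)"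
    and smult_mult_right:
      "\<lbrakk>x \<in> carrier A; y \<in> carrier A\<rbrakk> \<Longrightarrow> x \<otimes> (c \<odot> y) = c \<odot> (x \<otimes> y)"

definition alg_hom :: "('k::field, 'a) module \<Rightarrow> ('k, 'b) module \<Rightarrow> ('a \<Rightarrow> 'b) set" where
  "alg_hom A B =
     {h \<in> ring_hom A B. \<forall>c. \<forall>x\<in>carrier A. h (c \<odot>\<^bsub>A\<^esub> x) = c \<odot>\<^bsub>B\<^esub> h x}"

definition alg_iso :: "('k::field, 'a) module \<Rightarrow> ('k, 'b) module \<Rightarrow> ('a \<Rightarrow> 'b) set" where
  "alg_iso A B = {h \<in> alg_hom A B. bij_betw h (carrier A) (carrier B)}"

definition alg_isomorphic :: "('k::field, 'a) module \<Rightarrow> ('k, 'b) module \<Rightarrow> bool" where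
  "alg_isomorphic A B \<longleftrightarrow> alg_iso A B \<noteq> {}"

text \<open>Nontrivial: not of dimension zero.\<close>

definition nontrivial :: "('k::field, 'a) module \<Rightarrow> bool" where
  "nontrivial A \<longleftrightarrow> carrier A \<noteq> {\<zero>\<^bsub>A\<^esub>}"

definition k_subspace :: "('k::field, 'a) module \<Rightarrow> 'a set \<Rightarrow> bool" where
  "k_subspace A U \<longleftrightarrow> U \<subseteq> carrier A \<and> \<zero>\<^bsub>A\<^esub> \<in> U \<and>
     (\<forall>x\<in>U. \<forall>y\<in>U. x \<oplus>\<^bsub>A\<^esub> y \<in> U) \<and> (\<forall>c. \<forall>x\<in>U. c \<odot>\<^bsub>A\<^esub> x \<in> U)"

definition k_span :: "('k::field, 'a) module \<Rightarrow> 'a set \<Rightarrow> 'a set" where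
  "k_span A S = \<Inter>{U. k_subspace A U \<and> S \<subseteq> U}"

text \<open>The ring part of this record is the library's quotient ring \<^verbatim>\<open>A Quot I\<close>.\<close>

definition quot_alg :: "('k::field, 'a) module \<Rightarrow> 'a set \<Rightarrow> ('k, 'a set) module" where
  "quot_alg A I = \<lparr>
     carrier = carrier (A Quot I), mult = mult (A Quot I), one = one (A Quot I),
     zero = zero (A Quot I), add = add (A Quot I),
     smult = (\<lambda>c C. \<Union>a\<in>C. I +>\<^bsub>A\<^esub> (c \<odot>\<^bsub>A\<^esub> a))\<rparr>"

definition quot_by :: "('k::field, 'a) module \<Rightarrow> 'a set \<Rightarrow> ('k, 'a set) module" where
  "quot_by A S = quot_alg A (Idl\<^bsub>A\<^esub> S)"


section \<open>The tensor algebra\<close>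

text \<open>
  The free unital associative algebra on a set \<^term>\<open>W\<close> of letters: finitely supported functions on
  the words over \<^term>\<open>W\<close>, with the convolution product of concatenation.
\<close>

definition free_algebra :: "'v set \<Rightarrow> ('k::field, 'v list \<Rightarrow> 'k) module" where
  "free_algebra W = \<lparr>
     carrier = {f. finite {w. f w \<noteq> 0} \<and> {w. f w \<noteq> 0} \<subseteq> lists W},
     mult = (\<lambda>f g w. \<Sum>k\<le>length w. f (take k w) * g (drop k w)),
     one = (\<lambda>w. if w = [] then 1 else 0),
     zero = (\<lambda>w. 0),
     add = (\<lambda>f g w. f w + g w),
     smult = (\<lambda>c f w. c * f w)\<rparr>"

definition word :: "'v list \<Rightarrow> 'v list \<Rightarrow> 'k::field" where
  "word u = (\<lambda>w. if w = u then 1 else 0)"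

text \<open>
  For a linear subspace \<^term>\<open>W\<close> (possibly everything) of the vector space with scalar
  multiplication \<^term>\<open>scale\<close>, the tensor algebra of \<^term>\<open>W\<close> is the free algebra on the underlying
  set of \<^term>\<open>W\<close> modulo the relations making the inclusion of the letters linear.
\<close>

definition linearity_relations ::
    "('k::field \<Rightarrow> 'v::ab_group_add \<Rightarrow> 'v) \<Rightarrow> 'v set \<Rightarrow> ('v list \<Rightarrow> 'k) set" where
  "linearity_relations scale W =
     {(\<lambda>u. word [scale a v + scale b w] u - (a * word [v] u + b * word [w] u)) | a b v w.
        v \<in> W \<and> w \<in> W}"

definition tensor_algebra ::
    "('k::field \<Rightarrow> 'v::ab_group_add \<Rightarrow> 'v) \<Rightarrow> 'v set \<Rightarrow> ('k, ('v list \<Rightarrow> 'k) set) module" where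
  "tensor_algebra scale W = quot_by (free_algebra W) (linearity_relations scale W)"

text \<open>\<^term>\<open>tensor scale W [w\<^sub>1, w\<^sub>2, w\<^sub>3]\<close> is the pure tensor
  \<^term>\<open>w\<^sub>1\<close> \<open>\<otimes>\<close> \<^term>\<open>w\<^sub>2\<close> \<open>\<otimes>\<close> \<^term>\<open>w\<^sub>3\<close>, and similarly for other lengths.\<close>

definition tensor ::
    "('k::field \<Rightarrow> 'v::ab_group_add \<Rightarrow> 'v) \<Rightarrow> 'v set \<Rightarrow> 'v list \<Rightarrow> ('v list \<Rightarrow> 'k) set" where
  "tensor scale W ws =
     Idl\<^bsub>free_algebra W\<^esub> (linearity_relations scale W) +>\<^bsub>free_algebra W\<^esub> word ws"

definition tensor_power ::
    "('k::field \<Rightarrow> 'v::ab_group_add \<Rightarrow> 'v) \<Rightarrow> 'v set \<Rightarrow> nat \<Rightarrow> ('v list \<Rightarrow> 'k) set set" where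
  "tensor_power scale W j =
     k_span (tensor_algebra scale W) {tensor scale W ws | ws. ws \<in> lists W \<and> length ws = j}"

text \<open>The natural filtration; the sum of the tensor powers inside the tensor algebra is direct.\<close>

definition tensor_filtration ::
    "('k::field \<Rightarrow> 'v::ab_group_add \<Rightarrow> 'v) \<Rightarrow> 'v set \<Rightarrow> nat \<Rightarrow> ('v list \<Rightarrow> 'k) set set" where
  "tensor_filtration scale W i =
     k_span (tensor_algebra scale W) (\<Union>j\<le>i. tensor_power scale W j)"

text \<open>The projection of the second filtration step onto its component of degree two.\<close>

definition quadratic_part ::
    "('k::field \<Rightarrow> 'v::ab_group_add \<Rightarrow> 'v) \<Rightarrow> 'v set \<Rightarrow>
     ('v list \<Rightarrow> 'k) set \<Rightarrow> ('v list \<Rightarrow> 'k) set" where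
  "quadratic_part scale W t =
     (THE q. q \<in> tensor_power scale W 2 \<and>
        t \<ominus>\<^bsub>tensor_algebra scale W\<^esub> q \<in> tensor_filtration scale W 1)"


section \<open>Skew Clifford algebras\<close>

text \<open>
  Bases and matrices are indexed by a set \<^term>\<open>J\<close> of natural numbers: \<^term>\<open>{1..n::nat}\<close> for the
  full data, and a subset of it for a subset of the basis. Only the values \<^term>\<open>\<mu> i j\<close> and
  \<^term>\<open>x i\<close> with indices in \<^term>\<open>J\<close> matter, so passing to a smaller \<^term>\<open>J\<close> with the same
  \<^term>\<open>\<mu>\<close> is passing to the submatrix.
\<close>

definition basis_on ::
    "('k::field \<Rightarrow> 'v::ab_group_add \<Rightarrow> 'v) \<Rightarrow> 'v set \<Rightarrow> nat set \<Rightarrow> (nat \<Rightarrow> 'v) \<Rightarrow> bool" where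
  "basis_on scale W J x \<longleftrightarrow>
     inj_on x J \<and> \<not> Modules.module.dependent scale (x ` J) \<and> Modules.module.span scale (x ` J) = W"

definition mult_antisymmetric :: "nat set \<Rightarrow> (nat \<Rightarrow> nat \<Rightarrow> 'k::field) \<Rightarrow> bool" where
  "mult_antisymmetric J \<mu> \<longleftrightarrow> (\<forall>i\<in>J. \<forall>j\<in>J. \<mu> i j * \<mu> j i = 1 \<and> \<mu> i i = 1)"

definition bilinear_form ::
    "('k::field \<Rightarrow> 'v::ab_group_add \<Rightarrow> 'v) \<Rightarrow> ('v \<Rightarrow> 'v \<Rightarrow> 'k) \<Rightarrow> bool" where
  "bilinear_form scale \<phi> \<longleftrightarrow>
     (\<forall>v. Vector_Spaces.linear scale (*) (\<lambda>w. \<phi> v w)) \<and>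
     (\<forall>w. Vector_Spaces.linear scale (*) (\<lambda>v. \<phi> v w))"

definition mu_symmetric ::
    "nat set \<Rightarrow> (nat \<Rightarrow> 'v) \<Rightarrow> (nat \<Rightarrow> nat \<Rightarrow> 'k::field) \<Rightarrow> ('v \<Rightarrow> 'v \<Rightarrow> 'k) \<Rightarrow> bool" where
  "mu_symmetric J x \<mu> \<phi> \<longleftrightarrow> (\<forall>i\<in>J. \<forall>j\<in>J. \<phi> (x i) (x j) = \<mu> i j * \<phi> (x j) (x i))"

definition skew_clifford_relations ::
    "('k::field \<Rightarrow> 'v::ab_group_add \<Rightarrow> 'v) \<Rightarrow> 'v set \<Rightarrow> nat set \<Rightarrow> (nat \<Rightarrow> 'v) \<Rightarrow>
     (nat \<Rightarrow> nat \<Rightarrow> 'k) \<Rightarrow> ('v \<Rightarrow> 'v \<Rightarrow> 'k) \<Rightarrow> ('v list \<Rightarrow> 'k) set set" where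
  "skew_clifford_relations scale W J x \<mu> \<phi> = (let T = tensor_algebra scale W in
     {(tensor scale W [x i, x j] \<oplus>\<^bsub>T\<^esub> \<mu> i j \<odot>\<^bsub>T\<^esub> tensor scale W [x j, x i])
        \<ominus>\<^bsub>T\<^esub> (2 * \<phi> (x i) (x j)) \<odot>\<^bsub>T\<^esub> \<one>\<^bsub>T\<^esub> | i j. i \<in> J \<and> j \<in> J})"

definition skew_clifford ::
    "('k::field \<Rightarrow> 'v::ab_group_add \<Rightarrow> 'v) \<Rightarrow> 'v set \<Rightarrow> nat set \<Rightarrow> (nat \<Rightarrow> 'v) \<Rightarrow>
     (nat \<Rightarrow> nat \<Rightarrow> 'k) \<Rightarrow> ('v \<Rightarrow> 'v \<Rightarrow> 'k) \<Rightarrow> ('k, ('v list \<Rightarrow> 'k) set set) module" where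
  "skew_clifford scale W J x \<mu> \<phi> =
     quot_by (tensor_algebra scale W) (skew_clifford_relations scale W J x \<mu> \<phi>)"

definition quantum_exterior ::
    "('k::field \<Rightarrow> 'v::ab_group_add \<Rightarrow> 'v) \<Rightarrow> 'v set \<Rightarrow> nat set \<Rightarrow> (nat \<Rightarrow> 'v) \<Rightarrow>
     (nat \<Rightarrow> nat \<Rightarrow> 'k) \<Rightarrow> ('k, ('v list \<Rightarrow> 'k) set set) module" where
  "quantum_exterior scale W J x \<mu> = skew_clifford scale W J x \<mu> (\<lambda>_ _. 0)"


section \<open>The associated graded algebra of a filtered algebra\<close>

text \<open>The preceding filtration step, the one before step \<open>0\<close> being zero.\<close>

definition filt_pred :: "('k::field, 'a) module \<Rightarrow> (nat \<Rightarrow> 'a set) \<Rightarrow> nat \<Rightarrow> 'a set" where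
  "filt_pred R F i = (if i = 0 then {\<zero>\<^bsub>R\<^esub>} else F (i - 1))"

text \<open>
  An element of the direct sum of the quotients \<^term>\<open>F i\<close> modulo \<^term>\<open>F (i - 1)\<close> is the
  function sending \<^term>\<open>i\<close> to its component of degree \<^term>\<open>i\<close>, which is a coset of
  \<^term>\<open>filt_pred R F i\<close>. In the product, the union runs over all choices of representatives of the
  components of the two factors; all of them give the same coset.
\<close>

definition gr :: "('k::field, 'a) module \<Rightarrow> (nat \<Rightarrow> 'a set) \<Rightarrow> ('k, nat \<Rightarrow> 'a set) module" where
  "gr R F = \<lparr>
     carrier = {g. (\<forall>i. \<exists>r\<in>F i. g i = filt_pred R F i +>\<^bsub>R\<^esub> r) \<and>
                   finite {i. g i \<noteq> filt_pred R F i}},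
     mult = (\<lambda>g h i. \<Union>(a, b)\<in>{(a, b). \<forall>j. a j \<in> g j \<and> b j \<in> h j}.
               filt_pred R F i +>\<^bsub>R\<^esub> (\<Oplus>\<^bsub>R\<^esub>j\<in>{..i}. a j \<otimes>\<^bsub>R\<^esub> b (i - j))),
     one = (\<lambda>i. filt_pred R F i +>\<^bsub>R\<^esub> (if i = 0 then \<one>\<^bsub>R\<^esub> else \<zero>\<^bsub>R\<^esub>)),
     zero = (\<lambda>i. filt_pred R F i),
     add = (\<lambda>g h i. g i <+>\<^bsub>R\<^esub> h i),
     smult = (\<lambda>c g i. \<Union>r\<in>g i. filt_pred R F i +>\<^bsub>R\<^esub> (c \<odot>\<^bsub>R\<^esub> r))\<rparr>"

text \<open>The class of \<^term>\<open>r\<close> (an element of \<^term>\<open>F 1\<close>) in degree one of \<^term>\<open>gr R F\<close>.\<close>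

definition gr_class1 :: "('k::field, 'a) module \<Rightarrow> (nat \<Rightarrow> 'a set) \<Rightarrow> 'a \<Rightarrow> nat \<Rightarrow> 'a set" where
  "gr_class1 R F r = (\<lambda>i. filt_pred R F i +>\<^bsub>R\<^esub> (if i = 1 then r else \<zero>\<^bsub>R\<^esub>))"


section \<open>PBW deformations\<close>

text \<open>
  Below, \<^term>\<open>W\<close> is a vector space with basis \<^term>\<open>x i\<close> for \<^term>\<open>i \<in> J\<close>, and
  \<^term>\<open>P\<close> is a space of relations; the nonhomogeneous quadratic algebra defined by \<^term>\<open>P\<close> is
  \<^term>\<open>quot_by (tensor_algebra scale W) P\<close>.
\<close>

definition deforms_relations ::
    "('k::field \<Rightarrow> 'v::ab_group_add \<Rightarrow> 'v) \<Rightarrow> 'v set \<Rightarrow> nat set \<Rightarrow> (nat \<Rightarrow> 'v) \<Rightarrow>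
     (nat \<Rightarrow> nat \<Rightarrow> 'k) \<Rightarrow> ('v list \<Rightarrow> 'k) set set \<Rightarrow> bool" where
  "deforms_relations scale W J x \<mu> P \<longleftrightarrow>
     k_subspace (tensor_algebra scale W) P \<and> P \<subseteq> tensor_filtration scale W 2 \<and>
     quantum_exterior scale W J x \<mu> =
       quot_by (tensor_algebra scale W) (quadratic_part scale W ` P)"

definition quot_filtration ::
    "('k::field \<Rightarrow> 'v::ab_group_add \<Rightarrow> 'v) \<Rightarrow> 'v set \<Rightarrow> ('v list \<Rightarrow> 'k) set set \<Rightarrow>
     nat \<Rightarrow> ('v list \<Rightarrow> 'k) set set set" where
  "quot_filtration scale W P i = (let T = tensor_algebra scale W in
     (\<lambda>t. Idl\<^bsub>T\<^esub> P +>\<^bsub>T\<^esub> t) ` tensor_filtration scale W i)"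

text \<open>
  The natural projection from the quantum exterior algebra to \<open>gr(R)\<close>, where \<open>R\<close> is the quotient by
  \<^term>\<open>P\<close>: it is the homomorphism of algebras sending the image of a vector \<^term>\<open>v \<in> W\<close> to the
  degree one class of the image of \<^term>\<open>v\<close> in \<open>R\<close>. It is determined by this, since vectors generate.
\<close>

definition natural_projection ::
    "('k::field \<Rightarrow> 'v::ab_group_add \<Rightarrow> 'v) \<Rightarrow> 'v set \<Rightarrow> nat set \<Rightarrow> (nat \<Rightarrow> 'v) \<Rightarrow>
     (nat \<Rightarrow> nat \<Rightarrow> 'k) \<Rightarrow> ('v list \<Rightarrow> 'k) set set \<Rightarrow>
     (('v list \<Rightarrow> 'k) set set \<Rightarrow> nat \<Rightarrow> ('v list \<Rightarrow> 'k) set set set) \<Rightarrow> bool" where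
  "natural_projection scale W J x \<mu> P p \<longleftrightarrow>
     (let T = tensor_algebra scale W; R = quot_by T P; F = quot_filtration scale W P;
          I = Idl\<^bsub>T\<^esub> (skew_clifford_relations scale W J x \<mu> (\<lambda>_ _. 0))
      in p \<in> alg_hom (quantum_exterior scale W J x \<mu>) (gr R F) \<and>
         (\<forall>v\<in>W. p (I +>\<^bsub>T\<^esub> tensor scale W [v]) =
                  gr_class1 R F (Idl\<^bsub>T\<^esub> P +>\<^bsub>T\<^esub> tensor scale W [v])))"

definition pbw_relations ::
    "('k::field \<Rightarrow> 'v::ab_group_add \<Rightarrow> 'v) \<Rightarrow> 'v set \<Rightarrow> nat set \<Rightarrow> (nat \<Rightarrow> 'v) \<Rightarrow>
     (nat \<Rightarrow> nat \<Rightarrow> 'k) \<Rightarrow> ('v list \<Rightarrow> 'k) set set \<Rightarrow> bool" where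
  "pbw_relations scale W J x \<mu> P \<longleftrightarrow>
     deforms_relations scale W J x \<mu> P \<and>
     (\<exists>p. natural_projection scale W J x \<mu> P p \<and>
          p \<in> alg_iso (quantum_exterior scale W J x \<mu>)
                (gr (quot_by (tensor_algebra scale W) P) (quot_filtration scale W P)))"

definition Z2_graded_relations ::
    "('k::field \<Rightarrow> 'v::ab_group_add \<Rightarrow> 'v) \<Rightarrow> 'v set \<Rightarrow> ('v list \<Rightarrow> 'k) set set \<Rightarrow> bool" where
  "Z2_graded_relations scale W P \<longleftrightarrow> (let T = tensor_algebra scale W in
     P \<subseteq> {c \<odot>\<^bsub>T\<^esub> \<one>\<^bsub>T\<^esub> \<oplus>\<^bsub>T\<^esub> q | c q. q \<in> tensor_power scale W 2})"

text \<open>Algebras are identified up to isomorphism in the following two notions.\<close>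

definition pbw_deformation ::
    "('k::field \<Rightarrow> 'v::ab_group_add \<Rightarrow> 'v) \<Rightarrow> 'v set \<Rightarrow> nat set \<Rightarrow> (nat \<Rightarrow> 'v) \<Rightarrow>
     (nat \<Rightarrow> nat \<Rightarrow> 'k) \<Rightarrow> ('k, 'r) module \<Rightarrow> bool" where
  "pbw_deformation scale W J x \<mu> R \<longleftrightarrow> k_algebra R \<and>
     (\<exists>P. pbw_relations scale W J x \<mu> P \<and>
          alg_isomorphic R (quot_by (tensor_algebra scale W) P))"

definition Z2_graded_pbw_deformation ::
    "('k::field \<Rightarrow> 'v::ab_group_add \<Rightarrow> 'v) \<Rightarrow> 'v set \<Rightarrow> nat set \<Rightarrow> (nat \<Rightarrow> 'v) \<Rightarrow>
     (nat \<Rightarrow> nat \<Rightarrow> 'k) \<Rightarrow> ('k, 'r) module \<Rightarrow> bool" where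
  "Z2_graded_pbw_deformation scale W J x \<mu> R \<longleftrightarrow> k_algebra R \<and>
     (\<exists>P. pbw_relations scale W J x \<mu> P \<and> Z2_graded_relations scale W P \<and>
          alg_isomorphic R (quot_by (tensor_algebra scale W) P))"

end

theory Submission
  imports Defs "HOL-Library.Stream"
begin

text \<open>
  Two facts about ordered monomials \<open>x\<^sub>S\<close> (products of distinct basis vectors in increasing order) govern
  skew Clifford algebras. They always span, since the relations allow every word to be
  reordered (\<open>normal_form_symbol\<close>). They are linearly independent if the form is invariant under the
  diagonal maps \<open>x\<^sub>j \<mapsto> \<mu> i j x\<^sub>j\<close> (\<open>invariant_form\<close>): in that case the formulas for left multiplication on ordered
  monomials define a representation of the algebra (\<open>fock_relation\<close>). Reordering for the form \<open>\<phi>\<close> and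
  reordering for the form \<open>0\<close> agree in the top degree, so under invariance an element of degree \<open>d\<close> drops in
  degree modulo the relations of the skew Clifford algebra exactly if it vanishes in the quantum
  exterior algebra (\<open>graded_kernel\<close>). This is the PBW property (\<open>pbw_of_invariant_form\<close>).

  That every nontrivial skew Clifford algebra is a PBW deformation is a reduction to an invariant form. In such an algebra, associativity on
  the words \<open>x\<^sub>i x\<^sub>i x\<^sub>j\<close> and \<open>x\<^sub>i x\<^sub>j x\<^sub>k\<close> yields linear dependencies between the generators
  (\<open>overlap_square\<close>, \<open>overlap_triple\<close>). Keep one generator from each line spanned by a nonzero generator. On
  the generators kept, the dependencies force their own coefficients to vanish, and this says that the form is
  invariant (\<open>representatives_invariant\<close>). A discarded generator is zero or a multiple of a kept one, and then it has
  the same commutation coefficients (\<open>proportional_same_coefficient\<close>), so discarding it does not change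
  the algebra (\<open>relations_transfer\<close>).

  Conversely, the relations of a graded deformation are quadratic elements plus scalars. An ideal generated by a
  space of quadratic elements has no quadratic elements outside this space (\<open>quadratic_ideal\<close>), so the
  quadratic parts are the relations of the quantum exterior algebra. The scalar belonging to a
  quadratic part is unique, because the PBW property excludes the relation \<open>1 = 0\<close>
  (\<open>one_notin_pbw_ideal\<close>). These scalars are the values of a \<open>\<mu>\<close>-symmetric form (\<open>graded_pbw_is_sc\<close>).

  Computations in the tensor algebra take place in the free algebra on the indices of the basis, with which it is
  identified by \<open>to_tensor\<close>; homomorphisms out of the algebras in question come from universal properties
  (\<open>free_hom\<close>, \<open>sc_universal\<close>).
\<close>

section \<open>Algebras, homomorphisms and quotients\<close>

lemma alg_homI:
  assumes "\<And>a. a \<in> carrier A \<Longrightarrow> h a \<in> carrier B"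
    and "\<And>a b. \<lbrakk>a \<in> carrier A; b \<in> carrier A\<rbrakk> \<Longrightarrow> h (a \<otimes>\<^bsub>A\<^esub> b) = h a \<otimes>\<^bsub>B\<^esub> h b"
    and "\<And>a b. \<lbrakk>a \<in> carrier A; b \<in> carrier A\<rbrakk> \<Longrightarrow> h (a \<oplus>\<^bsub>A\<^esub> b) = h a \<oplus>\<^bsub>B\<^esub> h b"
    and "h \<one>\<^bsub>A\<^esub> = \<one>\<^bsub>B\<^esub>"
    and "\<And>c a. a \<in> carrier A \<Longrightarrow> h (c \<odot>\<^bsub>A\<^esub> a) = c \<odot>\<^bsub>B\<^esub> h a"
  shows "h \<in> alg_hom A B"
  using assms by (auto simp: alg_hom_def ring_hom_def)

lemma alg_homD:
  assumes "h \<in> alg_hom A B"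
  shows alg_hom_closed: "a \<in> carrier A \<Longrightarrow> h a \<in> carrier B"
    and alg_hom_mult: "\<lbrakk>a \<in> carrier A; b \<in> carrier A\<rbrakk> \<Longrightarrow> h (a \<otimes>\<^bsub>A\<^esub> b) = h a \<otimes>\<^bsub>B\<^esub> h b"
    and alg_hom_add: "\<lbrakk>a \<in> carrier A; b \<in> carrier A\<rbrakk> \<Longrightarrow> h (a \<oplus>\<^bsub>A\<^esub> b) = h a \<oplus>\<^bsub>B\<^esub> h b"
    and alg_hom_one: "h \<one>\<^bsub>A\<^esub> = \<one>\<^bsub>B\<^esub>"
    and alg_hom_smult: "a \<in> carrier A \<Longrightarrow> h (c \<odot>\<^bsub>A\<^esub> a) = c \<odot>\<^bsub>B\<^esub> h a"
  using assms by (auto simp: alg_hom_def ring_hom_def)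

lemma alg_hom_comp:
  assumes "h \<in> alg_hom A B" "g \<in> alg_hom B C"
  shows "(\<lambda>a. g (h a)) \<in> alg_hom A C"
  using assms by (auto simp: alg_hom_def ring_hom_def Pi_iff)

context k_algebra
begin

lemmas [simp] = smult_closed smult_one

lemma smult_zero_right [simp]: "c \<odot> \<zero> = \<zero>"
proof -
  have "c \<odot> \<zero> \<oplus> c \<odot> \<zero> = c \<odot> \<zero>"
    using smult_r_distr[of \<zero> \<zero> c] by simp
  then show ?thesis
    using add.r_cancel_one' [of "c \<odot> \<zero>" "c \<odot> \<zero>"] by simp
qed

lemma smult_zero_left [simp]: "x \<in> carrier A \<Longrightarrow> 0 \<odot> x = \<zero>"
proof -
  assume x: "x \<in> carrier A"
  have "0 \<odot> x \<oplus> 0 \<odot> x = 0 \<odot> x"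
    using smult_l_distr[OF x, of 0 0] by simp
  then show ?thesis
    using add.r_cancel_one' [of "0 \<odot> x" "0 \<odot> x"] x by simp
qed

lemma smult_uminus: "x \<in> carrier A \<Longrightarrow> (- c) \<odot> x = \<ominus> (c \<odot> x)"
  using smult_l_distr[of x "- c" c] by (intro minus_equality[symmetric]) auto

lemma smult_inv: "x \<in> carrier A \<Longrightarrow> c \<odot> (\<ominus> x) = \<ominus> (c \<odot> x)"
  using smult_r_distr[of "\<ominus> x" x c] by (intro minus_equality[symmetric]) (auto simp: l_neg)

lemma minus_eq_smult: "\<lbrakk>x \<in> carrier A; y \<in> carrier A\<rbrakk> \<Longrightarrow> x \<ominus> y = x \<oplus> (- 1) \<odot> y"
  by (simp add: smult_uminus a_minus_def)

lemma minus_eq_zero_iff [simp]: "\<lbrakk>x \<in> carrier A; y \<in> carrier A\<rbrakk> \<Longrightarrow> x \<ominus> y = \<zero> \<longleftrightarrow> x = y"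
  by (metis minus_eq r_neg a_inv_closed minus_minus minus_equality)

lemma smult_eq_zeroD: "\<lbrakk>c \<odot> x = \<zero>; c \<noteq> 0; x \<in> carrier A\<rbrakk> \<Longrightarrow> x = \<zero>"
  by (metis smult_assoc smult_one smult_zero_right left_inverse)

lemma smult_left_eq: "x \<in> carrier A \<Longrightarrow> c \<odot> x = (c \<odot> \<one>) \<otimes> x"
  by (simp add: smult_mult_left)

lemma ideal_smult:
  assumes "ideal I A" "a \<in> I"
  shows "c \<odot> a \<in> I"
proof -
  interpret I: ideal I A by fact
  have "a \<in> carrier A" using assms(2) by (rule I.a_Hcarr)
  then show ?thesis
    using I.I_l_closed[OF assms(2), of "c \<odot> \<one>"] by (simp add: smult_left_eq[of a])
qed

end

context
  fixes A :: "('k::field, 'a) module" and B :: "('k, 'b) module" and h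
  assumes A: "k_algebra A" and B: "k_algebra B" and h: "h \<in> alg_hom A B"
begin

interpretation A: k_algebra A by (rule A)
interpretation B: k_algebra B by (rule B)

lemma alg_hom_zero: "h \<zero>\<^bsub>A\<^esub> = \<zero>\<^bsub>B\<^esub>"
  using alg_hom_smult[OF h A.zero_closed, of 0] alg_hom_closed[OF h A.zero_closed] by simp

lemma alg_hom_minus:
  assumes "a \<in> carrier A" "b \<in> carrier A"
  shows "h (a \<ominus>\<^bsub>A\<^esub> b) = h a \<ominus>\<^bsub>B\<^esub> h b"
  using assms alg_homD[OF h] by (simp add: A.minus_eq_smult B.minus_eq_smult)

lemma alg_hom_eq_iff:
  assumes "a \<in> carrier A" "b \<in> carrier A"
  shows "h a = h b \<longleftrightarrow> h (a \<ominus>\<^bsub>A\<^esub> b) = \<zero>\<^bsub>B\<^esub>"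
  using assms alg_hom_closed[OF h] by (simp add: alg_hom_minus)

lemma alg_hom_kernel_ideal: "ideal {a \<in> carrier A. h a = \<zero>\<^bsub>B\<^esub>} A"
proof (rule idealI)
  show "ring A" by (rule A.ring_axioms)
  show "subgroup {a \<in> carrier A. h a = \<zero>\<^bsub>B\<^esub>} (add_monoid A)"
  proof (rule A.add.subgroupI)
    fix a assume a: "a \<in> {a \<in> carrier A. h a = \<zero>\<^bsub>B\<^esub>}"
    then have "h (\<zero>\<^bsub>A\<^esub> \<ominus>\<^bsub>A\<^esub> a) = \<zero>\<^bsub>B\<^esub>"
      using alg_hom_minus[of "\<zero>\<^bsub>A\<^esub>" a] alg_hom_zero by simp
    then show "\<ominus>\<^bsub>A\<^esub> a \<in> {a \<in> carrier A. h a = \<zero>\<^bsub>B\<^esub>}"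
      using a by (simp add: A.minus_eq)
  qed (use alg_homD[OF h] alg_hom_zero in \<open>auto\<close>)
qed (use alg_homD[OF h] in \<open>auto\<close>)

end

text \<open>Every axiom is an identity between elements of the form \<open>h a\<close>, so it can be read off from the
  source. Quotients inherit the axioms in this way.\<close>

lemma k_algebra_surjective_image:
  fixes A :: "('k::field, 'a) module" and B :: "('k, 'b) module"
  assumes A: "k_algebra A" and h: "h \<in> alg_hom A B"
    and zero: "h \<zero>\<^bsub>A\<^esub> = \<zero>\<^bsub>B\<^esub>" and surj: "h ` carrier A = carrier B"
  shows "k_algebra B"
proof -
  interpret A: k_algebra A by fact
  have ex: "\<exists>a\<in>carrier A. y = h a" if "y \<in> carrier B" for y
    using that surj by auto
  note hs = alg_hom_mult[OF h, symmetric] alg_hom_add[OF h, symmetric] alg_hom_one[OF h, symmetric]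
    alg_hom_smult[OF h, symmetric] zero[symmetric] alg_hom_closed[OF h]
  show ?thesis
  proof (intro k_algebra.intro ringI abelian_groupI monoid.intro k_algebra_axioms.intro)
    fix y assume "y \<in> carrier B"
    then obtain a where a: "a \<in> carrier A" "y = h a" using ex by blast
    show "\<exists>z\<in>carrier B. z \<oplus>\<^bsub>B\<^esub> y = \<zero>\<^bsub>B\<^esub>"
      using a by (intro bexI[of _ "h (\<ominus>\<^bsub>A\<^esub> a)"]) (auto simp: hs A.l_neg)
  qed (auto dest!: ex simp: hs A.a_ac A.m_assoc A.l_distr A.r_distr A.smult_l_distr
      A.smult_r_distr A.smult_assoc A.smult_mult_left A.smult_mult_right)
qed

lemma coset_eq_iff:
  assumes "ring A" "additive_subgroup I A" "a \<in> carrier A" "b \<in> carrier A"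
  shows "I +>\<^bsub>A\<^esub> a = I +>\<^bsub>A\<^esub> b \<longleftrightarrow> a \<ominus>\<^bsub>A\<^esub> b \<in> I"
proof -
  interpret ring A by fact
  interpret abelian_subgroup I A
    using assms(2) is_abelian_group by (intro abelian_subgroupI3)
  show ?thesis
    using a_rcos_self[OF assms(3)] a_repr_independence
      a_rcos_module_minus[OF ring_axioms assms(4,3)] assms(3,4) is_abelian_group
    by (metis a_subgroup a_rcos_self)
qed

context
  fixes A :: "('k::field, 'a) module" and I
  assumes A: "k_algebra A" and I: "ideal I A"
begin

interpretation A: k_algebra A by (rule A)
interpretation I: ideal I A by (rule I)

lemma quot_alg_carrier: "carrier (quot_alg A I) = (\<lambda>a. I +>\<^bsub>A\<^esub> a) ` carrier A"
  by (auto simp: quot_alg_def FactRing_def A_RCOSETS_defs a_r_coset_def r_coset_def)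

lemma quot_alg_proj: "(\<lambda>a. I +>\<^bsub>A\<^esub> a) \<in> alg_hom A (quot_alg A I)"
proof (rule alg_homI)
  fix c a assume a: "a \<in> carrier A"
  have "I +>\<^bsub>A\<^esub> c \<odot>\<^bsub>A\<^esub> b = I +>\<^bsub>A\<^esub> c \<odot>\<^bsub>A\<^esub> a" if b: "b \<in> I +>\<^bsub>A\<^esub> a" for b
  proof -
    have bc: "b \<in> carrier A" using b a I.a_elemrcos_carrier by blast
    have "b \<ominus>\<^bsub>A\<^esub> a \<in> I" using b bc a by (simp add: I.a_rcos_module_minus A.ring_axioms)
    then have "c \<odot>\<^bsub>A\<^esub> (b \<ominus>\<^bsub>A\<^esub> a) \<in> I" by (rule A.ideal_smult[OF I])
    then have "c \<odot>\<^bsub>A\<^esub> b \<ominus>\<^bsub>A\<^esub> c \<odot>\<^bsub>A\<^esub> a \<in> I"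
      using a bc by (simp add: A.minus_eq A.smult_r_distr A.smult_inv)
    then show ?thesis
      using a bc by (subst coset_eq_iff) (auto simp: A.ring_axioms I.additive_subgroup_axioms)
  qed
  moreover have "a \<in> I +>\<^bsub>A\<^esub> a" using a by (rule I.a_rcos_self)
  ultimately have "(\<Union>b\<in>I +>\<^bsub>A\<^esub> a. I +>\<^bsub>A\<^esub> c \<odot>\<^bsub>A\<^esub> b) = I +>\<^bsub>A\<^esub> c \<odot>\<^bsub>A\<^esub> a"
    by blast
  then show "I +>\<^bsub>A\<^esub> c \<odot>\<^bsub>A\<^esub> a = c \<odot>\<^bsub>quot_alg A I\<^esub> (I +>\<^bsub>A\<^esub> a)"
    by (simp add: quot_alg_def)
qed (auto simp: quot_alg_carrier; auto simp: quot_alg_def FactRing_def I.rcoset_mult_add I.a_rcos_sum)+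

lemma quot_alg_zero: "\<zero>\<^bsub>quot_alg A I\<^esub> = I"
  by (simp add: quot_alg_def FactRing_def)

lemma quot_alg_coset_eq:
  "\<lbrakk>a \<in> carrier A; b \<in> carrier A\<rbrakk> \<Longrightarrow> I +>\<^bsub>A\<^esub> a = I +>\<^bsub>A\<^esub> b \<longleftrightarrow> a \<ominus>\<^bsub>A\<^esub> b \<in> I"
  by (rule coset_eq_iff[OF A.ring_axioms I.additive_subgroup_axioms])

lemma quot_alg_coset_zero: "I +>\<^bsub>A\<^esub> \<zero>\<^bsub>A\<^esub> = I"
  by (rule I.a_rcos_const[OF I.zero_closed])

lemma quot_alg_coset_eq_zero: "a \<in> carrier A \<Longrightarrow> I +>\<^bsub>A\<^esub> a = I \<longleftrightarrow> a \<in> I"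
  using quot_alg_coset_eq[of a "\<zero>\<^bsub>A\<^esub>"] by (simp add: quot_alg_coset_zero A.minus_eq)

lemma k_algebra_quot_alg: "k_algebra (quot_alg A I)"
  by (rule k_algebra_surjective_image[OF A quot_alg_proj])
     (simp_all add: quot_alg_carrier quot_alg_zero quot_alg_coset_zero)

end

text \<open>The value at \<open>\<eta> a\<close> is \<open>\<theta> a\<close>, independently of the preimage \<open>a\<close>. The target is a bare record so
  that it can be the associated graded algebra, about which only the compatibility of \<open>\<theta>\<close> with the
  operations will be known.\<close>

lemma surjective_factor:
  fixes A :: "('k::field, 'a) module"
  assumes A: "k_algebra A" and \<eta>: "\<eta> \<in> alg_hom A C" "\<eta> ` carrier A = carrier C"
    and \<theta>: "\<theta> \<in> alg_hom A G"
    and fib: "\<And>a b. \<lbrakk>a \<in> carrier A; b \<in> carrier A; \<eta> a = \<eta> b\<rbrakk> \<Longrightarrow> \<theta> a = \<theta> b"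
  obtains p where "p \<in> alg_hom C G" "\<And>a. a \<in> carrier A \<Longrightarrow> p (\<eta> a) = \<theta> a"
proof
  interpret A: k_algebra A by fact
  define p where "p = (\<lambda>c. \<theta> (SOME a. a \<in> carrier A \<and> \<eta> a = c))"
  show p: "p (\<eta> a) = \<theta> a" if "a \<in> carrier A" for a
  proof -
    have "(SOME b. b \<in> carrier A \<and> \<eta> b = \<eta> a) \<in> carrier A \<and> \<eta> (SOME b. b \<in> carrier A \<and> \<eta> b = \<eta> a) = \<eta> a"
      by (rule someI[of _ a]) (use that in simp)
    then show ?thesis unfolding p_def using fib that by blast
  qed
  have ex: "\<exists>a\<in>carrier A. y = \<eta> a" if "y \<in> carrier C" for y
    using that \<eta>(2) by auto
  note hs = alg_hom_mult[OF \<eta>(1), symmetric] alg_hom_add[OF \<eta>(1), symmetric]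
    alg_hom_one[OF \<eta>(1), symmetric] alg_hom_smult[OF \<eta>(1), symmetric]
  show "p \<in> alg_hom C G"
    by (rule alg_homI; (drule ex)?; (drule ex)?) (auto dest!: ex simp: hs p alg_homD[OF \<theta>])
qed

lemma surjective_factor_iso:
  fixes A :: "('k::field, 'a) module"
  assumes A: "k_algebra A" and \<eta>: "\<eta> \<in> alg_hom A C" "\<eta> ` carrier A = carrier C"
    and \<theta>: "\<theta> \<in> alg_hom A G" "\<theta> ` carrier A = carrier G"
    and fib: "\<And>a b. \<lbrakk>a \<in> carrier A; b \<in> carrier A\<rbrakk> \<Longrightarrow> \<eta> a = \<eta> b \<longleftrightarrow> \<theta> a = \<theta> b"
  obtains p where "p \<in> alg_iso C G" "\<And>a. a \<in> carrier A \<Longrightarrow> p (\<eta> a) = \<theta> a"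
proof -
  obtain p where p: "p \<in> alg_hom C G" "\<And>a. a \<in> carrier A \<Longrightarrow> p (\<eta> a) = \<theta> a"
    using surjective_factor[OF A \<eta> \<theta>(1)] fib by blast
  have "bij_betw p (carrier C) (carrier G)"
  proof (rule bij_betw_imageI)
    show "inj_on p (carrier C)"
      unfolding \<eta>(2)[symmetric] using p(2) fib by (auto simp: inj_on_def)
    show "p ` carrier C = carrier G"
      unfolding \<eta>(2)[symmetric] \<theta>(2)[symmetric] using p(2) by (auto simp: image_iff)
  qed
  then show ?thesis using that p by (auto simp: alg_iso_def)
qed

section \<open>Quotients by generated ideals\<close>

context
  fixes A :: "('k::field, 'a) module" and S
  assumes A: "k_algebra A" and S: "S \<subseteq> carrier A"
begin

interpretation A: k_algebra A by (rule A)

abbreviation (input) quot_map where "quot_map \<equiv> (\<lambda>a. Idl\<^bsub>A\<^esub> S +>\<^bsub>A\<^esub> a)"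

lemma quot_by_ideal: "ideal (Idl\<^bsub>A\<^esub> S) A"
  using S by (rule A.genideal_ideal)

lemma k_algebra_quot_by: "k_algebra (quot_by A S)"
  unfolding quot_by_def by (rule k_algebra_quot_alg[OF A quot_by_ideal])

lemma quot_by_proj: "quot_map \<in> alg_hom A (quot_by A S)"
  unfolding quot_by_def by (rule quot_alg_proj[OF A quot_by_ideal])

lemma quot_by_surj: "quot_map ` carrier A = carrier (quot_by A S)"
  unfolding quot_by_def by (simp add: quot_alg_carrier[OF A quot_by_ideal])

lemma quot_by_zero: "\<zero>\<^bsub>quot_by A S\<^esub> = Idl\<^bsub>A\<^esub> S"
  unfolding quot_by_def by (rule quot_alg_zero[OF A quot_by_ideal])

lemma quot_by_eq_zero: "a \<in> carrier A \<Longrightarrow> quot_map a = \<zero>\<^bsub>quot_by A S\<^esub> \<longleftrightarrow> a \<in> Idl\<^bsub>A\<^esub> S"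
  unfolding quot_by_zero by (rule quot_alg_coset_eq_zero[OF A quot_by_ideal])

lemma quot_by_eq:
  "\<lbrakk>a \<in> carrier A; b \<in> carrier A\<rbrakk> \<Longrightarrow> quot_map a = quot_map b \<longleftrightarrow> a \<ominus>\<^bsub>A\<^esub> b \<in> Idl\<^bsub>A\<^esub> S"
  by (rule quot_alg_coset_eq[OF A quot_by_ideal])

lemma quot_by_kills: "s \<in> S \<Longrightarrow> quot_map s = \<zero>\<^bsub>quot_by A S\<^esub>"
  using A.genideal_self[OF S] S quot_by_eq_zero[of s] by (simp add: subset_iff)

lemma kernel_contains_genideal:
  assumes B: "k_algebra B" and h: "h \<in> alg_hom A B"
    and kill: "\<And>s. s \<in> S \<Longrightarrow> h s = \<zero>\<^bsub>B\<^esub>" and a: "a \<in> Idl\<^bsub>A\<^esub> S"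
  shows "h a = \<zero>\<^bsub>B\<^esub>"
proof -
  have "Idl\<^bsub>A\<^esub> S \<subseteq> {a \<in> carrier A. h a = \<zero>\<^bsub>B\<^esub>}"
    using S kill by (intro A.genideal_minimal alg_hom_kernel_ideal[OF A B h]) auto
  then show ?thesis using a by auto
qed

lemma quot_by_factor:
  assumes B: "k_algebra B" and h: "h \<in> alg_hom A B" and kill: "\<And>s. s \<in> S \<Longrightarrow> h s = \<zero>\<^bsub>B\<^esub>"
  obtains g where "g \<in> alg_hom (quot_by A S) B" "\<And>a. a \<in> carrier A \<Longrightarrow> g (quot_map a) = h a"
proof (rule surjective_factor[OF A quot_by_proj quot_by_surj h])
  fix a b assume ab: "a \<in> carrier A" "b \<in> carrier A" "quot_map a = quot_map b"
  then have "h (a \<ominus>\<^bsub>A\<^esub> b) = \<zero>\<^bsub>B\<^esub>"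
    using kernel_contains_genideal[OF B h kill] quot_by_eq by simp
  then show "h a = h b" using ab alg_hom_eq_iff[OF A B h] by simp
qed (use that in blast)

end

lemma quot_by_eq_iff:
  assumes "k_algebra A" "S \<subseteq> carrier A" "S' \<subseteq> carrier A"
  shows "quot_by A S = quot_by A S' \<longleftrightarrow> Idl\<^bsub>A\<^esub> S = Idl\<^bsub>A\<^esub> S'"
  using quot_by_zero[OF assms(1,2)] quot_by_zero[OF assms(1,3)] by (metis quot_by_def)

lemma k_subspace_carrier: "k_algebra A \<Longrightarrow> k_subspace A (carrier A)"
proof -
  assume "k_algebra A"
  then interpret k_algebra A .
  show ?thesis by (simp add: k_subspace_def)
qed

lemma k_span_subspace:
  assumes "k_algebra A" "S \<subseteq> carrier A"
  shows "k_subspace A (k_span A S)"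
proof -
  have "\<zero>\<^bsub>A\<^esub> \<in> U \<and> (\<forall>x\<in>U. \<forall>y\<in>U. x \<oplus>\<^bsub>A\<^esub> y \<in> U) \<and> (\<forall>c. \<forall>x\<in>U. c \<odot>\<^bsub>A\<^esub> x \<in> U)"
    if "k_subspace A U" for U
    using that by (simp add: k_subspace_def)
  moreover have "k_span A S \<subseteq> carrier A"
    using k_subspace_carrier[OF assms(1)] assms(2) by (auto simp: k_span_def)
  ultimately show ?thesis
    unfolding k_subspace_def[of A "k_span A S"] by (simp add: k_span_def)
qed

lemma k_span_superset: "S \<subseteq> k_span A S"
  by (auto simp: k_span_def)

lemma k_span_minimal: "\<lbrakk>k_subspace A U; S \<subseteq> U\<rbrakk> \<Longrightarrow> k_span A S \<subseteq> U"
  by (auto simp: k_span_def)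

lemma ideal_k_subspace:
  assumes "k_algebra A" "ideal I A"
  shows "k_subspace A I"
proof -
  interpret k_algebra A by fact
  interpret I: ideal I A by fact
  show ?thesis
    using I.a_subset I.zero_closed I.a_closed ideal_smult[OF assms(2)] by (simp add: k_subspace_def)
qed

text \<open>Relations given as a list of elements and relations given as a linear space define the same
  quotient; the first describes skew Clifford algebras, the second deformations.\<close>

lemma genideal_k_span:
  assumes A: "k_algebra A" and S: "S \<subseteq> carrier A"
  shows "Idl\<^bsub>A\<^esub> (k_span A S) = Idl\<^bsub>A\<^esub> S"
proof -
  interpret k_algebra A by fact
  have sub: "k_span A S \<subseteq> carrier A"
    using k_span_subspace[OF A S] by (simp add: k_subspace_def)
  show ?thesis
  proof
    show "Idl\<^bsub>A\<^esub> (k_span A S) \<subseteq> Idl\<^bsub>A\<^esub> S"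
      by (intro genideal_minimal genideal_ideal k_span_minimal ideal_k_subspace A S genideal_self)
    show "Idl\<^bsub>A\<^esub> S \<subseteq> Idl\<^bsub>A\<^esub> (k_span A S)"
      using subset_trans[OF k_span_superset genideal_self[OF sub]]
      by (intro genideal_minimal genideal_ideal sub)
  qed
qed

section \<open>The free algebra\<close>

lemma free_algebra_carrier:
  "f \<in> carrier (free_algebra W) \<longleftrightarrow> finite {w. f w \<noteq> 0} \<and> {w. f w \<noteq> 0} \<subseteq> lists W"
  by (simp add: free_algebra_def)

lemma free_algebra_support:
  assumes "f \<in> carrier (free_algebra W)" "f w \<noteq> 0"
  shows "w \<in> lists W"
proof -
  have "{w. f w \<noteq> 0} \<subseteq> lists W" using assms(1) by (simp add: free_algebra_carrier)
  then show ?thesis by (rule subsetD) (simp add: assms(2))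
qed

lemma free_algebra_simps:
  "f \<otimes>\<^bsub>free_algebra W\<^esub> g = (\<lambda>w. \<Sum>k\<le>length w. f (take k w) * g (drop k w))"
  "\<one>\<^bsub>free_algebra W\<^esub> = word []"
  "\<zero>\<^bsub>free_algebra W\<^esub> = (\<lambda>w. 0)"
  "f \<oplus>\<^bsub>free_algebra W\<^esub> g = (\<lambda>w. f w + g w)"
  "c \<odot>\<^bsub>free_algebra W\<^esub> f = (\<lambda>w. c * f w)"
  by (simp_all add: free_algebra_def word_def)

lemma free_algebra_mult_closed:
  assumes "f \<in> carrier (free_algebra W)" "g \<in> carrier (free_algebra W)"
  shows "(\<lambda>w. \<Sum>k\<le>length w. f (take k w) * g (drop k w)) \<in> carrier (free_algebra W)"
    (is "?h \<in> _")
proof -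
  let ?S = "(\<lambda>(u, v). u @ v) ` ({w. f w \<noteq> 0} \<times> {w. g w \<noteq> 0})"
  have "{w. ?h w \<noteq> 0} \<subseteq> ?S"
  proof clarify
    fix w assume "?h w \<noteq> 0"
    then obtain k where "f (take k w) * g (drop k w) \<noteq> 0"
      by (meson sum.not_neutral_contains_not_neutral)
    then show "w \<in> ?S"
      by (intro image_eqI[of _ _ "(take k w, drop k w)"]) auto
  qed
  moreover have "finite ?S"
    using assms by (simp add: free_algebra_carrier)
  moreover have "?S \<subseteq> lists W"
  proof
    fix w assume "w \<in> ?S"
    then obtain u v where w: "w = u @ v" "f u \<noteq> 0" "g v \<noteq> 0"
      by (elim imageE SigmaE) simp
    then show "w \<in> lists W"
      using free_algebra_support[OF assms(1) w(2)] free_algebra_support[OF assms(2) w(3)] by simp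
  qed
  ultimately show ?thesis
    unfolding free_algebra_carrier by (meson finite_subset subset_trans)
qed

text \<open>Both sides sum over all factorisations of \<open>w\<close> into three consecutive factors, of lengths \<open>i\<close>, \<open>j\<close>
  and the rest; the reindexing is \<open>k = i + j\<close>.\<close>

lemma free_algebra_mult_assoc:
  fixes f g h :: "'v list \<Rightarrow> 'k::field"
  shows "(\<Sum>k\<le>length w. (\<Sum>j\<le>length (take k w). f (take j (take k w)) * g (drop j (take k w))) * h (drop k w)) =
    (\<Sum>i\<le>length w. f (take i w) *
       (\<Sum>j\<le>length (drop i w). g (take j (drop i w)) * h (drop j (drop i w))))"
proof -
  let ?n = "length w"
  let ?G = "\<lambda>i j. f (take i w) * g (take j (drop i w)) * h (drop (i + j) w)"
  have "(\<Sum>k\<le>?n. (\<Sum>j\<le>length (take k w). f (take j (take k w)) * g (drop j (take k w))) * h (drop k w))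
      = (\<Sum>k\<le>?n. \<Sum>i\<le>k. ?G i (k - i))"
    by (intro sum.cong refl) (auto simp: sum_distrib_right drop_take min_def intro!: sum.cong)
  also have "\<dots> = (\<Sum>(i, j)\<in>{(i, j). i + j \<le> ?n}. ?G i j)"
    by (rule sum.triangle_reindex_eq[symmetric])
  also have "{(i, j). i + j \<le> ?n} = Sigma {..?n} (\<lambda>i. {..?n - i})"
    by auto
  also have "(\<Sum>(i, j)\<in>Sigma {..?n} (\<lambda>i. {..?n - i}). ?G i j) = (\<Sum>i\<le>?n. \<Sum>j\<le>?n - i. ?G i j)"
    by (rule sum.Sigma[symmetric]) auto
  also have "\<dots> = (\<Sum>i\<le>?n. f (take i w) *
       (\<Sum>j\<le>length (drop i w). g (take j (drop i w)) * h (drop j (drop i w))))"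
    by (intro sum.cong refl) (simp add: sum_distrib_left mult.assoc add.commute)
  finally show ?thesis .
qed

lemma word_mult_left:
  fixes f :: "'v list \<Rightarrow> 'k::field"
  shows "(\<Sum>k\<le>length w. word [] (take k w) * f (drop k w)) = f w"
proof -
  have "(\<Sum>k\<le>length w. word [] (take k w) * f (drop k w)) = (\<Sum>k\<in>{0}. f (drop k w))"
    by (rule sum.mono_neutral_cong_right) (auto simp: word_def)
  then show ?thesis by simp
qed

lemma word_mult_right:
  fixes f :: "'v list \<Rightarrow> 'k::field"
  shows "(\<Sum>k\<le>length w. f (take k w) * word [] (drop k w)) = f w"
proof -
  have "(\<Sum>k\<le>length w. f (take k w) * word [] (drop k w)) = (\<Sum>k\<in>{length w}. f (take k w))"
    by (rule sum.mono_neutral_cong_right) (auto simp: word_def)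
  then show ?thesis by simp
qed

lemma k_algebra_free_algebra: "k_algebra (free_algebra W :: ('k::field, 'v list \<Rightarrow> 'k) module)"
proof -
  have add: "(\<lambda>w. f w + g w) \<in> carrier (free_algebra W)"
    if "f \<in> carrier (free_algebra W)" "g \<in> carrier (free_algebra W)" for f g :: "'v list \<Rightarrow> 'k"
  proof -
    have sub: "{w. f w + g w \<noteq> 0} \<subseteq> {w. f w \<noteq> 0} \<union> {w. g w \<noteq> 0}" by auto
    have "finite ({w. f w \<noteq> 0} \<union> {w. g w \<noteq> 0})" "{w. f w \<noteq> 0} \<union> {w. g w \<noteq> 0} \<subseteq> lists W"
      using that by (simp_all add: free_algebra_carrier)
    then show ?thesis
      unfolding free_algebra_carrier by (intro conjI finite_subset[OF sub] subset_trans[OF sub])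
  qed
  have smult: "(\<lambda>w. c * f w) \<in> carrier (free_algebra W)"
    if "f \<in> carrier (free_algebra W)" for f :: "'v list \<Rightarrow> 'k" and c
    using that by (auto simp: free_algebra_carrier)
  have neg: "\<exists>g\<in>carrier (free_algebra W). \<forall>w. g w + f w = 0"
    if "f \<in> carrier (free_algebra W)" for f :: "'v list \<Rightarrow> 'k"
    using smult[OF that, of "- 1"] by (intro bexI[of _ "\<lambda>w. - 1 * f w"]) auto
  have one: "word [] \<in> carrier (free_algebra W)" and zero: "(\<lambda>w. 0) \<in> carrier (free_algebra W)"
    by (auto simp: free_algebra_carrier word_def)
  show ?thesis
  proof (intro k_algebra.intro ringI abelian_groupI monoid.intro k_algebra_axioms.intro,
      unfold free_algebra_simps, goal_cases)
    case 6
    then show ?case using neg by (simp add: fun_eq_iff)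
  next
    case 8
    show ?case by (rule ext) (rule free_algebra_mult_assoc)
  qed (simp_all only: add smult one zero free_algebra_mult_closed word_mult_left word_mult_right,
      simp_all add: fun_eq_iff ring_distribs sum.distrib sum_distrib_left mult.assoc mult.left_commute)
qed

lemma word_closed: "w \<in> lists W \<Longrightarrow> word w \<in> carrier (free_algebra W)"
  by (auto simp: free_algebra_carrier word_def)

lemma word_mult_word: "word u \<otimes>\<^bsub>free_algebra W\<^esub> word v = word (u @ v)"
proof
  fix w :: "'a list"
  have eq: "take k w = u \<and> drop k w = v \<longleftrightarrow> k = length u \<and> w = u @ v" if "k \<le> length w" for k
    using that by (auto simp: append_eq_conv_conj)
  have "(\<Sum>k\<le>length w. word u (take k w) * word v (drop k w)) =
        (\<Sum>k\<in>(if w = u @ v then {length u} else {}). (1::'b))"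
  proof (intro sum.mono_neutral_cong_right ballI)
    fix k assume "k \<in> {..length w} - (if w = u @ v then {length u} else {})"
    then show "word u (take k w) * word v (drop k w) = (0::'b)"
      using eq[of k] by (auto simp: word_def split: if_splits)
  qed (auto simp: word_def split: if_splits)
  then show "(word u \<otimes>\<^bsub>free_algebra W\<^esub> word v) w = (word (u @ v) w :: 'b)"
    by (auto simp: free_algebra_simps word_def)
qed

text \<open>Adding one word of the support at a time. Remembering that the words come from the support of
  the given element makes statements about degrees accessible to this induction.\<close>

lemma free_algebra_induct_support [consumes 1, case_names zero add]:
  assumes f: "f \<in> carrier (free_algebra W)"
    and zero: "P \<zero>\<^bsub>free_algebra W\<^esub>"
    and add: "\<And>g c w. \<lbrakk>g \<in> carrier (free_algebra W); P g; w \<in> lists W; f w \<noteq> 0\<rbrakk>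
        \<Longrightarrow> P (g \<oplus>\<^bsub>free_algebra W\<^esub> c \<odot>\<^bsub>free_algebra W\<^esub> word w)"
  shows "P f"
proof -
  have "P g" if "finite S" "S \<subseteq> {w. f w \<noteq> 0}" "{w. g w \<noteq> 0} \<subseteq> S" for S g
    using that
  proof (induction S arbitrary: g rule: finite_induct)
    case empty
    then have "g = \<zero>\<^bsub>free_algebra W\<^esub>" by (auto simp: free_algebra_simps)
    then show ?case using zero by simp
  next
    case (insert w S)
    let ?g = "g(w := 0)"
    have w: "f w \<noteq> 0" "w \<in> lists W"
      using insert.prems free_algebra_support[OF f, of w] by auto
    have sub: "{u. ?g u \<noteq> 0} \<subseteq> S" using insert.prems by auto
    have "S \<subseteq> lists W" using insert.prems free_algebra_support[OF f] by auto
    then have g: "?g \<in> carrier (free_algebra W)"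
      unfolding free_algebra_carrier using sub insert.hyps by (meson finite_subset subset_trans)
    have "P ?g" using insert.prems sub by (intro insert.IH) auto
    then have "P (?g \<oplus>\<^bsub>free_algebra W\<^esub> g w \<odot>\<^bsub>free_algebra W\<^esub> word w)"
      using add[OF g] w by simp
    moreover have "?g \<oplus>\<^bsub>free_algebra W\<^esub> g w \<odot>\<^bsub>free_algebra W\<^esub> word w = g"
      by (auto simp: free_algebra_simps word_def)
    ultimately show ?case by simp
  qed
  then show ?thesis using f by (auto simp: free_algebra_carrier)
qed

lemma free_algebra_induct [consumes 1, case_names zero add]:
  assumes "f \<in> carrier (free_algebra W)" "P \<zero>\<^bsub>free_algebra W\<^esub>"
    and "\<And>f c w. \<lbrakk>f \<in> carrier (free_algebra W); P f; w \<in> lists W\<rbrakk>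
        \<Longrightarrow> P (f \<oplus>\<^bsub>free_algebra W\<^esub> c \<odot>\<^bsub>free_algebra W\<^esub> word w)"
  shows "P f"
  using assms(1) by (rule free_algebra_induct_support) (use assms(2,3) in auto)

lemma free_algebra_minus:
  assumes "f \<in> carrier (free_algebra W)" "g \<in> carrier (free_algebra W)"
  shows "f \<ominus>\<^bsub>free_algebra W\<^esub> g = (\<lambda>w. f w - g w)"
  by (simp add: k_algebra.minus_eq_smult[OF k_algebra_free_algebra assms] free_algebra_simps)

text \<open>An element is a linear combination of the words that occur in it. This lets one check membership
  in a span (of pure tensors of a given degree, say) on words.\<close>

lemma free_algebra_image_in_subspace:
  fixes B :: "('k::field, 'b) module"
  assumes B: "k_algebra B" and h: "h \<in> alg_hom (free_algebra W) B" and U: "k_subspace B U"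
    and f: "f \<in> carrier (free_algebra W)" and words: "\<And>w. f w \<noteq> 0 \<Longrightarrow> h (word w) \<in> U"
  shows "h f \<in> U"
  using f
proof (induction f rule: free_algebra_induct_support)
  case zero
  then show ?case using U alg_hom_zero[OF k_algebra_free_algebra B h] by (simp add: k_subspace_def)
next
  case (add g c w)
  interpret FA: k_algebra "free_algebra W :: ('k, 'a list \<Rightarrow> 'k) module"
    by (rule k_algebra_free_algebra)
  show ?case
    using add words[of w] U
    by (simp add: alg_hom_add[OF h] alg_hom_smult[OF h] word_closed k_subspace_def)
qed

text \<open>The universal property of the free algebra: a map \<open>g\<close> from the letters to an algebra \<open>B\<close> extends to the
  homomorphism \<open>free_hom B g\<close>.\<close>

definition word_prod :: "('k, 'b) module \<Rightarrow> ('v \<Rightarrow> 'b) \<Rightarrow> 'v list \<Rightarrow> 'b" where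
  "word_prod B g w = foldr (\<lambda>v b. g v \<otimes>\<^bsub>B\<^esub> b) w \<one>\<^bsub>B\<^esub>"

definition free_hom :: "('k::field, 'b) module \<Rightarrow> ('v \<Rightarrow> 'b) \<Rightarrow> ('v list \<Rightarrow> 'k) \<Rightarrow> 'b" where
  "free_hom B g f = (\<Oplus>\<^bsub>B\<^esub>w\<in>{w. f w \<noteq> 0}. f w \<odot>\<^bsub>B\<^esub> word_prod B g w)"

lemma word_prod_simps [simp]:
  "word_prod B g [] = \<one>\<^bsub>B\<^esub>"
  "word_prod B g (v # w) = g v \<otimes>\<^bsub>B\<^esub> word_prod B g w"
  by (simp_all add: word_prod_def)

context
  fixes B :: "('k::field, 'b) module" and W :: "'v set" and g :: "'v \<Rightarrow> 'b"
  assumes B: "k_algebra B" and g: "\<And>v. v \<in> W \<Longrightarrow> g v \<in> carrier B"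
begin

interpretation B: k_algebra B by (rule B)
interpretation FA: k_algebra "free_algebra W :: ('k, 'v list \<Rightarrow> 'k) module"
  by (rule k_algebra_free_algebra)

lemma word_prod_closed: "w \<in> lists W \<Longrightarrow> word_prod B g w \<in> carrier B"
  by (induction w) (auto simp: g)

lemma word_prod_append:
  "\<lbrakk>u \<in> lists W; v \<in> lists W\<rbrakk> \<Longrightarrow> word_prod B g (u @ v) = word_prod B g u \<otimes>\<^bsub>B\<^esub> word_prod B g v"
  by (induction u) (auto simp: g word_prod_closed B.m_assoc)

lemma free_hom_superset:
  assumes "finite S" "S \<subseteq> lists W" "{w. f w \<noteq> 0} \<subseteq> S"
  shows "free_hom B g f = (\<Oplus>\<^bsub>B\<^esub>w\<in>S. f w \<odot>\<^bsub>B\<^esub> word_prod B g w)"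
  unfolding free_hom_def
proof (intro B.add.finprod_mono_neutral_cong_left)
  show "f i \<odot>\<^bsub>B\<^esub> word_prod B g i = \<zero>\<^bsub>B\<^esub>" if "i \<in> S - {w. f w \<noteq> 0}" for i
    using that word_prod_closed[of i] subsetD[OF assms(2), of i] by simp
  show "(\<lambda>w. f w \<odot>\<^bsub>B\<^esub> word_prod B g w) \<in> S \<rightarrow> carrier B"
    using assms(2) by (auto intro!: B.smult_closed word_prod_closed)
qed (use assms in auto)

lemma free_hom_add_word:
  assumes f: "f \<in> carrier (free_algebra W)" and w: "w \<in> lists W"
  shows "free_hom B g (f \<oplus>\<^bsub>free_algebra W\<^esub> c \<odot>\<^bsub>free_algebra W\<^esub> word w) = free_hom B g f \<oplus>\<^bsub>B\<^esub> c \<odot>\<^bsub>B\<^esub> word_prod B g w"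
proof -
  let ?S = "{u. f u \<noteq> 0} - {w}"
  have S: "finite ?S" "?S \<subseteq> lists W" "finite (insert w ?S)" "insert w ?S \<subseteq> lists W"
    using f w by (auto simp: free_algebra_carrier)
  have cl: "(\<lambda>u. a u \<odot>\<^bsub>B\<^esub> word_prod B g u) \<in> ?S \<rightarrow> carrier B" for a
    using S by (auto intro!: B.smult_closed word_prod_closed)
  have rest: "(\<Oplus>\<^bsub>B\<^esub>u\<in>?S. (f u + c * word w u) \<odot>\<^bsub>B\<^esub> word_prod B g u) =
      (\<Oplus>\<^bsub>B\<^esub>u\<in>?S. f u \<odot>\<^bsub>B\<^esub> word_prod B g u)"
    using cl by (intro B.add.finprod_cong') (auto simp: word_def)
  have "free_hom B g (f \<oplus>\<^bsub>free_algebra W\<^esub> c \<odot>\<^bsub>free_algebra W\<^esub> word w) =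
      (\<Oplus>\<^bsub>B\<^esub>u\<in>insert w ?S. (f u + c * word w u) \<odot>\<^bsub>B\<^esub> word_prod B g u)"
    unfolding free_algebra_simps
    using S by (intro free_hom_superset) (auto simp: word_def split: if_splits)
  also have "\<dots> = (f w + c) \<odot>\<^bsub>B\<^esub> word_prod B g w \<oplus>\<^bsub>B\<^esub> (\<Oplus>\<^bsub>B\<^esub>u\<in>?S. f u \<odot>\<^bsub>B\<^esub> word_prod B g u)"
    using S w cl by (subst B.finsum_insert) (auto simp: word_prod_closed rest, simp add: word_def)
  also have "\<dots> = (f w \<odot>\<^bsub>B\<^esub> word_prod B g w \<oplus>\<^bsub>B\<^esub> (\<Oplus>\<^bsub>B\<^esub>u\<in>?S. f u \<odot>\<^bsub>B\<^esub> word_prod B g u))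
      \<oplus>\<^bsub>B\<^esub> c \<odot>\<^bsub>B\<^esub> word_prod B g w"
    using w cl by (simp add: B.smult_l_distr word_prod_closed B.a_ac)
  also have "f w \<odot>\<^bsub>B\<^esub> word_prod B g w \<oplus>\<^bsub>B\<^esub> (\<Oplus>\<^bsub>B\<^esub>u\<in>?S. f u \<odot>\<^bsub>B\<^esub> word_prod B g u) =
      (\<Oplus>\<^bsub>B\<^esub>u\<in>insert w ?S. f u \<odot>\<^bsub>B\<^esub> word_prod B g u)"
    using S w cl by (subst B.finsum_insert) (auto simp: word_prod_closed)
  also have "\<dots> = free_hom B g f"
    using S by (intro free_hom_superset[symmetric]) auto
  finally show ?thesis .
qed

lemma free_hom_zero: "free_hom B g \<zero>\<^bsub>free_algebra W\<^esub> = \<zero>\<^bsub>B\<^esub>"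
  by (simp add: free_hom_def free_algebra_simps)

lemma free_hom_closed: "f \<in> carrier (free_algebra W) \<Longrightarrow> free_hom B g f \<in> carrier B"
  by (induction f rule: free_algebra_induct)
     (auto simp: free_hom_zero free_hom_add_word word_prod_closed)

lemma free_hom_word: "w \<in> lists W \<Longrightarrow> free_hom B g (word w) = word_prod B g w"
  using free_hom_add_word[OF FA.zero_closed, of w 1]
  by (simp add: free_hom_zero word_prod_closed word_closed)

lemma free_hom_add:
  assumes a: "a \<in> carrier (free_algebra W)" and b: "b \<in> carrier (free_algebra W)"
  shows "free_hom B g (a \<oplus>\<^bsub>free_algebra W\<^esub> b) = free_hom B g a \<oplus>\<^bsub>B\<^esub> free_hom B g b"
  using b
proof (induction b rule: free_algebra_induct)
  case zero
  then show ?case using a by (simp add: free_hom_closed free_hom_zero)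
next
  case (add f c w)
  have "a \<oplus>\<^bsub>free_algebra W\<^esub> (f \<oplus>\<^bsub>free_algebra W\<^esub> c \<odot>\<^bsub>free_algebra W\<^esub> word w) =
      (a \<oplus>\<^bsub>free_algebra W\<^esub> f) \<oplus>\<^bsub>free_algebra W\<^esub> c \<odot>\<^bsub>free_algebra W\<^esub> word w"
    using a add by (simp add: FA.a_assoc word_closed)
  then show ?case
    using add a by (simp add: free_hom_add_word free_hom_closed word_prod_closed B.a_assoc)
qed

lemma free_hom_smult:
  assumes a: "a \<in> carrier (free_algebra W)"
  shows "free_hom B g (d \<odot>\<^bsub>free_algebra W\<^esub> a) = d \<odot>\<^bsub>B\<^esub> free_hom B g a"
  using a
proof (induction a rule: free_algebra_induct)
  case zero
  then show ?case by (simp add: free_hom_zero)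
next
  case (add f c w)
  have "d \<odot>\<^bsub>free_algebra W\<^esub> (f \<oplus>\<^bsub>free_algebra W\<^esub> c \<odot>\<^bsub>free_algebra W\<^esub> word w) =
      d \<odot>\<^bsub>free_algebra W\<^esub> f \<oplus>\<^bsub>free_algebra W\<^esub> (d * c) \<odot>\<^bsub>free_algebra W\<^esub> word w"
    using add by (simp add: FA.smult_r_distr FA.smult_assoc word_closed)
  then show ?case
    using add
    by (simp add: free_hom_add_word free_hom_closed word_prod_closed B.smult_r_distr B.smult_assoc)
qed

text \<open>Both sides are bilinear, so the claim reduces to two words, whose product is their
  concatenation.\<close>

lemma free_hom_mult:
  assumes a: "a \<in> carrier (free_algebra W)" and b: "b \<in> carrier (free_algebra W)"
  shows "free_hom B g (a \<otimes>\<^bsub>free_algebra W\<^esub> b) = free_hom B g a \<otimes>\<^bsub>B\<^esub> free_hom B g b"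
proof -
  have word: "free_hom B g (word u \<otimes>\<^bsub>free_algebra W\<^esub> b) = word_prod B g u \<otimes>\<^bsub>B\<^esub> free_hom B g b"
    if u: "u \<in> lists W" for u
    using b
  proof (induction b rule: free_algebra_induct)
    case zero
    then show ?case
      using u by (simp add: word_closed free_hom_zero word_prod_closed)
  next
    case (add f c w)
    then show ?case
      using u
      by (simp add: word_closed FA.r_distr FA.smult_mult_right word_mult_word free_hom_add free_hom_smult
          free_hom_word word_prod_append word_prod_closed free_hom_closed B.r_distr B.smult_mult_right)
  qed
  show ?thesis
    using a
  proof (induction a rule: free_algebra_induct)
    case zero
    then show ?case
      using b by (simp add: word_closed free_hom_zero free_hom_closed)
  next
    case (add f c w)
    then show ?case
      using b
      by (simp add: word_closed FA.l_distr FA.smult_mult_left word free_hom_add free_hom_smult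
          free_hom_word word_prod_closed free_hom_closed B.l_distr B.smult_mult_left)
  qed
qed

lemma free_hom_alg_hom: "free_hom B g \<in> alg_hom (free_algebra W) B"
  using free_hom_word[of "[]"]
  by (intro alg_homI free_hom_closed free_hom_mult free_hom_add free_hom_smult)
     (simp_all add: free_algebra_simps)

text \<open>Identities between homomorphisms out of free algebras, and hence out of their quotients, are
  checked on letters below; this is the reason why that suffices.\<close>

lemma free_hom_unique:
  assumes h: "h \<in> alg_hom (free_algebra W) B" and hg: "\<And>v. v \<in> W \<Longrightarrow> h (word [v]) = g v"
    and a: "a \<in> carrier (free_algebra W)"
  shows "h a = free_hom B g a"
proof -
  have word: "h (word w) = word_prod B g w" if "w \<in> lists W" for w
    using that
  proof (induction w)
    case Nil
    then show ?case using alg_hom_one[OF h] by (simp add: free_algebra_simps)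
  next
    case (Cons v w)
    then have "h (word ([v] @ w)) = h (word [v]) \<otimes>\<^bsub>B\<^esub> h (word w)"
      unfolding word_mult_word[where W = W, symmetric]
      by (intro alg_hom_mult[OF h] word_closed) auto
    then show ?case using Cons hg by simp
  qed
  show ?thesis
    using a
  proof (induction a rule: free_algebra_induct)
    case zero
    then show ?case
      by (simp add: alg_hom_zero[OF k_algebra_free_algebra B h] free_hom_zero)
  next
    case (add f c w)
    then show ?case
      by (simp add: word_closed alg_hom_add[OF h] alg_hom_smult[OF h] word free_hom_add free_hom_smult
          free_hom_word)
  qed
qed

end

section \<open>Degrees in the free algebra\<close>

definition homogeneous :: "'v set \<Rightarrow> nat \<Rightarrow> ('v list \<Rightarrow> 'k::field) set" where
  "homogeneous J d = {f \<in> carrier (free_algebra J). \<forall>w. f w \<noteq> 0 \<longrightarrow> length w = d}"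

definition degree_le :: "'v set \<Rightarrow> nat \<Rightarrow> ('v list \<Rightarrow> 'k::field) set" where
  "degree_le J d = {f \<in> carrier (free_algebra J). \<forall>w. f w \<noteq> 0 \<longrightarrow> length w \<le> d}"

definition component :: "nat \<Rightarrow> ('v list \<Rightarrow> 'k::field) \<Rightarrow> 'v list \<Rightarrow> 'k" where
  "component d f = (\<lambda>w. if length w = d then f w else 0)"

lemma homogeneousD: "\<lbrakk>f \<in> homogeneous J d; length w \<noteq> d\<rbrakk> \<Longrightarrow> f w = 0"
  by (auto simp: homogeneous_def)

lemma degree_leD: "\<lbrakk>f \<in> degree_le J d; \<not> length w \<le> d\<rbrakk> \<Longrightarrow> f w = 0"
  by (auto simp: degree_le_def)

lemma homogeneousI:
  "\<lbrakk>f \<in> carrier (free_algebra J); \<And>w. length w \<noteq> d \<Longrightarrow> f w = 0\<rbrakk> \<Longrightarrow> f \<in> homogeneous J d"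
  by (auto simp: homogeneous_def)

lemma degree_leI:
  "\<lbrakk>f \<in> carrier (free_algebra J); \<And>w. \<not> length w \<le> d \<Longrightarrow> f w = 0\<rbrakk> \<Longrightarrow> f \<in> degree_le J d"
  by (auto simp: degree_le_def)

lemma homogeneous_subspace: "k_subspace (free_algebra J) (homogeneous J d)"
proof -
  interpret FA: k_algebra "free_algebra J :: ('b, 'a list \<Rightarrow> 'b) module"
    by (rule k_algebra_free_algebra)
  have cl: "f \<in> carrier (free_algebra J)" if "f \<in> homogeneous J d" for f :: "'a list \<Rightarrow> 'b"
    using that by (simp add: homogeneous_def)
  show ?thesis
    unfolding k_subspace_def
  proof (intro conjI ballI allI subsetI)
    fix f g :: "'a list \<Rightarrow> 'b" and c
    assume f: "f \<in> homogeneous J d"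
    show "f \<in> carrier (free_algebra J)" using f by (rule cl)
    show "c \<odot>\<^bsub>free_algebra J\<^esub> f \<in> homogeneous J d"
      using FA.smult_closed[OF cl[OF f]] by (rule homogeneousI) (simp add: free_algebra_simps homogeneousD[OF f])
    assume g: "g \<in> homogeneous J d"
    show "f \<oplus>\<^bsub>free_algebra J\<^esub> g \<in> homogeneous J d"
      using FA.a_closed[OF cl[OF f] cl[OF g]]
      by (rule homogeneousI) (simp add: free_algebra_simps homogeneousD[OF f] homogeneousD[OF g])
  next
    show "\<zero>\<^bsub>free_algebra J\<^esub> \<in> (homogeneous J d :: ('a list \<Rightarrow> 'b) set)"
      using FA.zero_closed by (rule homogeneousI) (simp add: free_algebra_simps)
  qed
qed

lemma degree_le_subspace: "k_subspace (free_algebra J) (degree_le J d)"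
proof -
  interpret FA: k_algebra "free_algebra J :: ('b, 'a list \<Rightarrow> 'b) module"
    by (rule k_algebra_free_algebra)
  have cl: "f \<in> carrier (free_algebra J)" if "f \<in> degree_le J d" for f :: "'a list \<Rightarrow> 'b"
    using that by (simp add: degree_le_def)
  show ?thesis
    unfolding k_subspace_def
  proof (intro conjI ballI allI subsetI)
    fix f g :: "'a list \<Rightarrow> 'b" and c
    assume f: "f \<in> degree_le J d"
    show "f \<in> carrier (free_algebra J)" using f by (rule cl)
    show "c \<odot>\<^bsub>free_algebra J\<^esub> f \<in> degree_le J d"
      using FA.smult_closed[OF cl[OF f]] by (rule degree_leI) (simp add: free_algebra_simps degree_leD[OF f])
    assume g: "g \<in> degree_le J d"
    show "f \<oplus>\<^bsub>free_algebra J\<^esub> g \<in> degree_le J d"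
      using FA.a_closed[OF cl[OF f] cl[OF g]]
      by (rule degree_leI) (simp add: free_algebra_simps degree_leD[OF f] degree_leD[OF g])
  next
    show "\<zero>\<^bsub>free_algebra J\<^esub> \<in> (degree_le J d :: ('a list \<Rightarrow> 'b) set)"
      using FA.zero_closed by (rule degree_leI) (simp add: free_algebra_simps)
  qed
qed

lemma homogeneous_word: "\<lbrakk>w \<in> lists J; length w = d\<rbrakk> \<Longrightarrow> word w \<in> homogeneous J d"
  by (simp add: homogeneous_def word_closed) (simp add: word_def)

lemma homogeneous_degree_le: "\<lbrakk>f \<in> homogeneous J d; d \<le> e\<rbrakk> \<Longrightarrow> f \<in> degree_le J e"
  by (auto simp: homogeneous_def degree_le_def)

lemma degree_le_mono: "\<lbrakk>f \<in> degree_le J d; d \<le> e\<rbrakk> \<Longrightarrow> f \<in> degree_le J e"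
  unfolding degree_le_def using order_trans by blast

lemma component_carrier:
  assumes "f \<in> carrier (free_algebra J)"
  shows "component d f \<in> carrier (free_algebra J)"
proof -
  have sub: "{w. component d f w \<noteq> 0} \<subseteq> {w. f w \<noteq> 0}" by (auto simp: component_def)
  show ?thesis
    using assms unfolding free_algebra_carrier
    by (intro conjI finite_subset[OF sub] subset_trans[OF sub]) simp_all
qed

lemma component_homogeneous:
  "f \<in> carrier (free_algebra J) \<Longrightarrow> component d f \<in> homogeneous J d"
  by (auto simp: homogeneous_def component_carrier) (auto simp: component_def split: if_splits)

lemma component_of_homogeneous:
  "f \<in> homogeneous J d \<Longrightarrow> component e f = (if e = d then f else (\<lambda>w. 0))"
  by (auto simp: component_def homogeneous_def fun_eq_iff)

lemma component_add: "component d (f \<oplus>\<^bsub>free_algebra J\<^esub> g) = component d f \<oplus>\<^bsub>free_algebra J\<^esub> component d g"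
  by (auto simp: component_def free_algebra_simps)

lemma component_smult: "component d (c \<odot>\<^bsub>free_algebra J\<^esub> g) = c \<odot>\<^bsub>free_algebra J\<^esub> component d g"
  by (auto simp: component_def free_algebra_simps)

lemma component_minus:
  assumes "f \<in> carrier (free_algebra J)" "g \<in> carrier (free_algebra J)"
  shows "component d (f \<ominus>\<^bsub>free_algebra J\<^esub> g) = component d f \<ominus>\<^bsub>free_algebra J\<^esub> component d g"
  using assms by (simp add: free_algebra_minus component_carrier) (auto simp: component_def)

text \<open>A factorisation of a word of length \<open>d\<close> has factors of lengths \<open>e\<close> and \<open>d - e\<close>, and exactly one
  summand of the right-hand side sees it.\<close>

lemma component_mult:
  "component d (f \<otimes>\<^bsub>free_algebra J\<^esub> g) =
     (\<lambda>w. \<Sum>e\<le>d. (component e f \<otimes>\<^bsub>free_algebra J\<^esub> component (d - e) g) w)"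
proof
  fix w :: "'a list"
  have *: "(component e f \<otimes>\<^bsub>free_algebra J\<^esub> component (d - e) g) w =
      (if e \<le> d \<and> length w = d then f (take e w) * g (drop e w) else 0)" if "e \<le> d" for e
  proof -
    have "(component e f \<otimes>\<^bsub>free_algebra J\<^esub> component (d - e) g) w =
       (\<Sum>k\<le>length w. if k = e then (if length w = d then f (take e w) * g (drop e w) else 0) else 0)"
      unfolding free_algebra_simps using that
      by (intro sum.cong) (auto simp: component_def)
    then show ?thesis using that by auto
  qed
  show "component d (f \<otimes>\<^bsub>free_algebra J\<^esub> g) w =
     (\<Sum>e\<le>d. (component e f \<otimes>\<^bsub>free_algebra J\<^esub> component (d - e) g) w)"
  proof -
    have "component d (f \<otimes>\<^bsub>free_algebra J\<^esub> g) w =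
        (\<Sum>e\<le>d. if length w = d then f (take e w) * g (drop e w) else 0)"
      by (auto simp: component_def free_algebra_simps)
    also have "\<dots> = (\<Sum>e\<le>d. (component e f \<otimes>\<^bsub>free_algebra J\<^esub> component (d - e) g) w)"
      by (intro sum.cong refl) (simp add: *)
    finally show ?thesis .
  qed
qed

lemma homogeneous_mult:
  assumes "f \<in> homogeneous J d" "g \<in> homogeneous J e"
  shows "f \<otimes>\<^bsub>free_algebra J\<^esub> g \<in> homogeneous J (d + e)"
proof -
  interpret FA: k_algebra "free_algebra J :: ('b, 'a list \<Rightarrow> 'b) module"
    by (rule k_algebra_free_algebra)
  have "length w = d + e" if "(\<Sum>k\<le>length w. f (take k w) * g (drop k w)) \<noteq> 0" for w
  proof -
    obtain k where "k \<le> length w" "f (take k w) \<noteq> 0" "g (drop k w) \<noteq> 0"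
      using \<open>(\<Sum>k\<le>length w. f (take k w) * g (drop k w)) \<noteq> 0\<close>
      by (metis (mono_tags, lifting) atMost_iff mult_not_zero sum.not_neutral_contains_not_neutral)
    then have "length (take k w) = d" "length (drop k w) = e"
      using assms unfolding homogeneous_def by blast+
    then show ?thesis using \<open>k \<le> length w\<close> by simp
  qed
  then show ?thesis
    using assms FA.m_closed by (auto simp: homogeneous_def free_algebra_simps)
qed

section \<open>The tensor algebra of a space with a basis is free\<close>

text \<open>The tensor algebra is a quotient of the huge free algebra \<open>FW\<close> on all vectors. With a basis indexed by
  \<open>J\<close> it is identified with the free algebra \<open>A\<close> on the indices, where degrees and components are
  visible; computations take place in \<open>A\<close> and are transported by \<open>to_tensor\<close>.\<close>

locale tensor_basis =
  fixes scale :: "'k::field \<Rightarrow> 'v::ab_group_add \<Rightarrow> 'v" and W :: "'v set" and J :: "nat set"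
    and x :: "nat \<Rightarrow> 'v"
  assumes vs: "vector_space scale" and basis: "basis_on scale W J x" and finite_J: "finite J"
begin

interpretation V: vector_space scale by (rule vs)

abbreviation "FW \<equiv> free_algebra W :: ('k, 'v list \<Rightarrow> 'k) module"
abbreviation "A \<equiv> free_algebra J :: ('k, nat list \<Rightarrow> 'k) module"
abbreviation "T \<equiv> tensor_algebra scale W"

sublocale FW: k_algebra FW by (rule k_algebra_free_algebra)
sublocale A: k_algebra A by (rule k_algebra_free_algebra)

lemma indep: "\<not> V.dependent (x ` J)" and span: "V.span (x ` J) = W" and inj: "inj_on x J"
  using basis by (auto simp: basis_on_def)

lemma x_in_W: "i \<in> J \<Longrightarrow> x i \<in> W"
  unfolding span[symmetric] by (rule V.span_base) simp

lemma lin_comb_in_W: "\<lbrakk>v \<in> W; w \<in> W\<rbrakk> \<Longrightarrow> scale a v + scale b w \<in> W"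
  unfolding span[symmetric] by (intro V.span_add V.span_scale)

definition coord :: "'v \<Rightarrow> nat \<Rightarrow> 'k" where
  "coord v i = V.representation (x ` J) v (x i)"

lemma coord_lin: "\<lbrakk>v \<in> W; w \<in> W\<rbrakk> \<Longrightarrow> coord (scale a v + scale b w) i = a * coord v i + b * coord w i"
  using indep unfolding coord_def span[symmetric]
  by (simp add: V.representation_add V.representation_scale V.span_scale)

lemma coord_basis: "\<lbrakk>i \<in> J; j \<in> J\<rbrakk> \<Longrightarrow> coord (x i) j = (if i = j then 1 else 0)"
  using indep inj unfolding coord_def by (auto simp: V.representation_basis inj_on_def)

text \<open>The vector \<open>v\<close>, written in the basis, as an element of degree one of \<open>A\<close>.\<close>

definition coord_element :: "'v \<Rightarrow> nat list \<Rightarrow> 'k" where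
  "coord_element v = (\<lambda>u. if \<exists>i\<in>J. u = [i] then coord v (hd u) else 0)"

lemma coord_element_homogeneous: "coord_element v \<in> homogeneous J 1"
proof -
  have "{u. coord_element v u \<noteq> 0} \<subseteq> (\<lambda>i. [i]) ` J"
    by (auto simp: coord_element_def split: if_splits)
  moreover have "finite ((\<lambda>i. [i]) ` J)" "(\<lambda>i. [i]) ` J \<subseteq> lists J" using finite_J by auto
  ultimately have "coord_element v \<in> carrier A"
    unfolding free_algebra_carrier by (meson finite_subset subset_trans)
  then show ?thesis by (auto simp: homogeneous_def) (auto simp: coord_element_def split: if_splits)
qed

lemma coord_element_closed: "coord_element v \<in> carrier A"
  using coord_element_homogeneous by (auto simp: homogeneous_def)

lemma coord_element_lin:
  "\<lbrakk>v \<in> W; w \<in> W\<rbrakk> \<Longrightarrow> coord_element (scale a v + scale b w) =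
     a \<odot>\<^bsub>A\<^esub> coord_element v \<oplus>\<^bsub>A\<^esub> b \<odot>\<^bsub>A\<^esub> coord_element w"
  by (auto simp: coord_element_def free_algebra_simps coord_lin)

lemma coord_element_basis: "i \<in> J \<Longrightarrow> coord_element (x i) = word [i]"
  by (auto simp: coord_element_def word_def coord_basis fun_eq_iff split: if_splits)

lemma linearity_relation_eq:
  assumes "v \<in> W" "w \<in> W"
  shows "(\<lambda>u. word [scale a v + scale b w] u - (a * word [v] u + b * word [w] u)) =
    word [scale a v + scale b w] \<ominus>\<^bsub>FW\<^esub> (a \<odot>\<^bsub>FW\<^esub> word [v] \<oplus>\<^bsub>FW\<^esub> b \<odot>\<^bsub>FW\<^esub> word [w])"
  using assms lin_comb_in_W[OF assms, of a b]
  by (subst free_algebra_minus) (auto simp: word_closed, simp add: free_algebra_simps)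

lemma linearity_relations_closed: "linearity_relations scale W \<subseteq> carrier FW"
  unfolding linearity_relations_def
  using lin_comb_in_W by (auto simp: linearity_relation_eq word_closed)

sublocale T: k_algebra T
  unfolding tensor_algebra_def by (rule k_algebra_quot_by[OF FW.k_algebra_axioms linearity_relations_closed])

abbreviation quotient_to_T where
  "quotient_to_T \<equiv> (\<lambda>f. Idl\<^bsub>FW\<^esub> (linearity_relations scale W) +>\<^bsub>FW\<^esub> f)"

lemma quotient_to_T_hom: "quotient_to_T \<in> alg_hom FW T"
  unfolding tensor_algebra_def by (rule quot_by_proj[OF FW.k_algebra_axioms linearity_relations_closed])

lemma quotient_to_T_surj: "quotient_to_T ` carrier FW = carrier T"
  unfolding tensor_algebra_def by (rule quot_by_surj[OF FW.k_algebra_axioms linearity_relations_closed])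

lemma tensor_closed: "ws \<in> lists W \<Longrightarrow> tensor scale W ws \<in> carrier T"
  unfolding tensor_def by (intro alg_hom_closed[OF quotient_to_T_hom] word_closed)

lemma tensor_append:
  "\<lbrakk>us \<in> lists W; vs \<in> lists W\<rbrakk> \<Longrightarrow>
     tensor scale W (us @ vs) = tensor scale W us \<otimes>\<^bsub>T\<^esub> tensor scale W vs"
  unfolding tensor_def word_mult_word[where W = W, symmetric]
  by (intro alg_hom_mult[OF quotient_to_T_hom] word_closed)

lemma tensor_Nil: "tensor scale W [] = \<one>\<^bsub>T\<^esub>"
  using alg_hom_one[OF quotient_to_T_hom] unfolding tensor_def free_algebra_simps .

lemma tensor_lin:
  assumes "v \<in> W" "w \<in> W"
  shows "tensor scale W [scale a v + scale b w] =
    a \<odot>\<^bsub>T\<^esub> tensor scale W [v] \<oplus>\<^bsub>T\<^esub> b \<odot>\<^bsub>T\<^esub> tensor scale W [w]"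
proof -
  let ?l = "word [scale a v + scale b w]" and ?r = "a \<odot>\<^bsub>FW\<^esub> word [v] \<oplus>\<^bsub>FW\<^esub> b \<odot>\<^bsub>FW\<^esub> word [w]"
  have cl: "?l \<in> carrier FW" "?r \<in> carrier FW" "word [v] \<in> carrier FW" "word [w] \<in> carrier FW"
    using assms lin_comb_in_W[OF assms] by (auto simp: word_closed)
  have "?l \<ominus>\<^bsub>FW\<^esub> ?r \<in> linearity_relations scale W"
    unfolding linearity_relation_eq[OF assms, symmetric] linearity_relations_def using assms by blast
  then have "quotient_to_T (?l \<ominus>\<^bsub>FW\<^esub> ?r) = \<zero>\<^bsub>T\<^esub>"
    unfolding tensor_algebra_def by (rule quot_by_kills[OF FW.k_algebra_axioms linearity_relations_closed])
  then have "quotient_to_T ?l = quotient_to_T ?r"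
    using alg_hom_eq_iff[OF FW.k_algebra_axioms T.k_algebra_axioms quotient_to_T_hom cl(1,2)] by simp
  then show ?thesis
    unfolding tensor_def using cl
    by (simp add: alg_hom_add[OF quotient_to_T_hom] alg_hom_smult[OF quotient_to_T_hom])
qed

definition to_tensor :: "(nat list \<Rightarrow> 'k) \<Rightarrow> ('v list \<Rightarrow> 'k) set" where
  "to_tensor = free_hom T (\<lambda>i. tensor scale W [x i])"

lemma basis_tensor_closed: "i \<in> J \<Longrightarrow> tensor scale W [x i] \<in> carrier T"
  by (simp add: tensor_closed x_in_W)

lemma to_tensor_hom: "to_tensor \<in> alg_hom A T"
  unfolding to_tensor_def by (rule free_hom_alg_hom[OF T.k_algebra_axioms basis_tensor_closed])

lemma to_tensor_word: "w \<in> lists J \<Longrightarrow> to_tensor (word w) = tensor scale W (map x w)"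
proof (induction w)
  case Nil
  then show ?case
    by (simp add: to_tensor_def free_hom_word[OF T.k_algebra_axioms basis_tensor_closed] tensor_Nil)
next
  case (Cons i w)
  then have "tensor scale W ([x i] @ map x w) = tensor scale W [x i] \<otimes>\<^bsub>T\<^esub> tensor scale W (map x w)"
    by (intro tensor_append) (auto simp: x_in_W)
  then show ?case
    using Cons by (simp add: to_tensor_def free_hom_word[OF T.k_algebra_axioms basis_tensor_closed])
qed

text \<open>Both sides are linear in \<open>v\<close> by the defining relations of the tensor algebra, and they agree on the
  basis.\<close>

lemma to_tensor_coord_element:
  assumes "v \<in> W"
  shows "to_tensor (coord_element v) = tensor scale W [v]"
proof -
  have "v \<in> W \<and> to_tensor (coord_element v) = tensor scale W [v]" if "v \<in> V.span (x ` J)" for v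
    using that
  proof (induction rule: V.span_induct_alt)
    case base
    have 0: "0 \<in> W" unfolding span[symmetric] by (rule V.span_zero)
    have "coord_element 0 = \<zero>\<^bsub>A\<^esub>"
      using coord_element_lin[OF 0 0, of 0 0] by (simp add: coord_element_closed)
    moreover have "tensor scale W [0] = \<zero>\<^bsub>T\<^esub>"
      using tensor_lin[OF 0 0, of 0 0] 0 by (simp add: tensor_closed)
    ultimately show ?case
      using 0 alg_hom_zero[OF A.k_algebra_axioms T.k_algebra_axioms to_tensor_hom] by simp
  next
    case (step c b y)
    then obtain i where i: "i \<in> J" "b = x i" by auto
    then have b: "b \<in> W" by (simp add: x_in_W)
    have "to_tensor (coord_element b) = tensor scale W [b]"
      using i to_tensor_word[of "[i]"] by (simp add: coord_element_basis)
    then show ?case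
      using step b lin_comb_in_W[of b y c 1] coord_element_lin[of b y c 1] tensor_lin[of b y c 1]
      by (simp add: alg_hom_add[OF to_tensor_hom] alg_hom_smult[OF to_tensor_hom] coord_element_closed
          tensor_closed)
  qed
  then show ?thesis using assms span by blast
qed

lemma from_tensor_exists:
  obtains g where "g \<in> alg_hom T A"
    "\<And>ws. ws \<in> lists W \<Longrightarrow> g (tensor scale W ws) = word_prod A coord_element ws"
proof -
  note hom = free_hom_alg_hom[OF A.k_algebra_axioms, of W coord_element, OF coord_element_closed]
  note word = free_hom_word[OF A.k_algebra_axioms, of W coord_element, OF coord_element_closed]
  have kill: "free_hom A coord_element r = \<zero>\<^bsub>A\<^esub>" if rel: "r \<in> linearity_relations scale W" for r
  proof -
    obtain a b v w where r: "v \<in> W" "w \<in> W"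
      "r = (\<lambda>u. word [scale a v + scale b w] u - (a * word [v] u + b * word [w] u))"
      using rel unfolding linearity_relations_def by auto
    have "r = word [scale a v + scale b w] \<ominus>\<^bsub>FW\<^esub> (a \<odot>\<^bsub>FW\<^esub> word [v] \<oplus>\<^bsub>FW\<^esub> b \<odot>\<^bsub>FW\<^esub> word [w])"
      unfolding r(3) by (rule linearity_relation_eq[OF r(1,2)])
    then show ?thesis
      using r(1,2) lin_comb_in_W[OF r(1,2)] coord_element_lin[OF r(1,2)]
      by (simp add: alg_hom_minus[OF FW.k_algebra_axioms A.k_algebra_axioms hom] word_closed
          alg_hom_add[OF hom] alg_hom_smult[OF hom] word coord_element_closed)
  qed
  obtain g where g: "g \<in> alg_hom T A"
    "\<And>a. a \<in> carrier FW \<Longrightarrow> g (quotient_to_T a) = free_hom A coord_element a"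
    unfolding tensor_algebra_def
    using quot_by_factor[OF FW.k_algebra_axioms linearity_relations_closed A.k_algebra_axioms hom kill]
    by blast
  show thesis
    by (rule that[OF g(1)]) (simp add: tensor_def g(2) word_closed word)
qed

text \<open>The inverse sends a vector to its coordinate element. Both composites are homomorphisms that fix
  generators: the letters in \<open>A\<close>, and the vectors in the tensor algebra.\<close>

lemma to_tensor_inverse_exists:
  obtains g where "g \<in> alg_hom T A" "\<And>a. a \<in> carrier A \<Longrightarrow> g (to_tensor a) = a"
    "\<And>t. t \<in> carrier T \<Longrightarrow> to_tensor (g t) = t"
    "\<And>ws. ws \<in> lists W \<Longrightarrow> g (tensor scale W ws) = word_prod A coord_element ws"
proof -
  obtain g where g: "g \<in> alg_hom T A"
    "\<And>ws. ws \<in> lists W \<Longrightarrow> g (tensor scale W ws) = word_prod A coord_element ws"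
    using from_tensor_exists by metis
  have 1: "g (to_tensor a) = a" if a: "a \<in> carrier A" for a
  proof -
    have "g (to_tensor a) = free_hom A (\<lambda>i. word [i]) a"
      by (rule free_hom_unique[OF A.k_algebra_axioms _ alg_hom_comp[OF to_tensor_hom g(1)] _ a])
         (auto simp: word_closed to_tensor_word g(2) x_in_W coord_element_basis)
    also have "\<dots> = a"
      by (rule free_hom_unique[OF A.k_algebra_axioms _ _ _ a, symmetric])
         (auto simp: word_closed alg_hom_def ring_hom_def)
    finally show ?thesis .
  qed
  have 2: "to_tensor (g (quotient_to_T f)) = quotient_to_T f" if f: "f \<in> carrier FW" for f
  proof -
    have "to_tensor (g (quotient_to_T f)) = free_hom T (\<lambda>v. tensor scale W [v]) f"
      using g(2)
      by (intro free_hom_unique[OF T.k_algebra_axioms _ alg_hom_comp[OF quotient_to_T_hom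
            alg_hom_comp[OF g(1) to_tensor_hom]] _ f])
         (auto simp: tensor_closed tensor_def[symmetric] coord_element_closed to_tensor_coord_element)
    also have "\<dots> = quotient_to_T f"
      by (rule free_hom_unique[OF T.k_algebra_axioms _ quotient_to_T_hom _ f, symmetric])
         (auto simp: tensor_closed tensor_def[symmetric])
    finally show ?thesis .
  qed
  have 3: "to_tensor (g t) = t" if "t \<in> carrier T" for t
    using that 2 unfolding quotient_to_T_surj[symmetric] by auto
  show thesis by (rule that[OF g(1) 1 3 g(2)])
qed

lemma to_tensor_bij: "bij_betw to_tensor (carrier A) (carrier T)"
proof -
  obtain g where g: "g \<in> alg_hom T A" "\<And>a. a \<in> carrier A \<Longrightarrow> g (to_tensor a) = a"
    "\<And>t. t \<in> carrier T \<Longrightarrow> to_tensor (g t) = t" using to_tensor_inverse_exists by metis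
  show ?thesis
    by (rule bij_betw_byWitness[of _ g])
       (auto simp: g alg_hom_closed[OF to_tensor_hom] alg_hom_closed[OF g(1)])
qed

lemma to_tensor_surj: "to_tensor ` carrier A = carrier T"
  using to_tensor_bij by (simp add: bij_betw_def)

lemma tensor_is_homogeneous:
  assumes "ws \<in> lists W"
  shows "tensor scale W ws \<in> to_tensor ` homogeneous J (length ws)"
proof -
  obtain g where g: "\<And>t. t \<in> carrier T \<Longrightarrow> to_tensor (g t) = t"
    "\<And>ws. ws \<in> lists W \<Longrightarrow> g (tensor scale W ws) = word_prod A coord_element ws"
    using to_tensor_inverse_exists by metis
  have "word_prod A coord_element ws \<in> homogeneous J (length ws)"
  proof (induction ws)
    case Nil
    then show ?case using homogeneous_word[of "[]" J 0] by (simp add: free_algebra_simps)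
  next
    case (Cons v ws)
    then show ?case using homogeneous_mult[OF coord_element_homogeneous Cons.IH, of v] by simp
  qed
  then show ?thesis using g(1)[OF tensor_closed[OF assms]] g(2)[OF assms] by (metis image_eqI)
qed

lemma image_subspace:
  assumes "k_subspace A U"
  shows "k_subspace T (to_tensor ` U)"
proof -
  have U: "u \<in> U \<Longrightarrow> u \<in> carrier A" for u using assms by (auto simp: k_subspace_def)
  have "\<zero>\<^bsub>T\<^esub> \<in> to_tensor ` U"
    using assms alg_hom_zero[OF A.k_algebra_axioms T.k_algebra_axioms to_tensor_hom, symmetric]
    by (auto simp: k_subspace_def)
  then show ?thesis
    using assms U unfolding k_subspace_def
    by (auto simp: alg_hom_closed[OF to_tensor_hom] alg_hom_add[OF to_tensor_hom, symmetric]
        alg_hom_smult[OF to_tensor_hom, symmetric])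
qed

text \<open>A pure tensor of \<open>d\<close> vectors is a product of \<open>d\<close> coordinate elements, hence homogeneous of degree \<open>d\<close>;
  conversely a word of length \<open>d\<close> is a pure tensor of basis vectors.\<close>

lemma tensor_power_eq: "tensor_power scale W d = to_tensor ` homogeneous J d"
proof
  show "tensor_power scale W d \<subseteq> to_tensor ` homogeneous J d"
    unfolding tensor_power_def
    by (intro k_span_minimal image_subspace homogeneous_subspace) (use tensor_is_homogeneous in auto)
  have sub: "{tensor scale W ws | ws. ws \<in> lists W \<and> length ws = d} \<subseteq> carrier T"
    using tensor_closed by auto
  have "to_tensor f \<in> tensor_power scale W d" if f: "f \<in> homogeneous J d" for f
  proof (rule free_algebra_image_in_subspace[OF T.k_algebra_axioms to_tensor_hom])
    show "k_subspace T (tensor_power scale W d)"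
      unfolding tensor_power_def by (rule k_span_subspace[OF T.k_algebra_axioms sub])
    fix w assume w: "f w \<noteq> 0"
    then have "w \<in> lists J" "length w = d"
      using f free_algebra_support[of f J w] by (auto simp: homogeneous_def)
    then show "to_tensor (word w) \<in> tensor_power scale W d"
      unfolding tensor_power_def
      by (intro subsetD[OF k_span_superset]) (auto simp: to_tensor_word x_in_W intro!: exI[of _ "map x w"])
  qed (use f in \<open>simp add: homogeneous_def\<close>)
  then show "to_tensor ` homogeneous J d \<subseteq> tensor_power scale W d" by blast
qed

lemma tensor_filtration_eq: "tensor_filtration scale W d = to_tensor ` degree_le J d"
proof
  show "tensor_filtration scale W d \<subseteq> to_tensor ` degree_le J d"
    unfolding tensor_filtration_def
    by (intro k_span_minimal image_subspace degree_le_subspace)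
       (auto simp: tensor_power_eq intro: homogeneous_degree_le)
  have sub: "(\<Union>j\<le>d. tensor_power scale W j) \<subseteq> carrier T"
    by (auto simp: tensor_power_eq homogeneous_def alg_hom_closed[OF to_tensor_hom])
  have "to_tensor f \<in> tensor_filtration scale W d" if f: "f \<in> degree_le J d" for f
  proof (rule free_algebra_image_in_subspace[OF T.k_algebra_axioms to_tensor_hom])
    show "k_subspace T (tensor_filtration scale W d)"
      unfolding tensor_filtration_def by (rule k_span_subspace[OF T.k_algebra_axioms sub])
    fix w assume w: "f w \<noteq> 0"
    then have "w \<in> lists J" "length w \<le> d"
      using f free_algebra_support[of f J w] by (auto simp: degree_le_def)
    then show "to_tensor (word w) \<in> tensor_filtration scale W d"
      unfolding tensor_filtration_def
      by (intro subsetD[OF k_span_superset]) (auto simp: tensor_power_eq intro!: bexI[of _ "length w"] imageI homogeneous_word)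
  qed (use f in \<open>simp add: degree_le_def\<close>)
  then show "to_tensor ` degree_le J d \<subseteq> tensor_filtration scale W d" by blast
qed

text \<open>The definite description is legitimate because the sum of the tensor powers is direct: in \<open>A\<close> an
  element of degree at most one has no component of degree two.\<close>

lemma quadratic_part_eq:
  assumes f: "f \<in> degree_le J 2"
  shows "quadratic_part scale W (to_tensor f) = to_tensor (component 2 f)"
proof -
  have fc: "f \<in> carrier A" using f by (simp add: degree_le_def)
  have c: "component 2 f \<in> homogeneous J 2" using fc by (rule component_homogeneous)
  have hc: "h \<in> carrier A" if "h \<in> homogeneous J d" for h d using that by (simp add: homogeneous_def)
  have iff: "to_tensor f \<ominus>\<^bsub>T\<^esub> to_tensor h \<in> to_tensor ` degree_le J 1 \<longleftrightarrow> h = component 2 f"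
    if h: "h \<in> homogeneous J 2" for h
  proof -
    have "to_tensor f \<ominus>\<^bsub>T\<^esub> to_tensor h = to_tensor (f \<ominus>\<^bsub>A\<^esub> h)"
      using fc hc[OF h] by (simp add: alg_hom_minus[OF A.k_algebra_axioms T.k_algebra_axioms to_tensor_hom])
    moreover have "f \<ominus>\<^bsub>A\<^esub> h \<in> carrier A" using fc hc[OF h] by simp
    ultimately have "to_tensor f \<ominus>\<^bsub>T\<^esub> to_tensor h \<in> to_tensor ` degree_le J 1 \<longleftrightarrow> f \<ominus>\<^bsub>A\<^esub> h \<in> degree_le J 1"
      using to_tensor_bij inj_on_image_mem_iff[of to_tensor "carrier A" _ "degree_le J 1"]
      by (simp add: bij_betw_def degree_le_def Collect_mono_iff)
    also have "\<dots> \<longleftrightarrow> (\<forall>w. f w - h w \<noteq> 0 \<longrightarrow> length w \<le> 1)"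
      using fc hc[OF h] A.minus_closed by (simp add: degree_le_def free_algebra_minus[symmetric]) (simp add: free_algebra_minus)
    also have "\<dots> \<longleftrightarrow> (\<forall>w. h w = component 2 f w)"
    proof (intro iff_allI)
      fix w
      have "h w = 0" if "length w \<noteq> 2" using h that by (auto simp: homogeneous_def)
      moreover have "f w = 0" if "\<not> length w \<le> 2" using f that by (auto simp: degree_le_def)
      ultimately show "(f w - h w \<noteq> 0 \<longrightarrow> length w \<le> 1) \<longleftrightarrow> h w = component 2 f w"
        by (cases "length w \<le> 1"; cases "length w = 2") (auto simp: component_def)
    qed
    finally show ?thesis by (simp add: fun_eq_iff)
  qed
  show ?thesis
    unfolding quadratic_part_def tensor_power_eq tensor_filtration_eq
  proof (rule the_equality)
    show "to_tensor (component 2 f) \<in> to_tensor ` homogeneous J 2 \<and>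
        to_tensor f \<ominus>\<^bsub>T\<^esub> to_tensor (component 2 f) \<in> to_tensor ` degree_le J 1"
      using c iff by blast
    fix q assume "q \<in> to_tensor ` homogeneous J 2 \<and> to_tensor f \<ominus>\<^bsub>T\<^esub> q \<in> to_tensor ` degree_le J 1"
    then show "q = to_tensor (component 2 f)" using iff by blast
  qed
qed

end

section \<open>The algebra of linear operators on a function space\<close>

definition linear_operators :: "('k::field, ('s \<Rightarrow> 'k) \<Rightarrow> 's \<Rightarrow> 'k) module" where
  "linear_operators = \<lparr>
     carrier = {F. \<forall>a b f g. F (\<lambda>s. a * f s + b * g s) = (\<lambda>s. a * F f s + b * F g s)},
     mult = (\<lambda>F G f. F (G f)), one = (\<lambda>f. f), zero = (\<lambda>f s. 0),
     add = (\<lambda>F G f s. F f s + G f s), smult = (\<lambda>c F f s. c * F f s)\<rparr>"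

lemma linear_operators_simps:
  "F \<in> carrier linear_operators \<longleftrightarrow> (\<forall>a b f g. F (\<lambda>s. a * f s + b * g s) = (\<lambda>s. a * F f s + b * F g s))"
  "F \<otimes>\<^bsub>linear_operators\<^esub> G = (\<lambda>f. F (G f))"
  "\<one>\<^bsub>linear_operators\<^esub> = (\<lambda>f. f)"
  "\<zero>\<^bsub>linear_operators\<^esub> = (\<lambda>f s. 0)"
  "F \<oplus>\<^bsub>linear_operators\<^esub> G = (\<lambda>f s. F f s + G f s)"
  "c \<odot>\<^bsub>linear_operators\<^esub> F = (\<lambda>f s. c * F f s)"
  by (simp_all add: linear_operators_def)

lemma linear_operators_add:
  "F \<in> carrier linear_operators \<Longrightarrow> F (\<lambda>s. f s + g s) = (\<lambda>s. F f s + F g s)"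
  unfolding linear_operators_simps by (drule spec[of _ 1], drule spec[of _ 1]) simp

lemma linear_operators_smult:
  "F \<in> carrier linear_operators \<Longrightarrow> F (\<lambda>s. c * f s) = (\<lambda>s. c * F f s)"
  unfolding linear_operators_simps by (drule spec[of _ c], drule spec[of _ 0]) simp

lemma k_algebra_linear_operators:
  "k_algebra (linear_operators :: ('k::field, ('s \<Rightarrow> 'k) \<Rightarrow> 's \<Rightarrow> 'k) module)"
proof -
  have neg: "\<exists>G\<in>carrier linear_operators. G \<oplus>\<^bsub>linear_operators\<^esub> F = \<zero>\<^bsub>linear_operators\<^esub>"
    if "F \<in> carrier linear_operators" for F :: "('s \<Rightarrow> 'k) \<Rightarrow> 's \<Rightarrow> 'k"
    using that
    by (intro bexI[of _ "\<lambda>f s. - F f s"]) (simp_all add: linear_operators_simps algebra_simps)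
  show ?thesis
    by (intro k_algebra.intro ringI abelian_groupI monoid.intro k_algebra_axioms.intro neg)
       (simp_all only: linear_operators_simps, simp_all add: algebra_simps,
        (rule ext, erule linear_operators_add[unfolded linear_operators_simps(1)])+,
        (rule ext, erule linear_operators_smult[unfolded linear_operators_simps(1)]))
qed

section \<open>Skew Clifford relations and normal forms\<close>

text \<open>Elements \<open>b i\<close> of an algebra \<open>B\<close> that satisfy the defining relations of the skew Clifford algebra whose
  form has the Gram matrix \<open>q\<close>, that is \<open>q i j = \<phi> (x i) (x j)\<close>.\<close>

definition skew_relations ::
    "('k::field, 'b) module \<Rightarrow> nat set \<Rightarrow> (nat \<Rightarrow> nat \<Rightarrow> 'k) \<Rightarrow> (nat \<Rightarrow> nat \<Rightarrow> 'k) \<Rightarrow> (nat \<Rightarrow> 'b) \<Rightarrow> bool" where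
  "skew_relations B J \<mu> q b \<longleftrightarrow> (\<forall>i\<in>J. b i \<in> carrier B) \<and>
     (\<forall>i\<in>J. \<forall>j\<in>J. b i \<otimes>\<^bsub>B\<^esub> b j \<oplus>\<^bsub>B\<^esub> \<mu> i j \<odot>\<^bsub>B\<^esub> (b j \<otimes>\<^bsub>B\<^esub> b i) = (2 * q i j) \<odot>\<^bsub>B\<^esub> \<one>\<^bsub>B\<^esub>)"

text \<open>An ordered monomial in the variables \<open>x\<^sub>m\<close>, \<open>m\<close> in a list \<open>js\<close>, each occurring at most once, is encoded by
  a stream of booleans whose entry at position \<open>p\<close> says whether the \<open>p\<close>-th variable occurs; a function on
  streams is a linear combination of monomials. The operator \<open>fock \<mu> q js i\<close> is left multiplication by
  \<open>x\<^sub>i\<close>, followed by reordering. For the first variable \<open>m\<close> a combination is \<open>f\<^sub>0 + x\<^sub>m f\<^sub>1\<close> with \<open>f\<^sub>0\<close>, \<open>f\<^sub>1\<close> in the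
  remaining variables, and the recursion expresses
  \<open>x\<^sub>m (f\<^sub>0 + x\<^sub>m f\<^sub>1) = x\<^sub>m f\<^sub>0 + q m m f\<^sub>1\<close> and
  \<open>x\<^sub>i (f\<^sub>0 + x\<^sub>m f\<^sub>1) = (x\<^sub>i f\<^sub>0 + 2 q i m f\<^sub>1) - \<mu> i m x\<^sub>m (x\<^sub>i f\<^sub>1)\<close> for \<open>i \<noteq> m\<close>.
  Streams have no end, so no bookkeeping of lengths enters the computation with these operators.\<close>

primrec fock :: "(nat \<Rightarrow> nat \<Rightarrow> 'k::field) \<Rightarrow> (nat \<Rightarrow> nat \<Rightarrow> 'k) \<Rightarrow> nat list \<Rightarrow> nat \<Rightarrow>
    (bool stream \<Rightarrow> 'k) \<Rightarrow> bool stream \<Rightarrow> 'k" where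
  "fock \<mu> q [] i f S = 0"
| "fock \<mu> q (m # ms) i f S =
     (if i = m then (if shd S then f (False ## stl S) else q m m * f (True ## stl S))
      else if shd S then - \<mu> i m * fock \<mu> q ms i (\<lambda>T. f (True ## T)) (stl S)
      else fock \<mu> q ms i (\<lambda>T. f (False ## T)) (stl S) + 2 * q i m * f (True ## stl S))"

text \<open>The element \<open>\<Sum> u S x\<^sub>S\<close>, where \<open>x\<^sub>S\<close> is the ordered monomial encoded by \<open>S\<close>.\<close>

primrec normal_form :: "('k::field, 'b) module \<Rightarrow> (nat \<Rightarrow> 'b) \<Rightarrow> nat list \<Rightarrow> (bool stream \<Rightarrow> 'k) \<Rightarrow> 'b" where
  "normal_form B b [] u = u (sconst False) \<odot>\<^bsub>B\<^esub> \<one>\<^bsub>B\<^esub>"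
| "normal_form B b (m # ms) u =
     normal_form B b ms (\<lambda>T. u (False ## T)) \<oplus>\<^bsub>B\<^esub> b m \<otimes>\<^bsub>B\<^esub> normal_form B b ms (\<lambda>T. u (True ## T))"

text \<open>The coefficients of the empty monomial.\<close>

definition vacuum :: "bool stream \<Rightarrow> 'k::field" where
  "vacuum S = (if S = sconst False then 1 else 0)"

lemma fock_linear:
  "fock \<mu> q js i (\<lambda>T. a * f T + b * g T) S = a * fock \<mu> q js i f S + b * fock \<mu> q js i g S"
  by (induction js arbitrary: f g S) (simp_all add: algebra_simps)

lemma fock_closed: "fock \<mu> q js i \<in> carrier linear_operators"
  by (simp add: linear_operators_simps fock_linear fun_eq_iff)

lemma fock_add: "fock \<mu> q js i (\<lambda>T. f T + g T) S = fock \<mu> q js i f S + fock \<mu> q js i g S"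
  using fock_linear[of \<mu> q js i 1 f 1 g S] by simp

lemma fock_smult: "fock \<mu> q js i (\<lambda>T. a * f T) S = a * fock \<mu> q js i f S"
  using fock_linear[of \<mu> q js i a f 0 f S] by simp

lemma fock_uminus: "fock \<mu> q js i (\<lambda>T. - f T) S = - fock \<mu> q js i f S"
  using fock_smult[of \<mu> q js i "- 1" f S] by simp

text \<open>The second condition says that, for every \<open>i\<close>, the form is invariant under the diagonal map scaling
  \<open>x\<^sub>j\<close> by \<open>\<mu> i j\<close>. It expresses that moving \<open>x\<^sub>i\<close> past \<open>x\<^sub>j x\<^sub>k\<close> gives the same result before and after a
  relation is applied, and it makes the ordered monomials linearly independent.\<close>

definition invariant_form :: "nat set \<Rightarrow> (nat \<Rightarrow> nat \<Rightarrow> 'k::field) \<Rightarrow> (nat \<Rightarrow> nat \<Rightarrow> 'k) \<Rightarrow> bool" where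
  "invariant_form J \<mu> q \<longleftrightarrow> (\<forall>i\<in>J. \<forall>j\<in>J. q i j = \<mu> i j * q j i) \<and>
     (\<forall>i\<in>J. \<forall>j\<in>J. \<forall>k\<in>J. q j k \<noteq> 0 \<longrightarrow> \<mu> i j * \<mu> i k = 1)"

lemma mult_antisymmetric_mono: "\<lbrakk>mult_antisymmetric J \<mu>; K \<subseteq> J\<rbrakk> \<Longrightarrow> mult_antisymmetric K \<mu>"
  unfolding mult_antisymmetric_def by blast

lemma invariant_form_mono: "\<lbrakk>invariant_form J \<mu> q; K \<subseteq> J\<rbrakk> \<Longrightarrow> invariant_form K \<mu> q"
  unfolding invariant_form_def by blast

lemma invariant_form_mult:
  assumes "invariant_form J \<mu> q" "i \<in> J" "j \<in> J" "k \<in> J"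
  shows "\<mu> i j * \<mu> i k * q j k = q j k"
proof (cases "q j k = 0")
  case False
  then have "\<mu> i j * \<mu> i k = 1" using assms unfolding invariant_form_def by blast
  then show ?thesis by simp
qed simp

text \<open>For the first variable \<open>m\<close>, and with \<open>X i\<close> for the operator of \<open>x\<^sub>i\<close> on the remaining variables, the operators
  are the block matrices \<open>(0, q m m; 1, 0)\<close> for \<open>x\<^sub>m\<close> and \<open>(X i, 2 q i m; 0, - \<mu> i m X i)\<close> for the other \<open>x\<^sub>i\<close>. On
  the diagonal the relations hold by induction, up to scalars \<open>\<mu> i m * \<mu> j m\<close> that invariance removes
  wherever \<open>q i j\<close> does not vanish; off the diagonal every term carries a factor such as
  \<open>q j m * (1 - \<mu> i j * \<mu> i m)\<close>, which vanishes by invariance.\<close>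

lemma fock_relation:
  assumes "mult_antisymmetric (set js) \<mu>" "invariant_form (set js) \<mu> q" "distinct js"
    and "i \<in> set js" "j \<in> set js"
  shows "fock \<mu> q js i (fock \<mu> q js j f) S + \<mu> i j * fock \<mu> q js j (fock \<mu> q js i f) S = 2 * q i j * f S"
  using assms
proof (induction js arbitrary: f S)
  case Nil
  then show ?case by simp
next
  case (Cons m ms)
  let ?X = "fock \<mu> q ms"
  let ?f0 = "\<lambda>T. f (False ## T)" and ?f1 = "\<lambda>T. f (True ## T)"
  have IH: "?X i (?X j g) R + \<mu> i j * ?X j (?X i g) R = 2 * q i j * g R"
    if "i \<in> set ms" "j \<in> set ms" for g R
    using Cons.prems(3) that
    by (intro Cons.IH mult_antisymmetric_mono[OF Cons.prems(1)] invariant_form_mono[OF Cons.prems(2)]) auto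
  have anti: "\<mu> k l * \<mu> l k = 1" "\<mu> k k = 1" if "k \<in> set (m # ms)" "l \<in> set (m # ms)" for k l
    using Cons.prems(1) that unfolding mult_antisymmetric_def by blast+
  have sym: "q k l = \<mu> k l * q l k" if "k \<in> set (m # ms)" "l \<in> set (m # ms)" for k l
    using Cons.prems(2) that unfolding invariant_form_def by blast
  have inv: "\<mu> k l * \<mu> k p * q l p = q l p"
    if "k \<in> set (m # ms)" "l \<in> set (m # ms)" "p \<in> set (m # ms)" for k l p
    by (rule invariant_form_mult[OF Cons.prems(2) that])
  have m: "m \<in> set (m # ms)" by simp
  have m_notin: "m \<notin> set ms" using Cons.prems(3) by simp
  note lin = fock_add fock_smult fock_uminus
  have with_m: "fock \<mu> q (m # ms) m (fock \<mu> q (m # ms) j f) S +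
      \<mu> m j * fock \<mu> q (m # ms) j (fock \<mu> q (m # ms) m f) S = 2 * q m j * f S"
    if j: "j \<in> set ms" for j
  proof -
    have j': "j \<in> set (m # ms)" "j \<noteq> m" using j m_notin by auto
    have 1: "\<mu> m j * q j m = q j m" using inv[OF m j'(1) m] anti[OF m m] by simp
    then have 2: "q m j = q j m" using sym[OF m j'(1)] by simp
    have 3: "\<mu> m j * q m m = \<mu> j m * q m m"
      using inv[OF j'(1) m m] anti[OF m j'(1)] by (metis mult.assoc mult_1)
    obtain h T where S: "S = h ## T" by (cases S)
    show ?thesis
    proof (cases h)
      case True
      have "\<mu> m j * (\<mu> j m * ?X j ?f0 T) = ?X j ?f0 T" using anti(1)[OF m j'(1)] by (simp flip: mult.assoc)
      then show ?thesis using True S j'(2) 2 by (simp add: lin algebra_simps)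
    next
      case False
      have *: "\<mu> m j * (q m m * y) = \<mu> j m * (q m m * y)" "\<mu> m j * (q j m * y) = q m j * y" for y
        using 3 1 2 by (simp_all flip: mult.assoc)
      show ?thesis using False S j'(2) by (simp add: lin algebra_simps *)
    qed
  qed
  consider (mm) "i = m" "j = m" | (im) "i = m" "j \<in> set ms" | (jm) "j = m" "i \<in> set ms"
    | (no) "i \<in> set ms" "j \<in> set ms"
    using Cons.prems(4,5) by auto
  then show ?case
  proof cases
    case mm
    obtain h T where "S = h ## T" by (cases S)
    then show ?thesis using mm anti[OF m m] by simp
  next
    case im
    show ?thesis unfolding im(1) by (rule with_m[OF im(2)])
  next
    case jm
    \<comment> \<open>The relation for \<open>(i, m)\<close> is \<open>\<mu> i m\<close> times the relation for \<open>(m, i)\<close>.\<close>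
    let ?a = "fock \<mu> q (m # ms) i (fock \<mu> q (m # ms) m f) S"
      and ?b = "fock \<mu> q (m # ms) m (fock \<mu> q (m # ms) i f) S"
    have i': "i \<in> set (m # ms)" using jm by simp
    have "?a + \<mu> i m * ?b = \<mu> i m * (?b + \<mu> m i * ?a)"
      using anti(1)[OF i' m] by (simp add: distrib_left flip: mult.assoc)
    also have "\<dots> = \<mu> i m * (2 * q m i * f S)" using with_m[OF jm(2)] by (simp only:)
    also have "\<dots> = 2 * q i m * f S" using sym[OF i' m] by simp
    finally show ?thesis unfolding jm(1) .
  next
    case no
    have i': "i \<in> set (m # ms)" "i \<noteq> m" and j': "j \<in> set (m # ms)" "j \<noteq> m" using no m_notin by auto
    obtain h T where S: "S = h ## T" by (cases S)
    show ?thesis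
    proof (cases h)
      case True
      have "\<mu> i m * \<mu> j m * q i j = (\<mu> i m * \<mu> m i) * (\<mu> j m * \<mu> m j) * q i j"
        using inv[OF m i'(1) j'(1)] by (metis mult.assoc mult.left_commute)
      then have *: "\<mu> i m * \<mu> j m * q i j = q i j"
        using anti(1)[OF i'(1) m] anti(1)[OF j'(1) m] by simp
      have "\<mu> i m * \<mu> j m * (?X i (?X j ?f1) T + \<mu> i j * ?X j (?X i ?f1) T) =
          2 * (\<mu> i m * \<mu> j m * q i j) * ?f1 T"
        unfolding IH[OF no] by (simp add: algebra_simps)
      then have "\<mu> i m * \<mu> j m * (?X i (?X j ?f1) T + \<mu> i j * ?X j (?X i ?f1) T) = 2 * q i j * ?f1 T"
        unfolding * .
      then show ?thesis using True S i' j' by (simp add: lin algebra_simps)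
    next
      case False
      have "\<mu> i j * \<mu> i m * q j m = q j m" using inv[OF i'(1) j'(1) m] .
      moreover have "\<mu> i j * q i m = \<mu> j m * q i m"
      proof -
        have "\<mu> i j * q i m = (\<mu> i j * \<mu> j i) * \<mu> j m * q i m"
          using inv[OF j'(1) i'(1) m] by (simp add: mult.assoc)
        then show ?thesis using anti(1)[OF i'(1) j'(1)] by simp
      qed
      ultimately have *: "\<mu> i j * (\<mu> i m * (q j m * y)) = q j m * y"
        "\<mu> i j * (q i m * y) = \<mu> j m * (q i m * y)" for y
        by (simp_all flip: mult.assoc)
      show ?thesis using False S i' j' IH[OF no, of ?f0 T]
        by (simp add: lin algebra_simps *)
    qed
  qed
qed


lemma fock_skew_relations:
  assumes "mult_antisymmetric (set js) \<mu>" "invariant_form (set js) \<mu> q" "distinct js"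
  shows "skew_relations linear_operators (set js) \<mu> q (fock \<mu> q js)"
  using fock_relation[OF assms]
  by (simp add: skew_relations_def fock_closed) (simp add: linear_operators_simps fun_eq_iff)

lemma vacuum_SCons: "vacuum (b ## S) = (if b then 0 else vacuum S)"
proof -
  have "b ## S = sconst False \<longleftrightarrow> b ## S = False ## sconst False"
    by (subst siterate.ctr) simp
  then show ?thesis by (simp add: vacuum_def)
qed

context
  fixes B :: "('k::field, 'b) module" and J :: "nat set" and b :: "nat \<Rightarrow> 'b"
  assumes B: "k_algebra B" and b: "\<And>i. i \<in> J \<Longrightarrow> b i \<in> carrier B"
begin

interpretation B: k_algebra B by (rule B)

lemma normal_form_closed: "set js \<subseteq> J \<Longrightarrow> normal_form B b js u \<in> carrier B"
  by (induction js arbitrary: u) (auto simp: b)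

lemma normal_form_linear:
  "set js \<subseteq> J \<Longrightarrow> normal_form B b js (\<lambda>S. c * u S + d * v S) =
     c \<odot>\<^bsub>B\<^esub> normal_form B b js u \<oplus>\<^bsub>B\<^esub> d \<odot>\<^bsub>B\<^esub> normal_form B b js v"
proof (induction js arbitrary: u v)
  case Nil
  then show ?case by (simp add: B.smult_l_distr B.smult_assoc)
next
  case (Cons m ms)
  then show ?case
    by (simp add: normal_form_closed b B.smult_r_distr B.r_distr B.smult_mult_right B.a_ac)
qed

lemma normal_form_add:
  "set js \<subseteq> J \<Longrightarrow> normal_form B b js (\<lambda>S. u S + v S) = normal_form B b js u \<oplus>\<^bsub>B\<^esub> normal_form B b js v"
  using normal_form_linear[of js 1 u 1 v] by (simp add: normal_form_closed)

lemma normal_form_smult: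
  "set js \<subseteq> J \<Longrightarrow> normal_form B b js (\<lambda>S. c * u S) = c \<odot>\<^bsub>B\<^esub> normal_form B b js u"
  using normal_form_linear[of js c u 0 u] by (simp add: normal_form_closed)

lemma normal_form_zero: "set js \<subseteq> J \<Longrightarrow> normal_form B b js (\<lambda>S. 0) = \<zero>\<^bsub>B\<^esub>"
  using normal_form_smult[of js 0 "\<lambda>S. 0"] by (simp add: normal_form_closed)

lemma normal_form_vacuum: "set js \<subseteq> J \<Longrightarrow> normal_form B b js vacuum = \<one>\<^bsub>B\<^esub>"
proof (induction js)
  case Nil
  then show ?case by (simp add: vacuum_def)
next
  case (Cons m ms)
  then show ?case by (simp add: vacuum_SCons normal_form_zero b)
qed

end

lemma skew_relations_square:
  fixes B :: "('k::field, 'b) module"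
  assumes B: "k_algebra B" and two: "(2::'k) \<noteq> 0" and rel: "skew_relations B J \<mu> q b"
    and i: "i \<in> J" "\<mu> i i = 1"
  shows "b i \<otimes>\<^bsub>B\<^esub> b i = q i i \<odot>\<^bsub>B\<^esub> \<one>\<^bsub>B\<^esub>"
proof -
  interpret B: k_algebra B by fact
  have b: "b i \<in> carrier B" using rel i by (simp add: skew_relations_def)
  have "b i \<otimes>\<^bsub>B\<^esub> b i \<oplus>\<^bsub>B\<^esub> \<mu> i i \<odot>\<^bsub>B\<^esub> (b i \<otimes>\<^bsub>B\<^esub> b i) = (2 * q i i) \<odot>\<^bsub>B\<^esub> \<one>\<^bsub>B\<^esub>"
    using rel i unfolding skew_relations_def by blast
  then have "(1 + 1) \<odot>\<^bsub>B\<^esub> (b i \<otimes>\<^bsub>B\<^esub> b i) = 2 \<odot>\<^bsub>B\<^esub> (q i i \<odot>\<^bsub>B\<^esub> \<one>\<^bsub>B\<^esub>)"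
    unfolding B.smult_l_distr[OF B.m_closed[OF b b]] using i b by (simp add: B.smult_assoc)
  then have "inverse 2 \<odot>\<^bsub>B\<^esub> (2 \<odot>\<^bsub>B\<^esub> (b i \<otimes>\<^bsub>B\<^esub> b i)) = inverse 2 \<odot>\<^bsub>B\<^esub> (2 \<odot>\<^bsub>B\<^esub> (q i i \<odot>\<^bsub>B\<^esub> \<one>\<^bsub>B\<^esub>))"
    by simp
  then show ?thesis using two b by (simp flip: B.smult_assoc)
qed

lemma skew_relations_swap:
  fixes B :: "('k::field, 'b) module"
  assumes B: "k_algebra B" and rel: "skew_relations B J \<mu> q b" and ij: "i \<in> J" "j \<in> J"
  shows "b i \<otimes>\<^bsub>B\<^esub> b j = (- \<mu> i j) \<odot>\<^bsub>B\<^esub> (b j \<otimes>\<^bsub>B\<^esub> b i) \<oplus>\<^bsub>B\<^esub> (2 * q i j) \<odot>\<^bsub>B\<^esub> \<one>\<^bsub>B\<^esub>"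
proof -
  interpret B: k_algebra B by fact
  have b: "b i \<in> carrier B" "b j \<in> carrier B" using rel ij by (simp_all add: skew_relations_def)
  have "b i \<otimes>\<^bsub>B\<^esub> b j \<oplus>\<^bsub>B\<^esub> \<mu> i j \<odot>\<^bsub>B\<^esub> (b j \<otimes>\<^bsub>B\<^esub> b i) = (2 * q i j) \<odot>\<^bsub>B\<^esub> \<one>\<^bsub>B\<^esub>"
    using rel ij unfolding skew_relations_def by blast
  then show ?thesis
    using b by (simp add: B.smult_uminus B.a_ac B.r_neg B.r_neg2 B.r_neg1 flip: \<open>_ = (2 * q i j) \<odot>\<^bsub>B\<^esub> \<one>\<^bsub>B\<^esub>\<close>)
qed

text \<open>The recursion for \<open>fock\<close> applies the relations to move \<open>x\<^sub>i\<close> to its place, so it is valid in every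
  algebra in which they hold.\<close>

lemma normal_form_fock:
  fixes B :: "('k::field, 'b) module"
  assumes B: "k_algebra B" and two: "(2::'k) \<noteq> 0" and rel: "skew_relations B J \<mu> q b"
    and anti: "mult_antisymmetric J \<mu>"
    and "set js \<subseteq> J" "distinct js" "i \<in> set js"
  shows "b i \<otimes>\<^bsub>B\<^esub> normal_form B b js u = normal_form B b js (fock \<mu> q js i u)"
  using assms(5-7)
proof (induction js arbitrary: u)
  case Nil
  then show ?case by simp
next
  case (Cons m ms)
  interpret B: k_algebra B by fact
  have b: "k \<in> J \<Longrightarrow> b k \<in> carrier B" for k using rel by (simp add: skew_relations_def)
  have ms: "set ms \<subseteq> J" and m: "m \<in> J" and i: "i \<in> J" using Cons.prems by auto
  note cl [simp] = normal_form_closed[of B J b, OF B b ms] b[OF m] b[OF i]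
  note lin = normal_form_add[of B J b, OF B b ms] normal_form_smult[of B J b, OF B b ms]
  let ?M = "normal_form B b ms" and ?u0 = "\<lambda>T. u (False ## T)" and ?u1 = "\<lambda>T. u (True ## T)"
  show ?case
  proof (cases "i = m")
    case True
    have "\<mu> m m = 1" using anti m unfolding mult_antisymmetric_def by blast
    then have "b m \<otimes>\<^bsub>B\<^esub> (b m \<otimes>\<^bsub>B\<^esub> ?M ?u1) = q m m \<odot>\<^bsub>B\<^esub> ?M ?u1"
      using skew_relations_square[OF B two rel m] by (simp add: B.smult_mult_left flip: B.m_assoc)
    then show ?thesis
      using True by (simp add: B.r_distr lin B.a_comm)
  next
    case False
    then have ims: "i \<in> set ms" using Cons.prems by simp
    have IH: "b i \<otimes>\<^bsub>B\<^esub> ?M v = ?M (fock \<mu> q ms i v)" for v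
      using Cons.prems ims by (intro Cons.IH) auto
    have "b i \<otimes>\<^bsub>B\<^esub> (b m \<otimes>\<^bsub>B\<^esub> ?M ?u1) =
        (- \<mu> i m) \<odot>\<^bsub>B\<^esub> (b m \<otimes>\<^bsub>B\<^esub> (b i \<otimes>\<^bsub>B\<^esub> ?M ?u1)) \<oplus>\<^bsub>B\<^esub> (2 * q i m) \<odot>\<^bsub>B\<^esub> ?M ?u1"
      using skew_relations_swap[OF B rel i m]
      by (simp add: B.smult_mult_left B.l_distr flip: B.m_assoc)
    then show ?thesis
      using False lin(2)[where c = "- \<mu> i m"]
      by (simp add: B.r_distr lin IH B.a_ac B.smult_mult_right)
  qed
qed

definition fock_hom :: "(nat \<Rightarrow> nat \<Rightarrow> 'k::field) \<Rightarrow> (nat \<Rightarrow> nat \<Rightarrow> 'k) \<Rightarrow> nat list \<Rightarrow>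
    (nat list \<Rightarrow> 'k) \<Rightarrow> (bool stream \<Rightarrow> 'k) \<Rightarrow> bool stream \<Rightarrow> 'k" where
  "fock_hom \<mu> q js = free_hom linear_operators (fock \<mu> q js)"

text \<open>The coefficients obtained when \<open>f\<close> is rewritten as a combination of ordered monomials: \<open>f\<close> acts on the
  empty monomial.\<close>

definition symbol :: "(nat \<Rightarrow> nat \<Rightarrow> 'k::field) \<Rightarrow> (nat \<Rightarrow> nat \<Rightarrow> 'k) \<Rightarrow> nat list \<Rightarrow>
    (nat list \<Rightarrow> 'k) \<Rightarrow> bool stream \<Rightarrow> 'k" where
  "symbol \<mu> q js f = fock_hom \<mu> q js f vacuum"

lemma fock_hom_alg_hom: "fock_hom \<mu> q js \<in> alg_hom (free_algebra J) linear_operators"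
  unfolding fock_hom_def by (rule free_hom_alg_hom[OF k_algebra_linear_operators fock_closed])

lemma symbol_zero: "symbol \<mu> q js \<zero>\<^bsub>free_algebra J\<^esub> = (\<lambda>S. 0)"
  unfolding symbol_def
  by (simp add: alg_hom_zero[OF k_algebra_free_algebra k_algebra_linear_operators fock_hom_alg_hom])
     (simp add: linear_operators_simps)

lemma symbol_add:
  assumes "f \<in> carrier (free_algebra J)" "g \<in> carrier (free_algebra J)"
  shows "symbol \<mu> q js (f \<oplus>\<^bsub>free_algebra J\<^esub> g) = (\<lambda>S. symbol \<mu> q js f S + symbol \<mu> q js g S)"
  using assms unfolding symbol_def
  by (simp add: alg_hom_add[OF fock_hom_alg_hom]) (simp add: linear_operators_simps)

lemma symbol_smult:
  assumes "f \<in> carrier (free_algebra J)"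
  shows "symbol \<mu> q js (c \<odot>\<^bsub>free_algebra J\<^esub> f) = (\<lambda>S. c * symbol \<mu> q js f S)"
  using assms unfolding symbol_def
  by (simp add: alg_hom_smult[OF fock_hom_alg_hom]) (simp add: linear_operators_simps)

lemma symbol_minus:
  assumes "f \<in> carrier (free_algebra J)" "g \<in> carrier (free_algebra J)"
  shows "symbol \<mu> q js (f \<ominus>\<^bsub>free_algebra J\<^esub> g) = (\<lambda>S. symbol \<mu> q js f S - symbol \<mu> q js g S)"
proof -
  interpret FA: k_algebra "free_algebra J :: ('a, nat list \<Rightarrow> 'a) module"
    by (rule k_algebra_free_algebra)
  show ?thesis
    using assms by (simp add: FA.minus_eq_smult symbol_add symbol_smult)
qed

lemma symbol_Nil: "symbol \<mu> q js (word []) = vacuum"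
  unfolding symbol_def fock_hom_def
  using free_hom_word[of linear_operators UNIV "fock \<mu> q js", OF k_algebra_linear_operators fock_closed, of "[]"]
  by (simp add: linear_operators_simps)

lemma symbol_Cons: "symbol \<mu> q js (word (i # w)) = fock \<mu> q js i (symbol \<mu> q js (word w))"
  unfolding symbol_def fock_hom_def
  using free_hom_word[of linear_operators UNIV "fock \<mu> q js", OF k_algebra_linear_operators fock_closed]
  by (simp add: linear_operators_simps)

text \<open>For a word this is a repeated application of \<open>normal_form_fock\<close>, one letter at a time; both sides are
  linear. Thus ordered monomials span, in every algebra in which the relations hold.\<close>

lemma normal_form_symbol:
  fixes B :: "('k::field, 'b) module"
  assumes B: "k_algebra B" and two: "(2::'k) \<noteq> 0" and rel: "skew_relations B (set js) \<mu> q b"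
    and anti: "mult_antisymmetric (set js) \<mu>" and js: "distinct js"
    and f: "f \<in> carrier (free_algebra (set js))"
  shows "free_hom B b f = normal_form B b js (symbol \<mu> q js f)"
proof -
  interpret B: k_algebra B by fact
  have b: "k \<in> set js \<Longrightarrow> b k \<in> carrier B" for k using rel by (simp add: skew_relations_def)
  note cl = normal_form_closed[of B "set js" b, OF B b subset_refl] word_prod_closed[of B "set js" b, OF B b] free_hom_closed[of B "set js" b, OF B b]
  have word: "word_prod B b w = normal_form B b js (symbol \<mu> q js (word w))" if "w \<in> lists (set js)" for w
    using that
  proof (induction w)
    case Nil
    then show ?case by (simp add: symbol_Nil normal_form_vacuum[of B "set js" b, OF B b])
  next
    case (Cons i w)
    then show ?case
      by (simp add: symbol_Cons normal_form_fock[OF B two rel anti subset_refl js])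
  qed
  show ?thesis
    using f
  proof (induction f rule: free_algebra_induct)
    case zero
    then show ?case
      by (simp add: symbol_zero normal_form_zero[of B "set js" b, OF B b]) (simp add: free_hom_zero[of B "set js" b, OF B b])
  next
    case (add f c w)
    interpret FA: k_algebra "free_algebra (set js) :: ('k, nat list \<Rightarrow> 'k) module"
      by (rule k_algebra_free_algebra)
    show ?case
      using add
      by (simp add: free_hom_add_word[of B "set js" b, OF B b] symbol_add symbol_smult word_closed word
          normal_form_add[of B "set js" b, OF B b] normal_form_smult[of B "set js" b, OF B b])
  qed
qed

lemma normal_form_hom:
  fixes B :: "('k::field, 'b) module" and C :: "('k, 'c) module"
  assumes B: "k_algebra B" and h: "h \<in> alg_hom B C"
    and b: "\<And>i. i \<in> J \<Longrightarrow> b i \<in> carrier B" and "set js \<subseteq> J"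
  shows "h (normal_form B b js u) = normal_form C (\<lambda>i. h (b i)) js u"
  using assms(4)
proof (induction js arbitrary: u)
  case Nil
  interpret B: k_algebra B by fact
  show ?case by (simp add: alg_hom_smult[OF h] alg_hom_one[OF h])
next
  case (Cons m ms)
  interpret B: k_algebra B by fact
  show ?case
    using Cons by (simp add: normal_form_closed[of B J b, OF B b] b alg_hom_add[OF h] alg_hom_mult[OF h])
qed

section \<open>The degree of a symbol\<close>

text \<open>Only the first entries, one for each variable, of a stream matter for \<open>normal_form\<close>.\<close>

definition occupation :: "bool list \<Rightarrow> bool stream" where
  "occupation L = L @- sconst False"

lemma occupation_Cons: "occupation (a # L) = a ## occupation L"
  by (simp add: occupation_def)

text \<open>The degree of a monomial is the number of its variables. The bound is an integer, since it
  drops by one, possibly from zero, when the first variable is split off.\<close>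

definition symbol_bound :: "nat \<Rightarrow> int \<Rightarrow> (bool stream \<Rightarrow> 'k::field) \<Rightarrow> bool" where
  "symbol_bound n d u \<longleftrightarrow>
     (\<forall>L. length L = n \<longrightarrow> d < int (count_list L True) \<longrightarrow> u (occupation L) = 0)"

text \<open>The symbol \<open>u\<close> has degree at most \<open>d\<close>, and \<open>u0\<close> is its homogeneous part of degree \<open>d\<close>.\<close>

definition leading_symbol :: "nat \<Rightarrow> int \<Rightarrow> (bool stream \<Rightarrow> 'k::field) \<Rightarrow> (bool stream \<Rightarrow> 'k) \<Rightarrow> bool" where
  "leading_symbol n d u u0 \<longleftrightarrow> symbol_bound n d u \<and>
     (\<forall>L. length L = n \<longrightarrow>
        (if int (count_list L True) = d then u (occupation L) = u0 (occupation L) else u0 (occupation L) = 0))"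

lemma leading_symbolD:
  assumes "leading_symbol n d u u0" "length L = n"
  shows "d < int (count_list L True) \<Longrightarrow> u (occupation L) = 0"
    and "int (count_list L True) = d \<Longrightarrow> u (occupation L) = u0 (occupation L)"
    and "int (count_list L True) \<noteq> d \<Longrightarrow> u0 (occupation L) = 0"
  using assms unfolding leading_symbol_def symbol_bound_def by metis+

lemma leading_symbolI:
  assumes "\<And>L. \<lbrakk>length L = n; d < int (count_list L True)\<rbrakk> \<Longrightarrow> u (occupation L) = 0"
    and "\<And>L. \<lbrakk>length L = n; int (count_list L True) = d\<rbrakk> \<Longrightarrow> u (occupation L) = u0 (occupation L)"
    and "\<And>L. \<lbrakk>length L = n; int (count_list L True) \<noteq> d\<rbrakk> \<Longrightarrow> u0 (occupation L) = 0"
  shows "leading_symbol n d u u0"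
  using assms by (simp add: leading_symbol_def symbol_bound_def)

text \<open>The terms of \<open>fock\<close> that carry a value of \<open>q\<close> remove a variable, so their degree is two lower than that
  of the others; what remains in the top degree is the operator for the form \<open>0\<close>.\<close>

lemma leading_symbol_fock:
  assumes "leading_symbol (length js) d u u0" "i \<in> set js"
  shows "leading_symbol (length js) (d + 1) (fock \<mu> q js i u) (fock \<mu> (\<lambda>_ _. 0) js i u0)"
  using assms
proof (induction js arbitrary: d u u0)
  case Nil
  then show ?case by simp
next
  case (Cons m ms)
  have D: "(d < int (count_list (a # L) True) \<longrightarrow> u (a ## occupation L) = 0) \<and>
      (int (count_list (a # L) True) = d \<longrightarrow> u (a ## occupation L) = u0 (a ## occupation L)) \<and>
      (int (count_list (a # L) True) \<noteq> d \<longrightarrow> u0 (a ## occupation L) = 0)" if "length L = length ms" for a L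
    using leading_symbolD[OF Cons.prems(1), of "a # L"] that unfolding occupation_Cons by auto
  have "leading_symbol (length ms) d (\<lambda>T. u (False ## T)) (\<lambda>T. u0 (False ## T))"
    using D[of _ False] by (intro leading_symbolI) auto
  then have F: "leading_symbol (length ms) (d + 1) (fock \<mu> q ms i (\<lambda>T. u (False ## T)))
      (fock \<mu> (\<lambda>_ _. 0) ms i (\<lambda>T. u0 (False ## T)))" if "i \<noteq> m"
    using that Cons.prems(2) by (intro Cons.IH) auto
  have "leading_symbol (length ms) (d - 1) (\<lambda>T. u (True ## T)) (\<lambda>T. u0 (True ## T))"
    using D[of _ True] by (intro leading_symbolI) auto
  then have T: "leading_symbol (length ms) (d - 1 + 1) (fock \<mu> q ms i (\<lambda>T. u (True ## T)))
      (fock \<mu> (\<lambda>_ _. 0) ms i (\<lambda>T. u0 (True ## T)))" if "i \<noteq> m"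
    using that Cons.prems(2) by (intro Cons.IH) auto
  show ?case
  proof (rule leading_symbolI, goal_cases)
    case (1 L)
    then obtain a L' where L: "L = a # L'" "length L' = length ms" by (cases L) auto
    show ?case
      using 1 L D[OF L(2)] leading_symbolD(1)[OF F L(2)] leading_symbolD(1)[OF T L(2)]
      by (cases a; cases "i = m") (auto simp: occupation_Cons)
  next
    case (2 L)
    then obtain a L' where L: "L = a # L'" "length L' = length ms" by (cases L) auto
    show ?case
      using 2 L D[OF L(2)] leading_symbolD(2)[OF F L(2)] leading_symbolD(2)[OF T L(2)]
      by (cases a; cases "i = m") (auto simp: occupation_Cons)
  next
    case (3 L)
    then obtain a L' where L: "L = a # L'" "length L' = length ms" by (cases L) auto
    show ?case
      using 3 L D[OF L(2)] leading_symbolD(3)[OF F L(2)] leading_symbolD(3)[OF T L(2)]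
      by (cases a; cases "i = m") (auto simp: occupation_Cons)
  qed
qed

lemma vacuum_occupation: "vacuum (occupation L) = (if count_list L True = 0 then 1 else 0)"
  by (induction L) (auto simp: occupation_Cons vacuum_SCons, auto simp: occupation_def vacuum_def)

lemma leading_symbol_word:
  "w \<in> lists (set js) \<Longrightarrow>
     leading_symbol (length js) (int (length w)) (symbol \<mu> q js (word w)) (symbol \<mu> (\<lambda>_ _. 0) js (word w))"
proof (induction w)
  case Nil
  show ?case by (rule leading_symbolI) (simp_all add: symbol_Nil vacuum_occupation)
next
  case (Cons i w)
  then show ?case using leading_symbol_fock[of js "int (length w)" _ _ i] by (simp add: symbol_Cons add.commute)
qed

lemma leading_symbol_homogeneous:
  assumes "f \<in> homogeneous (set js) d"
  shows "leading_symbol (length js) (int d) (symbol \<mu> q js f) (symbol \<mu> (\<lambda>_ _. 0) js f)"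
proof -
  have f: "f \<in> carrier (free_algebra (set js))" using assms by (simp add: homogeneous_def)
  then show ?thesis
  proof (induction f rule: free_algebra_induct_support)
    case zero
    show ?case by (rule leading_symbolI) (simp_all add: symbol_zero)
  next
    case (add g c w)
    interpret FA: k_algebra "free_algebra (set js) :: ('a, nat list \<Rightarrow> 'a) module"
      by (rule k_algebra_free_algebra)
    have "length w = d" using assms add by (simp add: homogeneous_def)
    then have wl: "leading_symbol (length js) (int d) (symbol \<mu> q js (word w)) (symbol \<mu> (\<lambda>_ _. 0) js (word w))"
      using leading_symbol_word[OF \<open>w \<in> lists (set js)\<close>] by simp
    have gl: "leading_symbol (length js) (int d) (symbol \<mu> q js g) (symbol \<mu> (\<lambda>_ _. 0) js g)"
      by fact
    show ?case
      using add.hyps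
      by (intro leading_symbolI)
         (simp_all add: symbol_add symbol_smult word_closed leading_symbolD[OF wl] leading_symbolD[OF gl])
  qed
qed

lemma symbol_bound_degree_le:
  assumes "f \<in> degree_le (set js) d"
  shows "symbol_bound (length js) (int d) (symbol \<mu> q js f)"
proof -
  have f: "f \<in> carrier (free_algebra (set js))" using assms by (simp add: degree_le_def)
  then show ?thesis
  proof (induction f rule: free_algebra_induct_support)
    case zero
    show ?case by (simp add: symbol_zero symbol_bound_def)
  next
    case (add g c w)
    interpret FA: k_algebra "free_algebra (set js) :: ('a, nat list \<Rightarrow> 'a) module"
      by (rule k_algebra_free_algebra)
    have "length w \<le> d" using assms add by (simp add: degree_le_def)
    then have "symbol_bound (length js) (int d) (symbol \<mu> q js (word w))"
      unfolding symbol_bound_def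
      by (intro allI impI leading_symbolD(1)[OF leading_symbol_word[OF \<open>w \<in> lists (set js)\<close>]]) auto
    then show ?case
      using add by (simp add: symbol_bound_def symbol_add symbol_smult word_closed)
  qed
qed

text \<open>The monomial encoded by \<open>L\<close> is a word whose length is the number of variables that occur.\<close>

lemma normal_form_degree:
  fixes u :: "bool stream \<Rightarrow> 'k::field"
  assumes "normal_form (free_algebra J) (\<lambda>i. word [i]) js u w \<noteq> 0"
  shows "\<exists>L. length L = length js \<and> count_list L True = length w \<and> u (occupation L) \<noteq> 0"
  using assms
proof (induction js arbitrary: u w)
  case Nil
  then show ?case
    by (intro exI[of _ "[]"]) (auto simp: free_algebra_simps occupation_def word_def split: if_splits)
next
  case (Cons m ms)
  let ?M = "normal_form (free_algebra J) (\<lambda>i. word [i]) ms"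
  consider "?M (\<lambda>T. u (False ## T)) w \<noteq> 0"
    | "(word [m] \<otimes>\<^bsub>free_algebra J\<^esub> ?M (\<lambda>T. u (True ## T))) w \<noteq> 0"
    using Cons.prems that unfolding normal_form.simps free_algebra_simps(4) by (metis add_0)
  then show ?case
  proof cases
    case 1
    from Cons.IH[OF this] obtain L where "length L = length ms" "count_list L True = length w"
      "u (False ## occupation L) \<noteq> 0" by blast
    then show ?thesis by (intro exI[of _ "False # L"]) (simp add: occupation_Cons)
  next
    case 2
    then obtain k where k: "k \<le> length w" "word [m] (take k w) * ?M (\<lambda>T. u (True ## T)) (drop k w) \<noteq> 0"
      unfolding free_algebra_simps(1) by (metis (no_types, lifting) atMost_iff sum.not_neutral_contains_not_neutral)
    then have "take k w = [m]" and M: "?M (\<lambda>T. u (True ## T)) (drop k w) \<noteq> 0"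
      by (auto simp: word_def split: if_splits)
    then have "length (take k w) = 1" by simp
    then have "length w = Suc (length (drop k w))" using k(1) by simp
    moreover from Cons.IH[OF M] obtain L where "length L = length ms" "count_list L True = length (drop k w)"
      "u (True ## occupation L) \<noteq> 0" by blast
    ultimately show ?thesis by (intro exI[of _ "True # L"]) (simp add: occupation_Cons)
  qed
qed

lemma normal_form_eq_zero:
  assumes B: "k_algebra B" and b: "\<And>i. i \<in> set js \<Longrightarrow> b i \<in> carrier B"
    and "\<And>L. length L = length js \<Longrightarrow> u (occupation L) = 0"
  shows "normal_form B b js u = \<zero>\<^bsub>B\<^esub>"
  using assms(2,3)
proof (induction js arbitrary: u)
  case Nil
  interpret B: k_algebra B by fact
  show ?case using Nil(2)[of "[]"] by (simp add: occupation_def)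
next
  case (Cons m ms)
  interpret B: k_algebra B by fact
  have "u (a ## occupation L) = 0" if "length L = length ms" for a L
    using Cons.prems(2)[of "a # L"] that by (simp add: occupation_Cons)
  then have "normal_form B b ms (\<lambda>T. u (a ## T)) = \<zero>\<^bsub>B\<^esub>" for a
    using Cons.prems(1) by (intro Cons.IH) auto
  then show ?case using Cons.prems(1) by simp
qed

section \<open>The graded algebra of an induced filtration\<close>

lemma (in abelian_group) finsum_difference_in_subgroup:
  assumes Q: "additive_subgroup Q G" and "finite I"
    and "\<And>i. i \<in> I \<Longrightarrow> u i \<in> carrier G" "\<And>i. i \<in> I \<Longrightarrow> v i \<in> carrier G"
    and "\<And>i. i \<in> I \<Longrightarrow> u i \<ominus> v i \<in> Q"
  shows "finsum G u I \<ominus> finsum G v I \<in> Q"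
  using assms(2-5)
proof (induction I rule: finite_induct)
  case empty
  have "\<zero> \<ominus> \<zero> = \<zero>" unfolding minus_eq by (rule r_neg[OF zero_closed])
  then show ?case using additive_subgroup.zero_closed[OF Q] by (simp only: finsum_empty)
next
  case (insert i I)
  have cl: "finsum G u I \<in> carrier G" "finsum G v I \<in> carrier G"
    using insert.prems by (auto intro!: finsum_closed)
  have "(u i \<ominus> v i) \<oplus> (finsum G u I \<ominus> finsum G v I) \<in> Q"
    using insert by (intro additive_subgroup.a_closed[OF Q]) auto
  moreover have "(u i \<ominus> v i) \<oplus> (finsum G u I \<ominus> finsum G v I) =
      finsum G u (insert i I) \<ominus> finsum G v (insert i I)"
    using insert cl by (subst (1 2) finsum_insert) (auto simp: minus_eq minus_add a_ac)
  ultimately show ?case by simp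
qed

lemma (in ring) product_difference:
  assumes "a \<in> carrier R" "a' \<in> carrier R" "b \<in> carrier R" "b' \<in> carrier R"
  shows "(a \<ominus> a') \<otimes> b \<oplus> a' \<otimes> (b \<ominus> b') = a \<otimes> b \<ominus> a' \<otimes> b'"
  using assms by algebra

text \<open>Components of a product are sums of functions; this translates them into sums in the algebra.\<close>

lemma alg_hom_pointwise_sum:
  fixes R :: "('k::field, 'b) module"
  assumes R: "k_algebra R" and h: "h \<in> alg_hom (free_algebra J) R"
    and "finite I" "\<And>i. i \<in> I \<Longrightarrow> f i \<in> carrier (free_algebra J)"
  shows "(\<lambda>w. \<Sum>i\<in>I. f i w) \<in> carrier (free_algebra J) \<and> h (\<lambda>w. \<Sum>i\<in>I. f i w) = finsum R (\<lambda>i. h (f i)) I"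
  using assms(3,4)
proof (induction I rule: finite_induct)
  case empty
  interpret FA: k_algebra "free_algebra J :: ('k, 'a list \<Rightarrow> 'k) module" by (rule k_algebra_free_algebra)
  interpret R: k_algebra R by fact
  show ?case
    using FA.zero_closed alg_hom_zero[OF k_algebra_free_algebra R h] by (simp add: free_algebra_simps)
next
  case (insert i I)
  interpret FA: k_algebra "free_algebra J :: ('k, 'a list \<Rightarrow> 'k) module" by (rule k_algebra_free_algebra)
  interpret R: k_algebra R by fact
  let ?s = "\<lambda>w. \<Sum>i\<in>I. f i w"
  have IH: "?s \<in> carrier (free_algebra J)" "h ?s = finsum R (\<lambda>i. h (f i)) I"
    using insert by simp_all
  have i: "f i \<in> carrier (free_algebra J)" using insert.prems by simp
  have eq: "(\<lambda>w. \<Sum>i\<in>insert i I. f i w) = f i \<oplus>\<^bsub>free_algebra J\<^esub> ?s"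
    using insert.hyps by (simp add: free_algebra_simps)
  have "finsum R (\<lambda>i. h (f i)) (insert i I) = h (f i) \<oplus>\<^bsub>R\<^esub> finsum R (\<lambda>i. h (f i)) I"
    using insert.hyps insert.prems alg_hom_closed[OF h] by (intro R.finsum_insert) auto
  then show ?case
    unfolding eq using FA.a_closed[OF i IH(1)] alg_hom_add[OF h i IH(1)] IH(2) by simp
qed

text \<open>An algebra \<open>R\<close> under the free algebra, with the filtration \<open>F\<close> by the images of elements of bounded
  degree. The graded algebra of \<open>F\<close> is then a quotient of the free algebra, by the map \<open>to_gr\<close> below, and its kernel
  can be tested degree by degree.\<close>

locale graded_quotient =
  fixes R :: "('k::field, 'b) module" and J :: "'v set" and \<eta> :: "('v list \<Rightarrow> 'k) \<Rightarrow> 'b"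
  assumes R: "k_algebra R" and hom: "\<eta> \<in> alg_hom (free_algebra J) R"
begin

sublocale R: k_algebra R by (rule R)
abbreviation "FJ \<equiv> free_algebra J :: ('k, 'v list \<Rightarrow> 'k) module"

sublocale FA: k_algebra FJ by (rule k_algebra_free_algebra)

definition F :: "nat \<Rightarrow> 'b set" where "F i = \<eta> ` degree_le J i"

abbreviation "Q \<equiv> filt_pred R F"

lemma F_subspace: "k_subspace R (F i)"
proof -
  have U: "u \<in> degree_le J i \<Longrightarrow> u \<in> carrier (FJ)" for u by (simp add: degree_le_def)
  have sub: "k_subspace FJ (degree_le J i)" by (rule degree_le_subspace)
  have "\<zero>\<^bsub>R\<^esub> = \<eta> \<zero>\<^bsub>FJ\<^esub>"
    using alg_hom_zero[OF FA.k_algebra_axioms R hom] by simp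
  moreover have "\<zero>\<^bsub>FJ\<^esub> \<in> degree_le J i"
    using sub by (simp add: k_subspace_def)
  moreover have "\<eta> u \<oplus>\<^bsub>R\<^esub> \<eta> v \<in> F i" if "u \<in> degree_le J i" "v \<in> degree_le J i" for u v
    using that U sub unfolding F_def k_subspace_def
    by (simp flip: alg_hom_add[OF hom])
  moreover have "c \<odot>\<^bsub>R\<^esub> \<eta> u \<in> F i" if "u \<in> degree_le J i" for u c
    using that U sub unfolding F_def k_subspace_def
    by (simp flip: alg_hom_smult[OF hom])
  ultimately show ?thesis
    using U alg_hom_closed[OF hom] by (auto simp: k_subspace_def F_def)
qed

lemma F_mono: "i \<le> j \<Longrightarrow> F i \<subseteq> F j"
  unfolding F_def by (intro image_mono subsetI) (rule degree_le_mono)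

lemma F_closed: "a \<in> F i \<Longrightarrow> a \<in> carrier R"
  using F_subspace[of i] by (auto simp: k_subspace_def)

lemma degree_le_mult:
  assumes "f \<in> degree_le J d" "g \<in> degree_le J e"
  shows "f \<otimes>\<^bsub>FJ\<^esub> g \<in> degree_le J (d + e)"
proof (rule degree_leI)
  show "f \<otimes>\<^bsub>FJ\<^esub> g \<in> carrier (FJ)"
    using assms by (simp add: degree_le_def)
  fix w :: "'v list" assume w: "\<not> length w \<le> d + e"
  have "f (take k w) * g (drop k w) = 0" if "k \<le> length w" for k
    using that w degree_leD[OF assms(1), of "take k w"] degree_leD[OF assms(2), of "drop k w"]
    by (cases "k \<le> d") auto
  then show "(f \<otimes>\<^bsub>FJ\<^esub> g) w = 0" unfolding free_algebra_simps by (intro sum.neutral) simp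
qed

lemma F_mult:
  assumes "a \<in> F i" "b \<in> F j"
  shows "a \<otimes>\<^bsub>R\<^esub> b \<in> F (i + j)"
proof -
  obtain u v where uv: "u \<in> degree_le J i" "v \<in> degree_le J j" "a = \<eta> u" "b = \<eta> v"
    using assms by (auto simp: F_def)
  then have "a \<otimes>\<^bsub>R\<^esub> b = \<eta> (u \<otimes>\<^bsub>FJ\<^esub> v)" by (simp add: alg_hom_mult[OF hom] degree_le_def)
  then show ?thesis using degree_le_mult[OF uv(1,2)] by (simp add: F_def)
qed

lemma Q_subspace: "k_subspace R (Q i)"
  using F_subspace[of "i - 1"] by (auto simp: filt_pred_def k_subspace_def)

lemma Q_closed: "a \<in> Q i \<Longrightarrow> a \<in> carrier R"
  using Q_subspace[of i] by (auto simp: k_subspace_def)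

lemma Q_F: "Q i \<subseteq> F i"
  using F_mono[of "i - 1" i] F_subspace[of i] by (auto simp: filt_pred_def k_subspace_def)

lemma Q_mult: "\<lbrakk>a \<in> Q i; b \<in> F j\<rbrakk> \<Longrightarrow> a \<otimes>\<^bsub>R\<^esub> b \<in> Q (i + j)"
  using F_mult[of a "i - 1" b j] F_closed[of b j] Q_subspace[of "i + j"]
  by (cases "i = 0") (auto simp: filt_pred_def k_subspace_def split: if_splits)

lemma F_mult_Q: "\<lbrakk>a \<in> F i; b \<in> Q j\<rbrakk> \<Longrightarrow> a \<otimes>\<^bsub>R\<^esub> b \<in> Q (i + j)"
  using F_mult[of a i b "j - 1"] F_closed[of a i] Q_subspace[of "i + j"]
  by (cases "j = 0") (auto simp: filt_pred_def k_subspace_def split: if_splits)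

lemma Q_subgroup: "additive_subgroup (Q i) R"
proof (rule additive_subgroup.intro, rule R.add.subgroupI)
  fix a assume a: "a \<in> Q i"
  then have "(- 1) \<odot>\<^bsub>R\<^esub> a \<in> Q i" using Q_subspace[of i] unfolding k_subspace_def by blast
  then show "\<ominus>\<^bsub>R\<^esub> a \<in> Q i" using Q_closed[OF a] by (simp add: R.smult_uminus)
qed (use Q_subspace[of i] in \<open>auto simp: k_subspace_def\<close>)

lemma Q_abelian_subgroup: "abelian_subgroup (Q i) R"
  using Q_subgroup R.is_abelian_group by (intro abelian_subgroupI3)

lemma coset_eq: "\<lbrakk>a \<in> carrier R; b \<in> carrier R\<rbrakk> \<Longrightarrow> Q i +>\<^bsub>R\<^esub> a = Q i +>\<^bsub>R\<^esub> b \<longleftrightarrow> a \<ominus>\<^bsub>R\<^esub> b \<in> Q i"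
  by (rule coset_eq_iff[OF R.ring_axioms Q_subgroup])

lemma coset_zero: "Q i +>\<^bsub>R\<^esub> \<zero>\<^bsub>R\<^esub> = Q i"
  by (rule abelian_subgroup.a_rcos_const[OF Q_abelian_subgroup additive_subgroup.zero_closed[OF Q_subgroup]])

lemma coset_mem: "a \<in> carrier R \<Longrightarrow> b \<in> Q i +>\<^bsub>R\<^esub> a \<longleftrightarrow> b \<in> carrier R \<and> b \<ominus>\<^bsub>R\<^esub> a \<in> Q i"
  using abelian_subgroup.a_rcos_module_minus[OF Q_abelian_subgroup R.ring_axioms]
    abelian_subgroup.a_elemrcos_carrier[OF Q_abelian_subgroup] by metis

lemma coset_self: "a \<in> carrier R \<Longrightarrow> a \<in> Q i +>\<^bsub>R\<^esub> a"
  by (rule abelian_subgroup.a_rcos_self[OF Q_abelian_subgroup])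

text \<open>The component of degree \<open>i\<close> lies in the filtration step \<open>i\<close>, and contributes its class there.\<close>

definition to_gr :: "('v list \<Rightarrow> 'k) \<Rightarrow> nat \<Rightarrow> 'b set" where
  "to_gr f = (\<lambda>i. Q i +>\<^bsub>R\<^esub> \<eta> (component i f))"

lemma eta_component_F: "f \<in> carrier (FJ) \<Longrightarrow> \<eta> (component i f) \<in> F i"
  unfolding F_def using component_homogeneous[of f J i] homogeneous_degree_le by blast

lemma eta_component_closed: "f \<in> carrier (FJ) \<Longrightarrow> \<eta> (component i f) \<in> carrier R"
  using eta_component_F F_closed by blast

text \<open>The product in the graded algebra runs over all representatives. If \<open>a\<close> and \<open>b\<close> represent the
  classes of the components \<open>a'\<close> and \<open>b'\<close>, then \<open>a b - a' b' = (a - a') b + a' (b - b')\<close> lies one filtration step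
  lower, so all choices give the class of the component of the product.\<close>

lemma to_gr_mult:
  assumes f: "f \<in> carrier (FJ)" and g: "g \<in> carrier (FJ)"
  shows "to_gr (f \<otimes>\<^bsub>FJ\<^esub> g) = to_gr f \<otimes>\<^bsub>gr R F\<^esub> to_gr g"
proof
  fix i
  let ?s = "\<Oplus>\<^bsub>R\<^esub>j\<in>{..i}. \<eta> (component j f) \<otimes>\<^bsub>R\<^esub> \<eta> (component (i - j) g)"
  let ?C = "{(a, b). \<forall>j. a j \<in> to_gr f j \<and> b j \<in> to_gr g j}"
  have "\<eta> (component i (f \<otimes>\<^bsub>FJ\<^esub> g)) =
      (\<Oplus>\<^bsub>R\<^esub>j\<in>{..i}. \<eta> (component j f \<otimes>\<^bsub>FJ\<^esub> component (i - j) g))"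
    unfolding component_mult using f g
    by (intro conjunct2[OF alg_hom_pointwise_sum[OF R hom]]) (auto simp: component_carrier)
  also have "\<dots> = ?s"
    using f g by (intro R.finsum_cong') (auto simp: alg_hom_mult[OF hom] component_carrier eta_component_closed)
  finally have lhs: "to_gr (f \<otimes>\<^bsub>FJ\<^esub> g) i = Q i +>\<^bsub>R\<^esub> ?s" by (simp add: to_gr_def)
  have term_eq: "Q i +>\<^bsub>R\<^esub> (\<Oplus>\<^bsub>R\<^esub>j\<in>{..i}. a j \<otimes>\<^bsub>R\<^esub> b (i - j)) = Q i +>\<^bsub>R\<^esub> ?s"
    if ab: "(a, b) \<in> ?C" for a b
  proof -
    have a: "a j \<in> carrier R" "a j \<ominus>\<^bsub>R\<^esub> \<eta> (component j f) \<in> Q j"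
      and b: "b j \<in> carrier R" "b j \<ominus>\<^bsub>R\<^esub> \<eta> (component j g) \<in> Q j" for j
      using ab f g by (auto simp: to_gr_def coset_mem eta_component_closed)
    have bF: "b j \<in> F j" for j
    proof -
      have "(b j \<ominus>\<^bsub>R\<^esub> \<eta> (component j g)) \<oplus>\<^bsub>R\<^esub> \<eta> (component j g) \<in> F j"
        using F_subspace[of j] Q_F[of j] b(2)[of j] eta_component_F[OF g, of j]
        unfolding k_subspace_def by blast
      then show ?thesis
        using b(1)[of j] eta_component_closed[OF g, of j] by (simp add: R.minus_eq R.a_assoc R.l_neg)
    qed
    have diff: "a j \<otimes>\<^bsub>R\<^esub> b (i - j) \<ominus>\<^bsub>R\<^esub> \<eta> (component j f) \<otimes>\<^bsub>R\<^esub> \<eta> (component (i - j) g) \<in> Q i"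
      if "j \<in> {..i}" for j
    proof -
      let ?a = "\<eta> (component j f)" and ?b = "\<eta> (component (i - j) g)"
      have cl: "?a \<in> carrier R" "?b \<in> carrier R" using f g by (simp_all add: eta_component_closed)
      have "(a j \<ominus>\<^bsub>R\<^esub> ?a) \<otimes>\<^bsub>R\<^esub> b (i - j) \<in> Q (j + (i - j))"
        by (rule Q_mult[OF a(2) bF])
      moreover have "?a \<otimes>\<^bsub>R\<^esub> (b (i - j) \<ominus>\<^bsub>R\<^esub> ?b) \<in> Q (j + (i - j))"
        by (rule F_mult_Q[OF eta_component_F[OF f] b(2)])
      ultimately have "(a j \<ominus>\<^bsub>R\<^esub> ?a) \<otimes>\<^bsub>R\<^esub> b (i - j) \<oplus>\<^bsub>R\<^esub> ?a \<otimes>\<^bsub>R\<^esub> (b (i - j) \<ominus>\<^bsub>R\<^esub> ?b) \<in> Q i"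
        using additive_subgroup.a_closed[OF Q_subgroup[of i]] that by simp
      moreover have "(a j \<ominus>\<^bsub>R\<^esub> ?a) \<otimes>\<^bsub>R\<^esub> b (i - j) \<oplus>\<^bsub>R\<^esub> ?a \<otimes>\<^bsub>R\<^esub> (b (i - j) \<ominus>\<^bsub>R\<^esub> ?b) =
          a j \<otimes>\<^bsub>R\<^esub> b (i - j) \<ominus>\<^bsub>R\<^esub> ?a \<otimes>\<^bsub>R\<^esub> ?b"
        using a(1)[of j] b(1)[of "i - j"] cl
        by (intro R.product_difference)
      ultimately show ?thesis by simp
    qed
    have "(\<Oplus>\<^bsub>R\<^esub>j\<in>{..i}. a j \<otimes>\<^bsub>R\<^esub> b (i - j)) \<ominus>\<^bsub>R\<^esub> ?s \<in> Q i"
      using a b f g diff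
      by (intro R.finsum_difference_in_subgroup[OF Q_subgroup]) (auto simp: eta_component_closed)
    then show ?thesis
      using a b f g by (subst coset_eq) (auto intro!: R.finsum_closed simp: eta_component_closed)
  qed
  have "(\<lambda>j. \<eta> (component j f), \<lambda>j. \<eta> (component j g)) \<in> ?C"
    using f g by (auto simp: to_gr_def eta_component_closed coset_self)
  then have "?C \<noteq> {}" by (metis empty_iff)
  then have "(\<Union>(a, b)\<in>?C. Q i +>\<^bsub>R\<^esub> (\<Oplus>\<^bsub>R\<^esub>j\<in>{..i}. a j \<otimes>\<^bsub>R\<^esub> b (i - j))) = Q i +>\<^bsub>R\<^esub> ?s"
  proof (rule SUP_eq_const)
    fix p assume p: "p \<in> ?C"
    then have "(fst p, snd p) \<in> ?C" by simp
    from term_eq[OF this] show "(case p of (a, b) \<Rightarrow>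
        Q i +>\<^bsub>R\<^esub> (\<Oplus>\<^bsub>R\<^esub>j\<in>{..i}. a j \<otimes>\<^bsub>R\<^esub> b (i - j))) = Q i +>\<^bsub>R\<^esub> ?s"
      by (simp add: case_prod_unfold)
  qed
  then show "to_gr (f \<otimes>\<^bsub>FJ\<^esub> g) i = (to_gr f \<otimes>\<^bsub>gr R F\<^esub> to_gr g) i"
    using lhs by (simp add: gr_def)
qed

lemma to_gr_smult:
  assumes f: "f \<in> carrier (FJ)"
  shows "to_gr (c \<odot>\<^bsub>FJ\<^esub> f) = c \<odot>\<^bsub>gr R F\<^esub> to_gr f"
proof
  fix i
  let ?a = "\<eta> (component i f)"
  have a: "?a \<in> carrier R" using f by (rule eta_component_closed)
  have indep: "Q i +>\<^bsub>R\<^esub> c \<odot>\<^bsub>R\<^esub> r = Q i +>\<^bsub>R\<^esub> c \<odot>\<^bsub>R\<^esub> ?a" if "r \<in> to_gr f i" for r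
  proof -
    have r: "r \<in> carrier R" "r \<ominus>\<^bsub>R\<^esub> ?a \<in> Q i" using that a by (auto simp: to_gr_def coset_mem)
    have "c \<odot>\<^bsub>R\<^esub> (r \<ominus>\<^bsub>R\<^esub> ?a) \<in> Q i" using Q_subspace[of i] r(2) unfolding k_subspace_def by blast
    then show ?thesis
      using r(1) a by (subst coset_eq) (auto simp: R.minus_eq R.smult_r_distr R.smult_inv)
  qed
  have "to_gr f i \<noteq> {}" using coset_self[OF a, of i] by (auto simp: to_gr_def)
  then have "(\<Union>r\<in>to_gr f i. Q i +>\<^bsub>R\<^esub> c \<odot>\<^bsub>R\<^esub> r) = Q i +>\<^bsub>R\<^esub> c \<odot>\<^bsub>R\<^esub> ?a"
    by (rule SUP_eq_const) (rule indep)
  then show "to_gr (c \<odot>\<^bsub>FJ\<^esub> f) i = (c \<odot>\<^bsub>gr R F\<^esub> to_gr f) i"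
    using f by (simp add: gr_def to_gr_def component_smult alg_hom_smult[OF hom] component_carrier)
qed

lemma to_gr_add:
  assumes "f \<in> carrier (FJ)" "g \<in> carrier (FJ)"
  shows "to_gr (f \<oplus>\<^bsub>FJ\<^esub> g) = to_gr f \<oplus>\<^bsub>gr R F\<^esub> to_gr g"
proof
  fix i
  show "to_gr (f \<oplus>\<^bsub>FJ\<^esub> g) i = (to_gr f \<oplus>\<^bsub>gr R F\<^esub> to_gr g) i"
    using assms
    by (simp add: gr_def to_gr_def component_add alg_hom_add[OF hom] component_carrier
        abelian_subgroup.a_rcos_sum[OF Q_abelian_subgroup] eta_component_closed)
qed

lemma to_gr_one: "to_gr \<one>\<^bsub>FJ\<^esub> = \<one>\<^bsub>gr R F\<^esub>"
proof
  fix i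
  have "component i \<one>\<^bsub>FJ\<^esub> = (if i = 0 then \<one>\<^bsub>FJ\<^esub> else \<zero>\<^bsub>FJ\<^esub>)"
    by (auto simp: component_def free_algebra_simps word_def)
  then show "to_gr \<one>\<^bsub>FJ\<^esub> i = \<one>\<^bsub>gr R F\<^esub> i"
    using alg_hom_one[OF hom] alg_hom_zero[OF FA.k_algebra_axioms R hom]
    unfolding to_gr_def \<open>component i _ = _\<close> by (simp add: gr_def)
qed

lemma to_gr_closed:
  assumes f: "f \<in> carrier (FJ)"
  shows "to_gr f \<in> carrier (gr R F)"
proof -
  have "i \<in> length ` {w. f w \<noteq> 0}" if i: "to_gr f i \<noteq> Q i" for i
  proof (rule ccontr)
    assume "i \<notin> length ` {w. f w \<noteq> 0}"
    then have "component i f = \<zero>\<^bsub>FJ\<^esub>"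
      by (auto simp: component_def free_algebra_simps fun_eq_iff)
    then show False
      using i alg_hom_zero[OF FA.k_algebra_axioms R hom] by (simp add: to_gr_def coset_zero)
  qed
  then have "{i. to_gr f i \<noteq> Q i} \<subseteq> length ` {w. f w \<noteq> 0}" by auto
  moreover have "finite (length ` {w. f w \<noteq> 0})" using f by (simp add: free_algebra_carrier)
  ultimately have "finite {i. to_gr f i \<noteq> Q i}" by (rule finite_subset)
  then show ?thesis
    using eta_component_F[OF f] by (auto simp: gr_def to_gr_def)
qed

lemma to_gr_hom: "to_gr \<in> alg_hom (FJ) (gr R F)"
  by (intro alg_homI to_gr_closed to_gr_mult to_gr_add to_gr_one to_gr_smult)

text \<open>Each class is represented by an element of degree at most \<open>i\<close>, which may be replaced by its component of
  degree \<open>i\<close>; the sum of these components over the finitely many nonzero classes is a preimage.\<close>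

lemma to_gr_surj: "to_gr ` carrier (FJ) = carrier (gr R F)"
proof
  show "to_gr ` carrier (FJ) \<subseteq> carrier (gr R F)" using to_gr_closed by blast
  show "carrier (gr R F) \<subseteq> to_gr ` carrier (FJ)"
  proof
    fix g assume g: "g \<in> carrier (gr R F)"
    then have fin: "finite {i. g i \<noteq> Q i}" and "\<forall>i. \<exists>r\<in>F i. g i = Q i +>\<^bsub>R\<^esub> r"
      by (auto simp: gr_def)
    then have "\<forall>i. \<exists>f. f \<in> degree_le J i \<and> g i = Q i +>\<^bsub>R\<^esub> \<eta> f" unfolding F_def by blast
    then obtain e where e: "\<And>i. e i \<in> degree_le J i" "\<And>i. g i = Q i +>\<^bsub>R\<^esub> \<eta> (e i)" by metis
    have ec: "e i \<in> carrier (FJ)" for i using e(1)[of i] by (simp add: degree_le_def)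
    define f where "f = (\<lambda>w. \<Sum>i\<in>{i. g i \<noteq> Q i}. component i (e i) w)"
    have fc: "f \<in> carrier (FJ)"
      unfolding f_def
      by (rule conjunct1[OF alg_hom_pointwise_sum[OF R hom fin]]) (rule component_carrier[OF ec])
    have comp: "component i f = (if g i \<noteq> Q i then component i (e i) else \<zero>\<^bsub>FJ\<^esub>)" for i
    proof
      fix w
      have "f w = (\<Sum>j\<in>{i. g i \<noteq> Q i}. if j = length w then e j w else 0)"
        unfolding f_def by (intro sum.cong) (auto simp: component_def)
      then have "f w = (if g (length w) \<noteq> Q (length w) then e (length w) w else 0)"
        using fin by simp
      then show "component i f w = (if g i \<noteq> Q i then component i (e i) else \<zero>\<^bsub>FJ\<^esub>) w"
        by (auto simp: component_def free_algebra_simps)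
    qed
    have "to_gr f i = g i" for i
    proof (cases "g i = Q i")
      case True
      then show ?thesis
        using comp[of i] alg_hom_zero[OF FA.k_algebra_axioms R hom] by (simp add: to_gr_def coset_zero)
    next
      case False
      have d: "component i (e i) \<ominus>\<^bsub>FJ\<^esub> e i = (\<lambda>w. component i (e i) w - e i w)"
        by (rule free_algebra_minus[OF component_carrier[OF ec] ec])
      have dc: "component i (e i) \<ominus>\<^bsub>FJ\<^esub> e i \<in> carrier (FJ)"
        by (intro FA.minus_closed component_carrier ec)
      have "\<eta> (component i (e i) \<ominus>\<^bsub>FJ\<^esub> e i) \<in> Q i"
      proof (cases i)
        case 0
        have "component i (e i) \<ominus>\<^bsub>FJ\<^esub> e i = \<zero>\<^bsub>FJ\<^esub>"
          unfolding d using 0 degree_leD[OF e(1)[of i]] by (auto simp: component_def free_algebra_simps)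
        then show ?thesis
          using alg_hom_zero[OF FA.k_algebra_axioms R hom] additive_subgroup.zero_closed[OF Q_subgroup] by simp
      next
        case (Suc k)
        have "component i (e i) \<ominus>\<^bsub>FJ\<^esub> e i \<in> degree_le J k"
          using dc
        proof (rule degree_leI)
          fix w :: "'v list" assume "\<not> length w \<le> k"
          then show "(component i (e i) \<ominus>\<^bsub>FJ\<^esub> e i) w = 0"
            unfolding d using Suc degree_leD[OF e(1)[of i], of w] by (auto simp: component_def)
        qed
        then show ?thesis using Suc by (simp add: filt_pred_def F_def)
      qed
      then have "\<eta> (component i (e i)) \<ominus>\<^bsub>R\<^esub> \<eta> (e i) \<in> Q i"
        using alg_hom_minus[OF FA.k_algebra_axioms R hom] ec component_carrier by metis
      then have "Q i +>\<^bsub>R\<^esub> \<eta> (component i (e i)) = g i"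
        unfolding e(2) using ec component_carrier alg_hom_closed[OF hom] by (subst coset_eq) blast+
      then show ?thesis using comp[of i] False by (simp add: to_gr_def)
    qed
    then show "g \<in> to_gr ` carrier (FJ)" using fc by (metis ext image_eqI)
  qed
qed

lemma to_gr_eq_iff:
  assumes f: "f \<in> carrier (FJ)" and g: "g \<in> carrier (FJ)"
  shows "to_gr f = to_gr g \<longleftrightarrow> (\<forall>i. \<eta> (component i (f \<ominus>\<^bsub>FJ\<^esub> g)) \<in> Q i)"
  using assms
  by (simp add: to_gr_def fun_eq_iff coset_eq eta_component_closed component_minus component_carrier
      alg_hom_minus[OF FA.k_algebra_axioms R hom])

end

section \<open>Skew Clifford algebras in a basis\<close>

text \<open>For the form \<open>0\<close> reordering preserves the number of letters, so the coefficients of monomials of a given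
  degree depend only on the component of that degree.\<close>

lemma symbol_component:
  assumes f: "f \<in> carrier (free_algebra (set js))" and L: "length L = length js"
  shows "symbol \<mu> (\<lambda>_ _. 0) js (component (count_list L True) f) (occupation L) =
    symbol \<mu> (\<lambda>_ _. 0) js f (occupation L)"
  using f
proof (induction f rule: free_algebra_induct)
  case zero
  have "component (count_list L True) \<zero>\<^bsub>free_algebra (set js)\<^esub> = (\<zero>\<^bsub>free_algebra (set js)\<^esub> :: nat list \<Rightarrow> 'a)"
    by (auto simp: component_def free_algebra_simps)
  then show ?case by simp
next
  case (add f c w)
  interpret FA: k_algebra "free_algebra (set js) :: ('a, nat list \<Rightarrow> 'a) module"
    by (rule k_algebra_free_algebra)
  have w: "(word w :: nat list \<Rightarrow> 'a) \<in> homogeneous (set js) (length w)" using add by (simp add: homogeneous_word)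
  have "symbol \<mu> (\<lambda>_ _. 0) js (component (count_list L True) (word w)) (occupation L) =
      symbol \<mu> (\<lambda>_ _. 0) js (word w) (occupation L)"
  proof (cases "count_list L True = length w")
    case True
    then show ?thesis by (simp add: component_of_homogeneous[OF w])
  next
    case False
    then have "component (count_list L True) (word w) = (\<zero>\<^bsub>free_algebra (set js)\<^esub> :: nat list \<Rightarrow> 'a)"
      using component_of_homogeneous[OF w] by (simp add: free_algebra_simps)
    then show ?thesis
      using False leading_symbolD(3)[OF leading_symbol_word L] add by (simp add: symbol_zero)
  qed
  then show ?case
    using add by (simp add: component_add component_smult symbol_add symbol_smult component_carrier word_closed)
qed

context tensor_basis
begin

definition eta :: "('v list \<Rightarrow> 'k) set set \<Rightarrow> (nat list \<Rightarrow> 'k) \<Rightarrow> ('v list \<Rightarrow> 'k) set set" where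
  "eta P f = Idl\<^bsub>T\<^esub> P +>\<^bsub>T\<^esub> to_tensor f"

lemma to_tensor_closed: "f \<in> carrier A \<Longrightarrow> to_tensor f \<in> carrier T"
  by (rule alg_hom_closed[OF to_tensor_hom])

lemma eta_hom:
  assumes "P \<subseteq> carrier T"
  shows "eta P \<in> alg_hom A (quot_by T P)"
  unfolding eta_def by (rule alg_hom_comp[OF to_tensor_hom quot_by_proj[OF T.k_algebra_axioms assms]])

lemma eta_surj:
  assumes "P \<subseteq> carrier T"
  shows "eta P ` carrier A = carrier (quot_by T P)"
  unfolding quot_by_surj[OF T.k_algebra_axioms assms, symmetric] to_tensor_surj[symmetric]
  by (auto simp: eta_def image_iff)

lemma eta_eq_zero:
  assumes "P \<subseteq> carrier T" "f \<in> carrier A"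
  shows "eta P f = \<zero>\<^bsub>quot_by T P\<^esub> \<longleftrightarrow> to_tensor f \<in> Idl\<^bsub>T\<^esub> P"
  unfolding eta_def by (rule quot_by_eq_zero[OF T.k_algebra_axioms assms(1) to_tensor_closed[OF assms(2)]])

definition free_relation :: "(nat \<Rightarrow> nat \<Rightarrow> 'k) \<Rightarrow> (nat \<Rightarrow> nat \<Rightarrow> 'k) \<Rightarrow> nat \<Rightarrow> nat \<Rightarrow> nat list \<Rightarrow> 'k" where
  "free_relation \<mu> q i j =
     (word [i, j] \<oplus>\<^bsub>A\<^esub> \<mu> i j \<odot>\<^bsub>A\<^esub> word [j, i]) \<ominus>\<^bsub>A\<^esub> (2 * q i j) \<odot>\<^bsub>A\<^esub> \<one>\<^bsub>A\<^esub>"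

abbreviation "form \<phi> \<equiv> (\<lambda>i j. \<phi> (x i) (x j))"
abbreviation "relations \<mu> \<phi> \<equiv> skew_clifford_relations scale W J x \<mu> \<phi>"
abbreviation "sc \<mu> \<phi> \<equiv> skew_clifford scale W J x \<mu> \<phi>"
abbreviation "gen \<mu> \<phi> i \<equiv> eta (relations \<mu> \<phi>) (word [i])"

lemma free_relation_closed: "\<lbrakk>i \<in> J; j \<in> J\<rbrakk> \<Longrightarrow> free_relation \<mu> q i j \<in> carrier A"
  by (simp add: free_relation_def word_closed)

lemma free_relation_apply:
  assumes "i \<in> J" "j \<in> J"
  shows "free_relation \<mu> q i j =
    (\<lambda>w. word [i, j] w + \<mu> i j * word [j, i] w - 2 * q i j * word [] w)"
proof -
  have "free_relation \<mu> q i j = (\<lambda>w. (word [i, j] \<oplus>\<^bsub>A\<^esub> \<mu> i j \<odot>\<^bsub>A\<^esub> word [j, i]) w -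
      ((2 * q i j) \<odot>\<^bsub>A\<^esub> \<one>\<^bsub>A\<^esub>) w)"
    unfolding free_relation_def using assms by (intro free_algebra_minus) (simp_all add: word_closed)
  then show ?thesis by (simp add: free_algebra_simps)
qed

lemma relations_eq: "relations \<mu> \<phi> = {to_tensor (free_relation \<mu> (form \<phi>) i j) | i j. i \<in> J \<and> j \<in> J}"
proof -
  have *: "to_tensor (free_relation \<mu> (form \<phi>) i j) =
      (tensor scale W [x i, x j] \<oplus>\<^bsub>T\<^esub> \<mu> i j \<odot>\<^bsub>T\<^esub> tensor scale W [x j, x i])
        \<ominus>\<^bsub>T\<^esub> (2 * \<phi> (x i) (x j)) \<odot>\<^bsub>T\<^esub> \<one>\<^bsub>T\<^esub>" if "i \<in> J" "j \<in> J" for i j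
    using that unfolding free_relation_def
    by (simp add: alg_hom_minus[OF A.k_algebra_axioms T.k_algebra_axioms to_tensor_hom]
        alg_homD[OF to_tensor_hom] word_closed to_tensor_word)
  show ?thesis
    unfolding skew_clifford_relations_def Let_def by (intro Collect_cong iff_exI) (auto simp: *)
qed

lemma relations_closed: "relations \<mu> \<phi> \<subseteq> carrier T"
  unfolding relations_eq using to_tensor_closed[OF free_relation_closed] by auto

lemma k_algebra_sc: "k_algebra (sc \<mu> \<phi>)"
  unfolding skew_clifford_def by (rule k_algebra_quot_by[OF T.k_algebra_axioms relations_closed])

lemma sc_eta_hom: "eta (relations \<mu> \<phi>) \<in> alg_hom A (sc \<mu> \<phi>)"
  unfolding skew_clifford_def by (rule eta_hom[OF relations_closed])

lemma sc_eta_surj: "eta (relations \<mu> \<phi>) ` carrier A = carrier (sc \<mu> \<phi>)"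
  unfolding skew_clifford_def by (rule eta_surj[OF relations_closed])

lemma gen_closed: "i \<in> J \<Longrightarrow> gen \<mu> \<phi> i \<in> carrier (sc \<mu> \<phi>)"
  by (rule alg_hom_closed[OF sc_eta_hom]) (simp add: word_closed)

text \<open>Passes between homomorphisms that kill the relations and elements that satisfy them.\<close>

lemma free_hom_relation:
  fixes B :: "('k, 'b) module"
  assumes B: "k_algebra B" and b: "\<And>i. i \<in> J \<Longrightarrow> b i \<in> carrier B" and ij: "i \<in> J" "j \<in> J"
  shows "free_hom B b (free_relation \<mu> q i j) = \<zero>\<^bsub>B\<^esub> \<longleftrightarrow>
    b i \<otimes>\<^bsub>B\<^esub> b j \<oplus>\<^bsub>B\<^esub> \<mu> i j \<odot>\<^bsub>B\<^esub> (b j \<otimes>\<^bsub>B\<^esub> b i) = (2 * q i j) \<odot>\<^bsub>B\<^esub> \<one>\<^bsub>B\<^esub>"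
proof -
  interpret B: k_algebra B by fact
  note hom = free_hom_alg_hom[of B J b, OF B b]
  show ?thesis
    using ij b unfolding free_relation_def
    by (simp add: alg_hom_minus[OF A.k_algebra_axioms B hom] alg_homD[OF hom] word_closed
        free_hom_word[of B J b, OF B b])
qed

lemma sc_eta_free_hom:
  "f \<in> carrier A \<Longrightarrow> eta (relations \<mu> \<phi>) f = free_hom (sc \<mu> \<phi>) (gen \<mu> \<phi>) f"
  by (rule free_hom_unique[OF k_algebra_sc gen_closed sc_eta_hom refl])

lemma sc_relations: "skew_relations (sc \<mu> \<phi>) J \<mu> (form \<phi>) (gen \<mu> \<phi>)"
proof -
  have "free_hom (sc \<mu> \<phi>) (gen \<mu> \<phi>) (free_relation \<mu> (form \<phi>) i j) = \<zero>\<^bsub>sc \<mu> \<phi>\<^esub>"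
    if ij: "i \<in> J" "j \<in> J" for i j
  proof -
    have "to_tensor (free_relation \<mu> (form \<phi>) i j) \<in> relations \<mu> \<phi>"
      unfolding relations_eq using ij by blast
    then have "eta (relations \<mu> \<phi>) (free_relation \<mu> (form \<phi>) i j) = \<zero>\<^bsub>sc \<mu> \<phi>\<^esub>"
      unfolding eta_def skew_clifford_def by (rule quot_by_kills[OF T.k_algebra_axioms relations_closed])
    then show ?thesis using sc_eta_free_hom[OF free_relation_closed[OF ij]] by simp
  qed
  then show ?thesis
    using free_hom_relation[of "sc \<mu> \<phi>" "gen \<mu> \<phi>", OF k_algebra_sc gen_closed] gen_closed
    by (auto simp: skew_relations_def)
qed

lemma hom_through_tensor:
  fixes B :: "('k, 'b) module"
  assumes B: "k_algebra B" and b: "\<And>i. i \<in> J \<Longrightarrow> b i \<in> carrier B"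
  obtains g where "g \<in> alg_hom T B" "\<And>f. f \<in> carrier A \<Longrightarrow> g (to_tensor f) = free_hom B b f"
proof -
  obtain g where g: "g \<in> alg_hom T A" "\<And>a. a \<in> carrier A \<Longrightarrow> g (to_tensor a) = a"
    using to_tensor_inverse_exists by metis
  show thesis
    by (rule that[OF alg_hom_comp[OF g(1) free_hom_alg_hom[of B J b, OF B b]]]) (simp_all add: g(2))
qed

text \<open>The universal property of the skew Clifford algebra. All homomorphisms out of it, in particular its
  representations, are obtained from this.\<close>

lemma sc_universal:
  fixes B :: "('k, 'b) module"
  assumes B: "k_algebra B" and rel: "skew_relations B J \<mu> (form \<phi>) b"
  obtains h where "h \<in> alg_hom (sc \<mu> \<phi>) B"
    "\<And>f. f \<in> carrier A \<Longrightarrow> h (eta (relations \<mu> \<phi>) f) = free_hom B b f"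
proof -
  have b: "\<And>i. i \<in> J \<Longrightarrow> b i \<in> carrier B" using rel by (simp add: skew_relations_def)
  obtain g where g: "g \<in> alg_hom T B" "\<And>f. f \<in> carrier A \<Longrightarrow> g (to_tensor f) = free_hom B b f"
    using hom_through_tensor[of B b, OF B b] by metis
  have kill: "g s = \<zero>\<^bsub>B\<^esub>" if s: "s \<in> relations \<mu> \<phi>" for s
  proof -
    obtain i j where ij: "i \<in> J" "j \<in> J" "s = to_tensor (free_relation \<mu> (form \<phi>) i j)"
      using s unfolding relations_eq by blast
    have "b i \<otimes>\<^bsub>B\<^esub> b j \<oplus>\<^bsub>B\<^esub> \<mu> i j \<odot>\<^bsub>B\<^esub> (b j \<otimes>\<^bsub>B\<^esub> b i) = (2 * form \<phi> i j) \<odot>\<^bsub>B\<^esub> \<one>\<^bsub>B\<^esub>"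
      using rel ij unfolding skew_relations_def by blast
    then have "free_hom B b (free_relation \<mu> (form \<phi>) i j) = \<zero>\<^bsub>B\<^esub>"
      using free_hom_relation[of B b i j \<mu> "form \<phi>", OF B b ij(1,2)] by simp
    then show ?thesis using ij g(2) free_relation_closed by simp
  qed
  obtain h where h: "h \<in> alg_hom (sc \<mu> \<phi>) B"
    "\<And>t. t \<in> carrier T \<Longrightarrow> h (Idl\<^bsub>T\<^esub> (relations \<mu> \<phi>) +>\<^bsub>T\<^esub> t) = g t"
    using quot_by_factor[OF T.k_algebra_axioms relations_closed B g(1) kill]
    unfolding skew_clifford_def by metis
  show thesis
    by (rule that[OF h(1)]) (simp add: eta_def h(2) to_tensor_closed g(2))
qed

section \<open>The PBW theorem under invariance\<close>

definition idx :: "nat list" where "idx = sorted_list_of_set J"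

lemma idx: "set idx = J" "distinct idx"
  using finite_J by (simp_all add: idx_def)

text \<open>The symbol determines the class in the algebra by \<open>normal_form_symbol\<close>. Conversely, invariance makes
  \<open>fock\<close> a representation of the algebra, so that the class determines the symbol.\<close>

lemma sc_eta_eq_zero_iff:
  assumes two: "(2::'k) \<noteq> 0" and anti: "mult_antisymmetric J \<mu>" and inv: "invariant_form J \<mu> (form \<phi>)"
    and f: "f \<in> carrier A"
  shows "eta (relations \<mu> \<phi>) f = \<zero>\<^bsub>sc \<mu> \<phi>\<^esub> \<longleftrightarrow>
    (\<forall>L. length L = length idx \<longrightarrow> symbol \<mu> (form \<phi>) idx f (occupation L) = 0)"
proof
  have "skew_relations linear_operators J \<mu> (form \<phi>) (fock \<mu> (form \<phi>) idx)"
    using fock_skew_relations[of idx \<mu> "form \<phi>"] anti inv idx by simp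
  from sc_universal[OF k_algebra_linear_operators this] obtain h where
    h: "h \<in> alg_hom (sc \<mu> \<phi>) linear_operators"
      "\<And>f. f \<in> carrier A \<Longrightarrow> h (eta (relations \<mu> \<phi>) f) = fock_hom \<mu> (form \<phi>) idx f"
    unfolding fock_hom_def by metis
  assume "eta (relations \<mu> \<phi>) f = \<zero>\<^bsub>sc \<mu> \<phi>\<^esub>"
  then have "fock_hom \<mu> (form \<phi>) idx f = \<zero>\<^bsub>linear_operators\<^esub>"
    using h(2)[OF f] alg_hom_zero[OF k_algebra_sc k_algebra_linear_operators h(1)] by simp
  then show "\<forall>L. length L = length idx \<longrightarrow> symbol \<mu> (form \<phi>) idx f (occupation L) = 0"
    by (simp add: symbol_def linear_operators_simps)
next
  assume "\<forall>L. length L = length idx \<longrightarrow> symbol \<mu> (form \<phi>) idx f (occupation L) = 0"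
  then have "normal_form (sc \<mu> \<phi>) (gen \<mu> \<phi>) idx (symbol \<mu> (form \<phi>) idx f) = \<zero>\<^bsub>sc \<mu> \<phi>\<^esub>"
    using idx gen_closed by (intro normal_form_eq_zero[OF k_algebra_sc]) auto
  then show "eta (relations \<mu> \<phi>) f = \<zero>\<^bsub>sc \<mu> \<phi>\<^esub>"
    using normal_form_symbol[OF k_algebra_sc two, where js = idx and \<mu> = \<mu> and q = "form \<phi>" and b = "gen \<mu> \<phi>" and f = f] sc_relations anti f idx
    by (simp add: sc_eta_free_hom)
qed

lemma sc_eta_normal_form:
  assumes two: "(2::'k) \<noteq> 0" and anti: "mult_antisymmetric J \<mu>" and f: "f \<in> carrier A"
  shows "eta (relations \<mu> \<phi>) f =
    eta (relations \<mu> \<phi>) (normal_form A (\<lambda>i. word [i]) idx (symbol \<mu> (form \<phi>) idx f))"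
proof -
  have "eta (relations \<mu> \<phi>) (normal_form A (\<lambda>i. word [i]) idx (symbol \<mu> (form \<phi>) idx f)) =
      normal_form (sc \<mu> \<phi>) (gen \<mu> \<phi>) idx (symbol \<mu> (form \<phi>) idx f)"
    using idx by (intro normal_form_hom[OF A.k_algebra_axioms sc_eta_hom, of J]) (auto simp: word_closed)
  also have "\<dots> = free_hom (sc \<mu> \<phi>) (gen \<mu> \<phi>) f"
    using normal_form_symbol[OF k_algebra_sc two, where js = idx and \<mu> = \<mu> and q = "form \<phi>" and b = "gen \<mu> \<phi>" and f = f] sc_relations anti f idx
    by simp
  finally show ?thesis using f by (simp add: sc_eta_free_hom)
qed

lemma invariant_form_zero: "invariant_form J \<mu> (form (\<lambda>_ _. 0))"
  by (simp add: invariant_form_def)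

text \<open>If \<open>f\<close> agrees with an element of lower degree modulo the relations, its symbol vanishes in degree \<open>d\<close>;
  but there it is the symbol for the form \<open>0\<close>, which has no coefficients in other degrees. Conversely, if the
  symbol for the form \<open>0\<close> vanishes, the normal form of \<open>f\<close> is an element of lower degree.\<close>

lemma graded_kernel:
  assumes two: "(2::'k) \<noteq> 0" and anti: "mult_antisymmetric J \<mu>" and inv: "invariant_form J \<mu> (form \<phi>)"
    and f: "f \<in> homogeneous J d"
  shows "eta (relations \<mu> \<phi>) f \<in> filt_pred (sc \<mu> \<phi>) (\<lambda>i. eta (relations \<mu> \<phi>) ` degree_le J i) d \<longleftrightarrow>
    eta (relations \<mu> (\<lambda>_ _. 0)) f = \<zero>\<^bsub>sc \<mu> (\<lambda>_ _. 0)\<^esub>"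
    (is "?e f \<in> ?Q d \<longleftrightarrow> _")
proof -
  have fc: "f \<in> carrier A" using f by (simp add: homogeneous_def)
  note iff = sc_eta_eq_zero_iff[where \<mu> = \<mu> and \<phi> = \<phi>, OF two anti inv]
  note iff0 = sc_eta_eq_zero_iff[where \<mu> = \<mu> and \<phi> = "\<lambda>_ _. 0", OF two anti invariant_form_zero fc]
  let ?s = "symbol \<mu> (form \<phi>) idx"
  let ?t = "symbol \<mu> (\<lambda>_ _. 0) idx"
  have lead: "leading_symbol (length idx) (int d) (?s f) (?t f)"
    using leading_symbol_homogeneous[of f idx d] f idx by simp
  show ?thesis
  proof
    assume mem: "?e f \<in> ?Q d"
    have "?s f (occupation L) = 0" if L: "length L = length idx" "count_list L True = d" for L
    proof (cases "d = 0")
      case True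
      then show ?thesis using mem iff[OF fc] L by (simp add: filt_pred_def)
    next
      case False
      then obtain g where g: "g \<in> degree_le J (d - 1)" "?e f = ?e g"
        using mem by (auto simp: filt_pred_def)
      have gc: "g \<in> carrier A" using g by (simp add: degree_le_def)
      have "?e (f \<ominus>\<^bsub>A\<^esub> g) = \<zero>\<^bsub>sc \<mu> \<phi>\<^esub>"
        using alg_hom_eq_iff[OF A.k_algebra_axioms k_algebra_sc sc_eta_hom fc gc] g(2) by simp
      then have "?s (f \<ominus>\<^bsub>A\<^esub> g) (occupation L) = 0" using iff[of "f \<ominus>\<^bsub>A\<^esub> g"] fc gc L by simp
      then have "?s f (occupation L) = ?s g (occupation L)"
        using symbol_minus[OF fc gc, of \<mu> "form \<phi>" idx] by simp
      also have "\<dots> = 0"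
      proof -
        have "symbol_bound (length idx) (int (d - 1)) (?s g)"
          using symbol_bound_degree_le[of g idx "d - 1"] g(1) idx by simp
        then show ?thesis using L False by (simp add: symbol_bound_def)
      qed
      finally show ?thesis .
    qed
    then have "?t f (occupation L) = 0" if L: "length L = length idx" for L
      using leading_symbolD[OF lead L] L by (cases "count_list L True = d") auto
    then show "eta (relations \<mu> (\<lambda>_ _. 0)) f = \<zero>\<^bsub>sc \<mu> (\<lambda>_ _. 0)\<^esub>" using iff0 by simp
  next
    assume "eta (relations \<mu> (\<lambda>_ _. 0)) f = \<zero>\<^bsub>sc \<mu> (\<lambda>_ _. 0)\<^esub>"
    then have s0: "?t f (occupation L) = 0" if "length L = length idx" for L
      using iff0 that by simp
    let ?n = "normal_form A (\<lambda>i. word [i]) idx (?s f)"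
    have n: "?n \<in> carrier A"
      using idx by (intro normal_form_closed[of A J "\<lambda>i. word [i]", OF A.k_algebra_axioms]) (auto simp: word_closed)
    have len: "length w < d" if w: "?n w \<noteq> 0" for w
    proof -
      obtain L where L: "length L = length idx" "count_list L True = length w" "?s f (occupation L) \<noteq> 0"
        using normal_form_degree[OF w] by blast
      then show ?thesis
        using leading_symbolD(1,2)[OF lead L(1)] s0[OF L(1)] by (cases "length w" d rule: linorder_cases) auto
    qed
    have "?e ?n \<in> ?Q d"
    proof (cases "d = 0")
      case True
      then have "?n = \<zero>\<^bsub>A\<^esub>" using len by (auto simp: free_algebra_simps)
      then show ?thesis
        using True alg_hom_zero[OF A.k_algebra_axioms k_algebra_sc sc_eta_hom] by (simp add: filt_pred_def)
    next
      case False
      have "?n \<in> degree_le J (d - 1)"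
        using n len False by (fastforce simp: degree_le_def)
      then show ?thesis using False by (simp add: filt_pred_def)
    qed
    then show "?e f \<in> ?Q d" using sc_eta_normal_form[OF two anti fc] by simp
  qed
qed

lemma exterior_kernel_graded:
  assumes two: "(2::'k) \<noteq> 0" and anti: "mult_antisymmetric J \<mu>" and f: "f \<in> carrier A"
  shows "eta (relations \<mu> (\<lambda>_ _. 0)) f = \<zero>\<^bsub>sc \<mu> (\<lambda>_ _. 0)\<^esub> \<longleftrightarrow>
    (\<forall>d. eta (relations \<mu> (\<lambda>_ _. 0)) (component d f) = \<zero>\<^bsub>sc \<mu> (\<lambda>_ _. 0)\<^esub>)"
proof -
  let ?t = "symbol \<mu> (\<lambda>_ _. 0) idx"
  note iff0 = sc_eta_eq_zero_iff[where \<mu> = \<mu> and \<phi> = "\<lambda>_ _. 0", OF two anti invariant_form_zero]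
  have comp: "?t (component d f) (occupation L) = (if d = count_list L True then ?t f (occupation L) else 0)"
    if L: "length L = length idx" for d L
  proof (cases "d = count_list L True")
    case True
    then show ?thesis using symbol_component[OF _ L] f idx by simp
  next
    case False
    have "component d f \<in> homogeneous (set idx) d" using component_homogeneous[OF f] idx by simp
    from leading_symbolD(3)[OF leading_symbol_homogeneous[OF this] L] show ?thesis using False by simp
  qed
  show ?thesis
    unfolding iff0[OF f] iff0[OF component_carrier[OF f]] using comp by auto
qed

lemma quadratic_part_lin:
  assumes "f \<in> degree_le J 2" "g \<in> degree_le J 2"
  shows "quadratic_part scale W (to_tensor f \<oplus>\<^bsub>T\<^esub> to_tensor g) =
      quadratic_part scale W (to_tensor f) \<oplus>\<^bsub>T\<^esub> quadratic_part scale W (to_tensor g)"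
    and "quadratic_part scale W (c \<odot>\<^bsub>T\<^esub> to_tensor f) = c \<odot>\<^bsub>T\<^esub> quadratic_part scale W (to_tensor f)"
proof -
  have sub: "k_subspace A (degree_le J 2)" by (rule degree_le_subspace)
  have cl: "f \<in> carrier A" "g \<in> carrier A" using assms by (simp_all add: degree_le_def)
  have "f \<oplus>\<^bsub>A\<^esub> g \<in> degree_le J 2" "c \<odot>\<^bsub>A\<^esub> f \<in> degree_le J 2"
    using sub assms by (simp_all add: k_subspace_def)
  then show "quadratic_part scale W (to_tensor f \<oplus>\<^bsub>T\<^esub> to_tensor g) =
      quadratic_part scale W (to_tensor f) \<oplus>\<^bsub>T\<^esub> quadratic_part scale W (to_tensor g)"
    "quadratic_part scale W (c \<odot>\<^bsub>T\<^esub> to_tensor f) = c \<odot>\<^bsub>T\<^esub> quadratic_part scale W (to_tensor f)"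
    using cl assms
    by (simp_all add: quadratic_part_eq component_add component_smult component_carrier
        alg_hom_add[OF to_tensor_hom, symmetric] alg_hom_smult[OF to_tensor_hom, symmetric])
qed

lemma free_relation_degree:
  assumes "i \<in> J" "j \<in> J"
  shows "free_relation \<mu> q i j \<in> degree_le J 2"
proof (rule degree_leI[OF free_relation_closed[OF assms]])
  fix w :: "nat list" assume "\<not> length w \<le> 2"
  then have "w \<noteq> [i, j]" "w \<noteq> [j, i]" "w \<noteq> []" by auto
  then show "free_relation \<mu> q i j w = 0"
    unfolding free_relation_apply[OF assms] by (simp add: word_def)
qed

lemma component_free_relation:
  assumes "i \<in> J" "j \<in> J"
  shows "component 2 (free_relation \<mu> q i j) = free_relation \<mu> (\<lambda>_ _. 0) i j"
proof
  fix w :: "nat list"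
  have "word [] w = (0::'k)" if "length w = 2"
    using that by (auto simp: word_def)
  moreover have "word [i, j] w = (0::'k)" "word [j, i] w = (0::'k)" if "length w \<noteq> 2"
    using that by (auto simp: word_def)
  ultimately show "component 2 (free_relation \<mu> q i j) w = free_relation \<mu> (\<lambda>_ _. 0) i j w"
    unfolding free_relation_apply[OF assms] component_def by (cases "length w = 2") simp_all
qed

lemma span_relations_subset: "k_span T (relations \<mu> \<phi>) \<subseteq> tensor_filtration scale W 2"
  unfolding tensor_filtration_eq
  by (intro k_span_minimal image_subspace degree_le_subspace)
     (auto simp: relations_eq free_relation_degree)

text \<open>The quadratic part of the relation for \<open>\<phi>\<close> is the relation for the form \<open>0\<close>, and taking quadratic parts is
  linear.\<close>

lemma span_relations_deform:
  "Idl\<^bsub>T\<^esub> (quadratic_part scale W ` k_span T (relations \<mu> \<phi>)) = Idl\<^bsub>T\<^esub> (relations \<mu> (\<lambda>_ _. 0))"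
proof -
  let ?P = "k_span T (relations \<mu> \<phi>)" and ?I0 = "Idl\<^bsub>T\<^esub> (relations \<mu> (\<lambda>_ _. 0))"
  have I0: "ideal ?I0 T" by (rule T.genideal_ideal[OF relations_closed])
  have sub0: "k_subspace T ?I0" by (rule ideal_k_subspace[OF T.k_algebra_axioms I0])
  have subF: "k_subspace T (to_tensor ` degree_le J 2)" by (intro image_subspace degree_le_subspace)
  let ?U = "{t \<in> to_tensor ` degree_le J 2. quadratic_part scale W t \<in> ?I0}"
  have rel: "quadratic_part scale W (to_tensor (free_relation \<mu> q i j)) = to_tensor (free_relation \<mu> (\<lambda>_ _. 0) i j)"
    if "i \<in> J" "j \<in> J" for i j q
    using that by (simp add: quadratic_part_eq free_relation_degree component_free_relation)
  have rel0: "to_tensor (free_relation \<mu> (\<lambda>_ _. 0) i j) \<in> relations \<mu> (\<lambda>_ _. 0)" if "i \<in> J" "j \<in> J" for i j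
    using that unfolding relations_eq by blast
  have "k_subspace T ?U"
  proof -
    have "quadratic_part scale W \<zero>\<^bsub>T\<^esub> = \<zero>\<^bsub>T\<^esub>"
    proof -
      have z: "\<zero>\<^bsub>A\<^esub> \<in> degree_le J 2" using degree_le_subspace[of J 2] unfolding k_subspace_def by blast
      have "component 2 \<zero>\<^bsub>A\<^esub> = \<zero>\<^bsub>A\<^esub>" by (auto simp: component_def free_algebra_simps)
      then show ?thesis
        using quadratic_part_eq[OF z] alg_hom_zero[OF A.k_algebra_axioms T.k_algebra_axioms to_tensor_hom] by simp
    qed
    moreover have "a \<oplus>\<^bsub>T\<^esub> b \<in> ?U" if a: "a \<in> ?U" and b: "b \<in> ?U" for a b
    proof -
      obtain f g where fg: "f \<in> degree_le J 2" "a = to_tensor f" "g \<in> degree_le J 2" "b = to_tensor g"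
        using a b by auto
      have "a \<oplus>\<^bsub>T\<^esub> b \<in> to_tensor ` degree_le J 2"
        using subF fg(1,3) unfolding fg(2,4) k_subspace_def by blast
      moreover have "quadratic_part scale W a \<oplus>\<^bsub>T\<^esub> quadratic_part scale W b \<in> ?I0"
        using sub0 a b unfolding k_subspace_def by simp
      ultimately show ?thesis using quadratic_part_lin(1)[OF fg(1,3)] unfolding fg(2,4) by simp
    qed
    moreover have "c \<odot>\<^bsub>T\<^esub> a \<in> ?U" if a: "a \<in> ?U" for a c
    proof -
      obtain f where f: "f \<in> degree_le J 2" "a = to_tensor f" using a by auto
      have "c \<odot>\<^bsub>T\<^esub> a \<in> to_tensor ` degree_le J 2"
        using subF f(1) unfolding f(2) k_subspace_def by blast
      moreover have "c \<odot>\<^bsub>T\<^esub> quadratic_part scale W a \<in> ?I0"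
        using sub0 a unfolding k_subspace_def by simp
      ultimately show ?thesis using quadratic_part_lin(2)[OF f(1) f(1)] unfolding f(2) by simp
    qed
    moreover have "?U \<subseteq> carrier T" "\<zero>\<^bsub>T\<^esub> \<in> to_tensor ` degree_le J 2" "\<zero>\<^bsub>T\<^esub> \<in> ?I0"
      using subF sub0 unfolding k_subspace_def by blast+
    ultimately show ?thesis
      unfolding k_subspace_def by simp
  qed
  moreover have "relations \<mu> \<phi> \<subseteq> ?U"
    using rel subsetD[OF T.genideal_self[OF relations_closed] rel0]
    by (auto simp: relations_eq[of \<mu> \<phi>] free_relation_degree)
  ultimately have "?P \<subseteq> ?U" by (rule k_span_minimal)
  then have qp: "quadratic_part scale W ` ?P \<subseteq> ?I0" by blast
  then have qpc: "quadratic_part scale W ` ?P \<subseteq> carrier T"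
    using sub0 by (auto simp: k_subspace_def)
  show ?thesis
  proof
    show "Idl\<^bsub>T\<^esub> (quadratic_part scale W ` ?P) \<subseteq> ?I0" by (rule T.genideal_minimal[OF I0 qp])
    have "relations \<mu> (\<lambda>_ _. 0) \<subseteq> quadratic_part scale W ` ?P"
    proof
      fix t assume "t \<in> relations \<mu> (\<lambda>_ _. 0)"
      then obtain i j where ij: "i \<in> J" "j \<in> J" "t = to_tensor (free_relation \<mu> (\<lambda>_ _. 0) i j)"
        unfolding relations_eq by blast
      have "to_tensor (free_relation \<mu> (form \<phi>) i j) \<in> relations \<mu> \<phi>"
        unfolding relations_eq using ij by blast
      then have "to_tensor (free_relation \<mu> (form \<phi>) i j) \<in> ?P" by (rule subsetD[OF k_span_superset])
      then show "t \<in> quadratic_part scale W ` ?P"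
        unfolding ij(3) rel[OF ij(1,2), of "form \<phi>", symmetric] by (rule imageI)
    qed
    then show "?I0 \<subseteq> Idl\<^bsub>T\<^esub> (quadratic_part scale W ` ?P)"
      using T.genideal_self[OF qpc] by (intro T.genideal_minimal T.genideal_ideal qpc) blast
  qed
qed

text \<open>The projections of the free algebra onto the quantum exterior algebra and onto the graded algebra of
  the skew Clifford algebra are surjective, and by \<open>graded_kernel\<close> they have the same fibres. The resulting
  isomorphism is the natural projection.\<close>

theorem pbw_of_invariant_form:
  assumes two: "(2::'k) \<noteq> 0" and anti: "mult_antisymmetric J \<mu>" and inv: "invariant_form J \<mu> (form \<phi>)"
  shows "pbw_deformation scale W J x \<mu> (sc \<mu> \<phi>)"
proof -
  let ?P = "k_span T (relations \<mu> \<phi>)" and ?E = "sc \<mu> (\<lambda>_ _. 0)" and ?e0 = "eta (relations \<mu> (\<lambda>_ _. 0))"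
  have P: "k_subspace T ?P" by (rule k_span_subspace[OF T.k_algebra_axioms relations_closed])
  then have Pc: "?P \<subseteq> carrier T" by (simp add: k_subspace_def)
  have idl: "Idl\<^bsub>T\<^esub> ?P = Idl\<^bsub>T\<^esub> (relations \<mu> \<phi>)"
    by (rule genideal_k_span[OF T.k_algebra_axioms relations_closed])
  then have R: "quot_by T ?P = sc \<mu> \<phi>"
    unfolding skew_clifford_def using quot_by_eq_iff[OF T.k_algebra_axioms Pc relations_closed] by blast
  have eta: "eta ?P = eta (relations \<mu> \<phi>)" unfolding eta_def idl ..
  interpret G: graded_quotient "sc \<mu> \<phi>" J "eta (relations \<mu> \<phi>)"
    by (rule graded_quotient.intro[OF k_algebra_sc sc_eta_hom])
  have F: "quot_filtration scale W ?P = G.F"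
    by (rule ext) (simp add: quot_filtration_def Let_def tensor_filtration_eq G.F_def image_image eta_def idl)
  have QF: "G.Q = filt_pred (sc \<mu> \<phi>) (\<lambda>i. eta (relations \<mu> \<phi>) ` degree_le J i)"
    by (simp only: G.F_def[abs_def])
  have fib: "?e0 f = ?e0 g \<longleftrightarrow> G.to_gr f = G.to_gr g" if f: "f \<in> carrier A" and g: "g \<in> carrier A" for f g
  proof -
    have fg: "f \<ominus>\<^bsub>A\<^esub> g \<in> carrier A" using f g by simp
    have "?e0 f = ?e0 g \<longleftrightarrow> ?e0 (f \<ominus>\<^bsub>A\<^esub> g) = \<zero>\<^bsub>?E\<^esub>"
      by (rule alg_hom_eq_iff[OF A.k_algebra_axioms k_algebra_sc sc_eta_hom f g])
    also have "\<dots> \<longleftrightarrow> (\<forall>d. ?e0 (component d (f \<ominus>\<^bsub>A\<^esub> g)) = \<zero>\<^bsub>?E\<^esub>)"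
      by (rule exterior_kernel_graded[OF two anti fg])
    also have "\<dots> \<longleftrightarrow> (\<forall>d. eta (relations \<mu> \<phi>) (component d (f \<ominus>\<^bsub>A\<^esub> g)) \<in> G.Q d)"
      unfolding QF graded_kernel[OF two anti inv component_homogeneous[OF fg]] ..
    also have "\<dots> \<longleftrightarrow> G.to_gr f = G.to_gr g" by (rule G.to_gr_eq_iff[OF f g, symmetric])
    finally show ?thesis .
  qed
  obtain p where p: "p \<in> alg_iso ?E (gr (sc \<mu> \<phi>) G.F)" "\<And>f. f \<in> carrier A \<Longrightarrow> p (?e0 f) = G.to_gr f"
    using surjective_factor_iso[OF A.k_algebra_axioms sc_eta_hom sc_eta_surj G.to_gr_hom G.to_gr_surj fib]
    by metis
  have class1: "p (Idl\<^bsub>T\<^esub> (relations \<mu> (\<lambda>_ _. 0)) +>\<^bsub>T\<^esub> tensor scale W [v]) =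
      gr_class1 (sc \<mu> \<phi>) G.F (Idl\<^bsub>T\<^esub> ?P +>\<^bsub>T\<^esub> tensor scale W [v])" if v: "v \<in> W" for v
  proof -
    have "p (?e0 (coord_element v)) = G.to_gr (coord_element v)"
      by (rule p(2)[OF coord_element_closed])
    also have "\<dots> = gr_class1 (sc \<mu> \<phi>) G.F (eta ?P (coord_element v))"
    proof
      fix i
      have z: "eta (relations \<mu> \<phi>) (\<lambda>w. 0) = \<zero>\<^bsub>sc \<mu> \<phi>\<^esub>"
        using alg_hom_zero[OF A.k_algebra_axioms k_algebra_sc sc_eta_hom] by (simp add: free_algebra_simps)
      show "G.to_gr (coord_element v) i = gr_class1 (sc \<mu> \<phi>) G.F (eta ?P (coord_element v)) i"
        by (simp add: G.to_gr_def gr_class1_def component_of_homogeneous[OF coord_element_homogeneous] eta z)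
    qed
    finally show ?thesis unfolding eta_def to_tensor_coord_element[OF v] .
  qed
  have "natural_projection scale W J x \<mu> ?P p"
    unfolding natural_projection_def Let_def quantum_exterior_def F R
    using p(1) class1 by (auto simp: alg_iso_def)
  moreover have "deforms_relations scale W J x \<mu> ?P"
  proof -
    have "quadratic_part scale W ` ?P \<subseteq> carrier T"
    proof
      fix t assume "t \<in> quadratic_part scale W ` ?P"
      then obtain f where "f \<in> degree_le J 2" "t = quadratic_part scale W (to_tensor f)"
        using span_relations_subset[of \<mu> \<phi>] unfolding tensor_filtration_eq by blast
      then show "t \<in> carrier T"
        by (simp add: quadratic_part_eq to_tensor_closed component_carrier degree_le_def)
    qed
    then have "?E = quot_by T (quadratic_part scale W ` ?P)"
      unfolding skew_clifford_def
      by (simp only: quot_by_eq_iff[OF T.k_algebra_axioms relations_closed] span_relations_deform)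
    then show ?thesis
      unfolding deforms_relations_def quantum_exterior_def using P span_relations_subset by blast
  qed
  ultimately have "pbw_relations scale W J x \<mu> ?P"
    unfolding pbw_relations_def F R quantum_exterior_def using p(1) by blast
  moreover have "alg_isomorphic (sc \<mu> \<phi>) (quot_by T ?P)"
    unfolding R alg_isomorphic_def alg_iso_def
    by (auto simp: alg_hom_def ring_hom_def bij_betw_def intro!: exI[of _ "\<lambda>a. a"])
  ultimately show ?thesis
    unfolding pbw_deformation_def using k_algebra_sc by blast
qed

end

section \<open>Linear dependencies between the generators\<close>

context k_algebra
begin

lemma smult_cancel: "\<lbrakk>c \<odot> x = d \<odot> x; x \<in> carrier A; x \<noteq> \<zero>\<rbrakk> \<Longrightarrow> c = d"
proof (rule ccontr)
  assume eq: "c \<odot> x = d \<odot> x" and x: "x \<in> carrier A" "x \<noteq> \<zero>" and "c \<noteq> d"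
  have "(c - d) \<odot> x = c \<odot> x \<oplus> (- d) \<odot> x" using smult_l_distr[OF x(1), of c "- d"] by simp
  also have "\<dots> = \<zero>" using eq x by (simp add: smult_uminus r_neg)
  finally show False using smult_eq_zeroD[of "c - d" x] \<open>c \<noteq> d\<close> x by simp
qed

lemma smult_solve:
  assumes "c \<odot> x = y" "c \<noteq> 0" "x \<in> carrier A"
  shows "x = inverse c \<odot> y"
  using assms by (auto simp: smult_assoc[symmetric])

lemma two_term_dependence:
  assumes "a \<odot> x \<oplus> b \<odot> y = \<zero>" "x \<in> carrier A" "y \<in> carrier A" "\<And>c. x \<noteq> c \<odot> y"
  shows "a = 0"
proof (rule ccontr)
  assume "a \<noteq> 0"
  have "a \<odot> x = (- b) \<odot> y"
    using assms(1-3) by (metis smult_uminus minus_equality smult_closed minus_minus a_inv_closed)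
  then have "x = inverse a \<odot> ((- b) \<odot> y)" by (rule smult_solve) (use \<open>a \<noteq> 0\<close> assms in auto)
  then show False using assms by (simp flip: smult_assoc)
qed

text \<open>Moves a multiple of \<open>x\<close> from the right to the left of an equation between linear combinations.\<close>

lemma smult_merge:
  assumes "x \<in> carrier A" "y \<in> carrier A"
  shows "a \<odot> x \<oplus> y = b \<odot> x \<oplus> z \<Longrightarrow> z \<in> carrier A \<Longrightarrow> (a - b) \<odot> x \<oplus> y = z"
proof -
  assume eq: "a \<odot> x \<oplus> y = b \<odot> x \<oplus> z" and z: "z \<in> carrier A"
  have "(a - b) \<odot> x \<oplus> y = (- b) \<odot> x \<oplus> (a \<odot> x \<oplus> y)"
    using assms smult_l_distr[OF assms(1), of a "- b"] by (simp add: a_ac)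
  also have "\<dots> = (- b) \<odot> x \<oplus> (b \<odot> x \<oplus> z)" using eq by simp
  also have "\<dots> = z" using assms z by (simp add: smult_uminus r_neg1 r_neg2)
  finally show ?thesis .
qed

end

text \<open>A nontrivial algebra \<open>R\<close> with elements \<open>X i\<close> satisfying the skew Clifford relations. The last condition is
  what remains of the universal property of a skew Clifford algebra: a generator pairing to zero with
  all generators can be specialised to zero.\<close>

locale skew_algebra = k_algebra R for R :: "('k::field, 'r) module" (structure) +
  fixes I :: "nat set" and \<mu> q :: "nat \<Rightarrow> nat \<Rightarrow> 'k" and X :: "nat \<Rightarrow> 'r"
  assumes two: "(2::'k) \<noteq> 0" and nonzero: "\<one> \<noteq> \<zero>"
    and rel: "skew_relations R I \<mu> q X"
    and anti: "mult_antisymmetric I \<mu>"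
    and sym: "\<And>i j. \<lbrakk>i \<in> I; j \<in> I\<rbrakk> \<Longrightarrow> q i j = \<mu> i j * q j i"
    and kill: "\<And>i. \<lbrakk>i \<in> I; \<And>p. p \<in> I \<Longrightarrow> q i p = 0\<rbrakk> \<Longrightarrow>
        \<exists>h\<in>alg_hom R R. h (X i) = \<zero> \<and> (\<forall>k\<in>I. k \<noteq> i \<longrightarrow> h (X k) = X k)"
begin

lemma X_closed [simp]: "i \<in> I \<Longrightarrow> X i \<in> carrier R"
  using rel by (simp add: skew_relations_def)

lemma relation: "\<lbrakk>i \<in> I; j \<in> I\<rbrakk> \<Longrightarrow> X i \<otimes> X j \<oplus> \<mu> i j \<odot> (X j \<otimes> X i) = (2 * q i j) \<odot> \<one>"
  using rel unfolding skew_relations_def by blast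

lemma mu_inverse: "\<lbrakk>i \<in> I; j \<in> I\<rbrakk> \<Longrightarrow> \<mu> i j * \<mu> j i = 1" and mu_diag: "i \<in> I \<Longrightarrow> \<mu> i i = 1"
  using anti unfolding mult_antisymmetric_def by blast+

lemma scalar_cancel: "c \<odot> \<one> = d \<odot> \<one> \<Longrightarrow> c = d"
  by (rule smult_cancel) (use nonzero in auto)

lemma scalar_mult [simp]: "x \<in> carrier R \<Longrightarrow> (c \<odot> \<one>) \<otimes> x = c \<odot> x" "x \<in> carrier R \<Longrightarrow> x \<otimes> (c \<odot> \<one>) = c \<odot> x"
  by (simp_all add: smult_mult_left smult_mult_right)

lemma square: "i \<in> I \<Longrightarrow> X i \<otimes> X i = q i i \<odot> \<one>"
  by (rule skew_relations_square[OF k_algebra_axioms two rel _ mu_diag])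

lemma swap: "\<lbrakk>i \<in> I; j \<in> I\<rbrakk> \<Longrightarrow> X i \<otimes> X j = (- \<mu> i j) \<odot> (X j \<otimes> X i) \<oplus> (2 * q i j) \<odot> \<one>"
  by (rule skew_relations_swap[OF k_algebra_axioms rel])

lemma swap_left:
  assumes "i \<in> I" "j \<in> I" "z \<in> carrier R"
  shows "X i \<otimes> (X j \<otimes> z) = (- \<mu> i j) \<odot> (X j \<otimes> (X i \<otimes> z)) \<oplus> (2 * q i j) \<odot> z"
proof -
  have "X i \<otimes> (X j \<otimes> z) = (X i \<otimes> X j) \<otimes> z" using assms by (simp add: m_assoc)
  also have "\<dots> = (- \<mu> i j) \<odot> (X j \<otimes> (X i \<otimes> z)) \<oplus> (2 * q i j) \<odot> z"
    unfolding swap[OF assms(1,2)] using assms by (simp add: l_distr smult_mult_left m_assoc)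
  finally show ?thesis .
qed

lemma form_zero:
  assumes "i \<in> I" "j \<in> I" "X i = \<zero>"
  shows "q i j = 0" "q j i = 0"
proof -
  have "(2 * q i j) \<odot> \<one> = 0 \<odot> \<one>" using relation[OF assms(1,2)] assms by simp
  then have "2 * q i j = 0" by (rule scalar_cancel)
  then show "q i j = 0" using two by simp
  then show "q j i = 0" using sym[OF assms(2,1)] by simp
qed

text \<open>The word \<open>x\<^sub>i x\<^sub>i x\<^sub>j\<close> can be reduced by replacing \<open>x\<^sub>i x\<^sub>i\<close> with a scalar, or by moving \<open>x\<^sub>j\<close> to the front first.
  Comparing the results gives a linear dependency.\<close>

lemma overlap_square:
  assumes i: "i \<in> I" and j: "j \<in> I"
  shows "((1 - \<mu> i j * \<mu> i j) * q i i) \<odot> X j \<oplus> (- (2 * q i j * (1 - \<mu> i j))) \<odot> X i = \<zero>"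
proof -
  have "q i i \<odot> X j = X i \<otimes> (X i \<otimes> X j)"
    using i j square[OF i] by (simp flip: m_assoc)
  also have "\<dots> = (- \<mu> i j) \<odot> (X i \<otimes> (X j \<otimes> X i)) \<oplus> (2 * q i j) \<odot> X i"
    unfolding swap[OF i j] using i j by (simp add: r_distr smult_mult_right)
  also have "X i \<otimes> (X j \<otimes> X i) = (- \<mu> i j * q i i) \<odot> X j \<oplus> (2 * q i j) \<odot> X i"
    using swap_left[OF i j, of "X i"] square[OF i] i j by (simp flip: smult_assoc)
  also have "(- \<mu> i j) \<odot> ((- \<mu> i j * q i i) \<odot> X j \<oplus> (2 * q i j) \<odot> X i) \<oplus> (2 * q i j) \<odot> X i =
      (\<mu> i j * \<mu> i j * q i i) \<odot> X j \<oplus> (2 * q i j * (1 - \<mu> i j)) \<odot> X i"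
  proof -
    have "(- \<mu> i j * (2 * q i j)) \<odot> X i \<oplus> (2 * q i j) \<odot> X i = (2 * q i j * (1 - \<mu> i j)) \<odot> X i"
      using i by (simp add: algebra_simps flip: smult_l_distr)
    then show ?thesis
      using i j by (simp add: smult_r_distr a_assoc algebra_simps flip: smult_assoc)
  qed
  finally have "q i i \<odot> X j \<oplus> \<zero> = (\<mu> i j * \<mu> i j * q i i) \<odot> X j \<oplus> (2 * q i j * (1 - \<mu> i j)) \<odot> X i"
    using i j by simp
  then have "(q i i - \<mu> i j * \<mu> i j * q i i) \<odot> X j \<oplus> \<zero> = (2 * q i j * (1 - \<mu> i j)) \<odot> X i"
    by (rule smult_merge[rotated 2]) (use i j in auto)
  then show ?thesis
    using i j by (simp add: smult_uminus r_neg left_diff_distrib)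
qed

text \<open>The word \<open>x\<^sub>i x\<^sub>j x\<^sub>k\<close> can be reversed in two ways, starting with \<open>x\<^sub>i x\<^sub>j\<close> or with \<open>x\<^sub>j x\<^sub>k\<close>. The coefficients of the
  reversed word agree, so that a linear dependency remains.\<close>

lemma overlap_triple:
  assumes i: "i \<in> I" and j: "j \<in> I" and k: "k \<in> I"
  shows "(q j k * (\<mu> i j * \<mu> i k - 1)) \<odot> X i \<oplus> ((q i k * (\<mu> j k - \<mu> i j)) \<odot> X j
    \<oplus> (q i j * (1 - \<mu> j k * \<mu> i k)) \<odot> X k) = \<zero>"
proof -
  note cl = i j k
  let ?Z = "X k \<otimes> (X j \<otimes> X i)" and ?m = "\<mu> i j * \<mu> i k * \<mu> j k"
  have "X i \<otimes> (X j \<otimes> X k) = (- \<mu> i j) \<odot> (X j \<otimes> (X i \<otimes> X k)) \<oplus> (2 * q i j) \<odot> X k"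
    using swap_left[OF i j, of "X k"] k by simp
  also have "X j \<otimes> (X i \<otimes> X k) = (- \<mu> i k) \<odot> (X j \<otimes> (X k \<otimes> X i)) \<oplus> (2 * q i k) \<odot> X j"
    unfolding swap[OF i k] using cl by (simp add: r_distr smult_mult_right)
  also have "X j \<otimes> (X k \<otimes> X i) = (- \<mu> j k) \<odot> ?Z \<oplus> (2 * q j k) \<odot> X i"
    using swap_left[OF j k, of "X i"] i by simp
  finally have 1: "X i \<otimes> (X j \<otimes> X k) = (- ?m) \<odot> ?Z \<oplus> ((\<mu> i j * \<mu> i k * (2 * q j k)) \<odot> X i
      \<oplus> ((- (\<mu> i j * (2 * q i k))) \<odot> X j \<oplus> (2 * q i j) \<odot> X k))"
    using cl by (simp add: smult_r_distr a_assoc mult.assoc flip: smult_assoc)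
  have "X i \<otimes> (X j \<otimes> X k) = (- \<mu> j k) \<odot> (X i \<otimes> (X k \<otimes> X j)) \<oplus> (2 * q j k) \<odot> X i"
    unfolding swap[OF j k] using cl by (simp add: r_distr smult_mult_right)
  also have "X i \<otimes> (X k \<otimes> X j) = (- \<mu> i k) \<odot> (X k \<otimes> (X i \<otimes> X j)) \<oplus> (2 * q i k) \<odot> X j"
    using swap_left[OF i k, of "X j"] j by simp
  also have "X k \<otimes> (X i \<otimes> X j) = (- \<mu> i j) \<odot> ?Z \<oplus> (2 * q i j) \<odot> X k"
    unfolding swap[OF i j] using cl by (simp add: r_distr smult_mult_right)
  finally have 2: "X i \<otimes> (X j \<otimes> X k) = (- ?m) \<odot> ?Z \<oplus> ((2 * q j k) \<odot> X i
      \<oplus> ((- (\<mu> j k * (2 * q i k))) \<odot> X j \<oplus> (\<mu> j k * \<mu> i k * (2 * q i j)) \<odot> X k))"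
    using cl by (simp add: smult_r_distr a_ac mult_ac flip: smult_assoc)
  from 1 2 have "(- ?m) \<odot> ?Z \<oplus> ((\<mu> i j * \<mu> i k * (2 * q j k)) \<odot> X i
      \<oplus> ((- (\<mu> i j * (2 * q i k))) \<odot> X j \<oplus> (2 * q i j) \<odot> X k)) = (- ?m) \<odot> ?Z \<oplus> ((2 * q j k) \<odot> X i
      \<oplus> ((- (\<mu> j k * (2 * q i k))) \<odot> X j \<oplus> (\<mu> j k * \<mu> i k * (2 * q i j)) \<odot> X k))"
    by simp
  then have "(\<mu> i j * \<mu> i k * (2 * q j k)) \<odot> X i
      \<oplus> ((- (\<mu> i j * (2 * q i k))) \<odot> X j \<oplus> (2 * q i j) \<odot> X k) = (2 * q j k) \<odot> X i
      \<oplus> ((- (\<mu> j k * (2 * q i k))) \<odot> X j \<oplus> (\<mu> j k * \<mu> i k * (2 * q i j)) \<odot> X k)"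
    using cl by (simp add: add.left_cancel del: smult_uminus)
  from smult_merge[OF _ _ this] have "(- (\<mu> i j * (2 * q i k))) \<odot> X j
      \<oplus> ((\<mu> i j * \<mu> i k * (2 * q j k) - 2 * q j k) \<odot> X i \<oplus> (2 * q i j) \<odot> X k) =
      (- (\<mu> j k * (2 * q i k))) \<odot> X j \<oplus> (\<mu> j k * \<mu> i k * (2 * q i j)) \<odot> X k"
    using cl by (simp add: a_lcomm)
  from smult_merge[OF _ _ this] have "(2 * q i j) \<odot> X k
      \<oplus> ((- (\<mu> i j * (2 * q i k)) - - (\<mu> j k * (2 * q i k))) \<odot> X j
        \<oplus> (\<mu> i j * \<mu> i k * (2 * q j k) - 2 * q j k) \<odot> X i) = (\<mu> j k * \<mu> i k * (2 * q i j)) \<odot> X k \<oplus> \<zero>"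
    using cl by (simp add: a_ac)
  from smult_merge[OF _ _ this] have "2 \<odot> ((q j k * (\<mu> i j * \<mu> i k - 1)) \<odot> X i \<oplus> ((q i k * (\<mu> j k - \<mu> i j)) \<odot> X j
    \<oplus> (q i j * (1 - \<mu> j k * \<mu> i k)) \<odot> X k)) = \<zero>"
    using cl by (simp add: smult_r_distr a_ac algebra_simps flip: smult_assoc)
  then show ?thesis by (rule smult_eq_zeroD) (use two cl in auto)
qed

text \<open>If the coefficients differed, the two commutation relations with \<open>X m\<close> would make \<open>X j \<otimes> X m\<close> and
  \<open>X m \<otimes> X j\<close> scalars, and then zero. If some \<open>X p\<close> pairs nontrivially with \<open>X j\<close>, multiplying by it would
  force \<open>X m\<close> onto the line of \<open>X j\<close>. If none does, \<open>X j\<close> can be specialised to zero while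
  its multiple \<open>X k\<close> is kept, which is absurd.\<close>

lemma proportional_same_coefficient:
  assumes j: "j \<in> I" and k: "k \<in> I" and m: "m \<in> I"
    and prop_k: "X k = c \<odot> X j" and Xk: "X k \<noteq> \<zero>" and out: "\<And>d. X m \<noteq> d \<odot> X j"
  shows "\<mu> k m = \<mu> j m"
proof (rule ccontr)
  assume neq: "\<mu> k m \<noteq> \<mu> j m"
  have c: "c \<noteq> 0" and Xj: "X j \<noteq> \<zero>" using prop_k Xk j by auto
  have outside: "\<lbrakk>a \<odot> X m = b \<odot> X j\<rbrakk> \<Longrightarrow> a = 0" for a b
    using smult_solve[of a "X m" "b \<odot> X j"] out m j by (auto simp flip: smult_assoc)
  have "c \<odot> (X j \<otimes> X m \<oplus> \<mu> k m \<odot> (X m \<otimes> X j)) = (2 * q k m) \<odot> \<one>"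
    using relation[OF k m] j m unfolding prop_k
    by (simp add: smult_mult_left smult_mult_right smult_r_distr mult.commute flip: smult_assoc)
  then have "X j \<otimes> X m \<oplus> \<mu> k m \<odot> (X m \<otimes> X j) = (inverse c * (2 * q k m)) \<odot> \<one>"
    using smult_solve[OF _ c, of "X j \<otimes> X m \<oplus> \<mu> k m \<odot> (X m \<otimes> X j)" "(2 * q k m) \<odot> \<one>"] j m
    by (simp flip: smult_assoc)
  then have "\<mu> k m \<odot> (X m \<otimes> X j) \<oplus> X j \<otimes> X m = \<mu> j m \<odot> (X m \<otimes> X j) \<oplus>
      (X j \<otimes> X m \<oplus> (inverse c * (2 * q k m) - 2 * q j m) \<odot> \<one>)"
  proof -
    have "\<mu> j m \<odot> (X m \<otimes> X j) \<oplus> (X j \<otimes> X m \<oplus> (inverse c * (2 * q k m) - 2 * q j m) \<odot> \<one>) =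
        (2 * q j m) \<odot> \<one> \<oplus> (inverse c * (2 * q k m) - 2 * q j m) \<odot> \<one>"
      unfolding relation[OF j m, symmetric] using j m by (simp add: a_ac)
    also have "\<dots> = (inverse c * (2 * q k m)) \<odot> \<one>" by (simp flip: smult_l_distr)
    finally show ?thesis
      using \<open>X j \<otimes> X m \<oplus> \<mu> k m \<odot> (X m \<otimes> X j) = _\<close> j m by (simp add: a_comm)
  qed
  from smult_merge[OF _ _ this] have "X j \<otimes> X m \<oplus> (\<mu> k m - \<mu> j m) \<odot> (X m \<otimes> X j) =
      X j \<otimes> X m \<oplus> (inverse c * (2 * q k m) - 2 * q j m) \<odot> \<one>"
    using j m by (simp add: a_comm)
  then have "(\<mu> k m - \<mu> j m) \<odot> (X m \<otimes> X j) = (inverse c * (2 * q k m) - 2 * q j m) \<odot> \<one>"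
    using j m by (simp add: add.left_cancel)
  from smult_solve[OF this] obtain e where e: "X m \<otimes> X j = e \<odot> \<one>"
    using neq j m by (auto simp flip: smult_assoc)
  have "X j \<otimes> X m = (- \<mu> j m * e + 2 * q j m) \<odot> \<one>"
    using swap[OF j m] unfolding e by (simp flip: smult_assoc smult_l_distr)
  then obtain e' where e': "X j \<otimes> X m = e' \<odot> \<one>" by blast
  have 1: "q j j \<odot> X m = e' \<odot> X j"
    using e' square[OF j] j m by (metis m_assoc scalar_mult X_closed)
  have 2: "q j j \<odot> X m = e \<odot> X j"
    using e square[OF j] j m by (metis m_assoc scalar_mult X_closed)
  have "q j j = 0" by (rule outside[OF 1])
  then have "e' = 0" "e = 0"
    using 1 2 smult_eq_zeroD[of _ "X j"] Xj j m by auto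
  then have ann: "X j \<otimes> X m = \<zero>" "X m \<otimes> X j = \<zero>" using e e' by simp_all
  show False
  proof (cases "\<exists>p\<in>I. q j p \<noteq> 0")
    case True
    then obtain p where p: "p \<in> I" "q j p \<noteq> 0" by blast
    then have "q p j \<noteq> 0" using sym[OF j p(1)] by auto
    have "\<zero> = X p \<otimes> (X j \<otimes> X m)" using ann p by simp
    also have "\<dots> = (- \<mu> p j) \<odot> (X j \<otimes> (X p \<otimes> X m)) \<oplus> (2 * q p j) \<odot> X m"
      by (rule swap_left[OF p(1) j]) (use m in simp)
    also have "X j \<otimes> (X p \<otimes> X m) = (2 * q p m) \<odot> X j"
    proof -
      have "X j \<otimes> (X m \<otimes> X p) = \<zero>" using ann j m p by (simp flip: m_assoc)
      then show ?thesis
        unfolding swap[OF p(1) m] using j m p by (simp add: r_distr smult_mult_right)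
    qed
    finally have "(2 * q p j) \<odot> X m \<oplus> (- \<mu> p j * (2 * q p m)) \<odot> X j = \<zero>"
      using j m by (simp add: a_comm flip: smult_assoc)
    then have "2 * q p j = 0" by (rule two_term_dependence) (use j m out in auto)
    then show False using two \<open>q p j \<noteq> 0\<close> by simp
  next
    case False
    then obtain h where h: "h \<in> alg_hom R R" "h (X j) = \<zero>" "\<And>i. \<lbrakk>i \<in> I; i \<noteq> j\<rbrakk> \<Longrightarrow> h (X i) = X i"
      using kill[OF j] by blast
    have "k \<noteq> j" using neq by auto
    then have "X k = h (c \<odot> X j)" using h(3)[OF k] prop_k by simp
    also have "\<dots> = \<zero>" using alg_hom_smult[OF h(1)] h(2) j by simp
    finally show False using Xk by simp
  qed
qed

text \<open>The first generator on each line of nonzero generators.\<close>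

definition representatives :: "nat set" where
  "representatives = {i \<in> I. X i \<noteq> \<zero> \<and> (\<forall>j\<in>I. j < i \<longrightarrow> (\<forall>c. X i \<noteq> c \<odot> X j))}"

lemma representatives_subset: "representatives \<subseteq> I" and representatives_nonzero: "i \<in> representatives \<Longrightarrow> X i \<noteq> \<zero>"
  by (auto simp: representatives_def)

lemma representatives_independent:
  assumes "i \<in> representatives" "j \<in> representatives" "i \<noteq> j"
  shows "X i \<noteq> c \<odot> X j"
proof
  assume eq: "X i = c \<odot> X j"
  have ij: "i \<in> I" "j \<in> I" "X i \<noteq> \<zero>" using assms by (auto simp: representatives_def)
  show False
  proof (cases "j < i")
    case True
    then show False using assms(1) ij eq by (auto simp: representatives_def)
  next
    case False
    then have "i < j" using assms(3) by simp
    have "c \<noteq> 0" using eq ij by auto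
    then have "X j = inverse c \<odot> X i" using smult_solve[OF eq[symmetric]] ij by simp
    then show False using assms(2) ij \<open>i < j\<close> by (auto simp: representatives_def)
  qed
qed

lemma representative_exists:
  assumes k: "k \<in> I" and Xk: "X k \<noteq> \<zero>"
  shows "\<exists>i\<in>representatives. \<exists>c. X k = c \<odot> X i"
proof -
  let ?Q = "\<lambda>i. i \<in> I \<and> (\<exists>c. X k = c \<odot> X i)"
  have "?Q k" using k by (auto intro!: exI[of _ 1])
  define i where "i = (LEAST i. ?Q i)"
  have i: "?Q i" unfolding i_def by (rule LeastI[of ?Q, OF \<open>?Q k\<close>])
  then obtain c where iI: "i \<in> I" and c: "X k = c \<odot> X i" by blast
  have "X i \<noteq> \<zero>" using c Xk by auto
  moreover have "X i \<noteq> d \<odot> X j" if j: "j \<in> I" "j < i" for d j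
  proof
    assume "X i = d \<odot> X j"
    then have "X k = (c * d) \<odot> X j" using c j by (simp add: smult_assoc)
    then have "?Q j" using j by blast
    then have "i \<le> j" unfolding i_def by (rule Least_le)
    then show False using j by simp
  qed
  ultimately show ?thesis using iI c by (auto simp: representatives_def)
qed

text \<open>Between generators on different lines no dependency involves just two of them, so the dependencies
  found from the overlaps must have coefficients zero wherever they are that short. By the
  overlap of \<open>x\<^sub>j x\<^sub>j x\<^sub>k\<close>, nonvanishing of \<open>q j k\<close> gives \<open>\<mu> j k = 1\<close>, and this shortens the
  dependency found from three generators to at most two terms.\<close>

lemma representatives_invariant: "invariant_form representatives \<mu> q"
proof -
  let ?J = "representatives"
  have J: "i \<in> I" if "i \<in> ?J" for i using that representatives_subset by blast
  note np = representatives_independent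
  have mu1: "\<mu> j k = 1" if jk: "j \<in> ?J" "k \<in> ?J" "q j k \<noteq> 0" for j k
  proof (cases "j = k")
    case True
    then show ?thesis using mu_diag J jk by simp
  next
    case False
    have "(- (2 * q j k * (1 - \<mu> j k))) \<odot> X j \<oplus> ((1 - \<mu> j k * \<mu> j k) * q j j) \<odot> X k = \<zero>"
      using overlap_square[OF J[OF jk(1)] J[OF jk(2)]] J[OF jk(1)] J[OF jk(2)] by (simp add: a_comm)
    then have "- (2 * q j k * (1 - \<mu> j k)) = 0"
      by (rule two_term_dependence) (use J jk False np in auto)
    then show ?thesis using two jk by simp
  qed
  have "\<mu> i j * \<mu> i k = 1" if ijk: "i \<in> ?J" "j \<in> ?J" "k \<in> ?J" and q: "q j k \<noteq> 0" for i j k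
  proof -
    note I = J[OF ijk(1)] J[OF ijk(2)] J[OF ijk(3)]
    have jk: "\<mu> j k = 1" "\<mu> k j = 1" using mu1[OF ijk(2,3) q] mu_inverse[OF I(2,3)] by auto
    consider "i = j" | "i = k" | "j = k" "i \<noteq> j" | "i \<noteq> j" "i \<noteq> k" "j \<noteq> k" by blast
    then show ?thesis
    proof cases
      case 1
      then show ?thesis using jk mu_diag I by simp
    next
      case 2
      then show ?thesis using jk mu_diag I by simp
    next
      case 3
      have "(1 - \<mu> j i * \<mu> j i) * q j j = 0"
        by (rule two_term_dependence[OF overlap_square[OF I(2,1)]]) (use I 3 np ijk in auto)
      then have "\<mu> j i * \<mu> j i = 1" using q 3 by simp
      then have "\<mu> i j * \<mu> i j = (\<mu> i j * \<mu> i j) * (\<mu> j i * \<mu> j i)" by simp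
      also have "\<dots> = (\<mu> i j * \<mu> j i) * (\<mu> i j * \<mu> j i)" by (simp only: mult_ac)
      also have "\<dots> = 1" using mu_inverse[OF I(1,2)] by simp
      finally show ?thesis using 3 by simp
    next
      case 4
      note T = overlap_triple[OF I]
      show ?thesis
      proof (cases "q i j = 0")
        case ij: True
        show ?thesis
        proof (cases "q i k = 0")
          case True
          then have "(q j k * (\<mu> i j * \<mu> i k - 1)) \<odot> X i = \<zero>" using T ij I by simp
          then have "q j k * (\<mu> i j * \<mu> i k - 1) = 0"
            using smult_eq_zeroD X_closed[OF I(1)] representatives_nonzero[OF ijk(1)] by blast
          then show ?thesis using q by simp
        next
          case False
          then have "\<mu> i k = 1" using mu1 ijk by simp
          have "(q j k * (\<mu> i j * \<mu> i k - 1)) \<odot> X i \<oplus> (q i k * (\<mu> j k - \<mu> i j)) \<odot> X j = \<zero>"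
            using T ij I by simp
          then have "q j k * (\<mu> i j * \<mu> i k - 1) = 0"
            by (rule two_term_dependence) (use I 4 np ijk in auto)
          then show ?thesis using q by simp
        qed
      next
        case False
        then have ij: "\<mu> i j = 1" using mu1 ijk by simp
        show ?thesis
        proof (cases "q i k = 0")
          case True
          have "(q j k * (\<mu> i j * \<mu> i k - 1)) \<odot> X i \<oplus> (q i j * (1 - \<mu> j k * \<mu> i k)) \<odot> X k = \<zero>"
            using T True I by simp
          then have "q j k * (\<mu> i j * \<mu> i k - 1) = 0"
            by (rule two_term_dependence) (use I 4 np ijk in auto)
          then show ?thesis using q by simp
        next
          case False
          then show ?thesis using mu1 ijk ij by simp
        qed
      qed
    qed
  qed
  then show ?thesis using sym J unfolding invariant_form_def by blast
qed

text \<open>The relation for \<open>k\<close> and \<open>m\<close> becomes a multiple of an expression in \<open>r k\<close> and \<open>r m\<close>. In \<open>R\<close> and in \<open>B\<close> this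
  expression is the same scalar: if \<open>r k = r m\<close> by squaring, and otherwise because
  \<open>\<mu> k m = \<mu> (r k) (r m)\<close>. Since \<open>R\<close> is nontrivial, the scalar has the value required by the relation.\<close>

lemma relations_transfer:
  fixes B :: "('k, 'b) module"
  assumes B: "k_algebra B" and b: "skew_relations B representatives \<mu> q b"
    and r: "\<And>k. k \<in> I \<Longrightarrow> r k \<in> representatives" "\<And>k. k \<in> I \<Longrightarrow> X k = c k \<odot> X (r k)"
  shows "skew_relations B I \<mu> q (\<lambda>k. c k \<odot>\<^bsub>B\<^esub> b (r k))"
proof -
  interpret B: k_algebra B by fact
  have J: "i \<in> I" if "i \<in> representatives" for i using that representatives_subset by blast
  have bc: "b i \<in> carrier B" if "i \<in> representatives" for i using b that by (simp add: skew_relations_def)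
  have "(c k \<odot>\<^bsub>B\<^esub> b (r k)) \<otimes>\<^bsub>B\<^esub> (c m \<odot>\<^bsub>B\<^esub> b (r m)) \<oplus>\<^bsub>B\<^esub>
      \<mu> k m \<odot>\<^bsub>B\<^esub> ((c m \<odot>\<^bsub>B\<^esub> b (r m)) \<otimes>\<^bsub>B\<^esub> (c k \<odot>\<^bsub>B\<^esub> b (r k))) = (2 * q k m) \<odot>\<^bsub>B\<^esub> \<one>\<^bsub>B\<^esub>"
    if km: "k \<in> I" "m \<in> I" for k m
  proof -
    let ?k = "r k" and ?m = "r m"
    have rI: "?k \<in> I" "?m \<in> I" and rJ: "?k \<in> representatives" "?m \<in> representatives" using r J km by auto
    have factor: "(c k \<odot>\<^bsub>B\<^esub> b ?k) \<otimes>\<^bsub>B\<^esub> (c m \<odot>\<^bsub>B\<^esub> b ?m) \<oplus>\<^bsub>B\<^esub> \<mu> k m \<odot>\<^bsub>B\<^esub> ((c m \<odot>\<^bsub>B\<^esub> b ?m) \<otimes>\<^bsub>B\<^esub> (c k \<odot>\<^bsub>B\<^esub> b ?k)) =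
        (c k * c m) \<odot>\<^bsub>B\<^esub> (b ?k \<otimes>\<^bsub>B\<^esub> b ?m \<oplus>\<^bsub>B\<^esub> \<mu> k m \<odot>\<^bsub>B\<^esub> (b ?m \<otimes>\<^bsub>B\<^esub> b ?k))"
      using bc[OF rJ(1)] bc[OF rJ(2)]
      by (simp add: B.smult_mult_left B.smult_mult_right B.smult_r_distr mult_ac flip: B.smult_assoc)
    have factorX: "(c k * c m) \<odot> (X ?k \<otimes> X ?m \<oplus> \<mu> k m \<odot> (X ?m \<otimes> X ?k)) = (2 * q k m) \<odot> \<one>"
      using relation[OF km] rI unfolding r(2)[OF km(1)] r(2)[OF km(2)]
      by (simp add: smult_mult_left smult_mult_right smult_r_distr mult_ac flip: smult_assoc)
    show ?thesis
    proof (cases "c k = 0 \<or> c m = 0")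
      case True
      then have "(2 * q k m) \<odot> \<one> = 0 \<odot> \<one>" using factorX rI by auto
      then have "2 * q k m = 0" by (rule scalar_cancel)
      then show ?thesis unfolding factor using True bc[OF rJ(1)] bc[OF rJ(2)] by auto
    next
      case False
      have "\<exists>s. X ?k \<otimes> X ?m \<oplus> \<mu> k m \<odot> (X ?m \<otimes> X ?k) = s \<odot> \<one> \<and>
          b ?k \<otimes>\<^bsub>B\<^esub> b ?m \<oplus>\<^bsub>B\<^esub> \<mu> k m \<odot>\<^bsub>B\<^esub> (b ?m \<otimes>\<^bsub>B\<^esub> b ?k) = s \<odot>\<^bsub>B\<^esub> \<one>\<^bsub>B\<^esub>"
      proof (cases "?k = ?m")
        case True
        have "b ?m \<otimes>\<^bsub>B\<^esub> b ?m = q ?m ?m \<odot>\<^bsub>B\<^esub> \<one>\<^bsub>B\<^esub>"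
          by (rule skew_relations_square[OF B two b rJ(2) mu_diag[OF rI(2)]])
        then show ?thesis
          using True square[OF rI(2)]
          by (intro exI[of _ "q ?m ?m + \<mu> k m * q ?m ?m"])
             (simp add: smult_l_distr smult_assoc B.smult_l_distr B.smult_assoc)
      next
        case neq: False
        have nz: "X ?k \<noteq> \<zero>" "X ?m \<noteq> \<zero>" using representatives_nonzero rJ by auto
        have nzk: "X k \<noteq> \<zero>" "X m \<noteq> \<zero>"
          using smult_eq_zeroD[of "c k" "X ?k"] smult_eq_zeroD[of "c m" "X ?m"] False nz rI
          unfolding r(2)[OF km(1)] r(2)[OF km(2)] by auto
        have outm: "X m \<noteq> d \<odot> X ?k" for d
        proof
          assume "X m = d \<odot> X ?k"
          then have "c m \<odot> X ?m = d \<odot> X ?k" using r(2)[OF km(2)] by simp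
          then have "X ?m = inverse (c m) \<odot> (d \<odot> X ?k)" by (rule smult_solve) (use False rI in auto)
          then have "X ?m = (inverse (c m) * d) \<odot> X ?k" using rI by (simp add: smult_assoc)
          then show False using representatives_independent[OF rJ(2,1)] neq by auto
        qed
        have 1: "\<mu> k m = \<mu> ?k m"
          by (rule proportional_same_coefficient[OF rI(1) km r(2)[OF km(1)] nzk(1) outm])
        have 2: "\<mu> m ?k = \<mu> ?m ?k"
          by (rule proportional_same_coefficient[OF rI(2) km(2) rI(1) r(2)[OF km(2)] nzk(2)])
             (use representatives_independent[OF rJ neq] in auto)
        have "\<mu> ?k m = \<mu> ?k m * (\<mu> ?m ?k * \<mu> ?k ?m)" using mu_inverse[OF rI(2,1)] by simp
        also have "\<dots> = (\<mu> ?k m * \<mu> m ?k) * \<mu> ?k ?m" using 2 by (simp add: mult.assoc)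
        also have "\<dots> = \<mu> ?k ?m" using mu_inverse[OF rI(1) km(2)] by simp
        finally have "\<mu> k m = \<mu> ?k ?m" using 1 by simp
        moreover have "b ?k \<otimes>\<^bsub>B\<^esub> b ?m \<oplus>\<^bsub>B\<^esub> \<mu> ?k ?m \<odot>\<^bsub>B\<^esub> (b ?m \<otimes>\<^bsub>B\<^esub> b ?k) = (2 * q ?k ?m) \<odot>\<^bsub>B\<^esub> \<one>\<^bsub>B\<^esub>"
          using b rJ unfolding skew_relations_def by blast
        ultimately show ?thesis using relation[OF rI] by metis
      qed
      then obtain s where s: "X ?k \<otimes> X ?m \<oplus> \<mu> k m \<odot> (X ?m \<otimes> X ?k) = s \<odot> \<one>"
        "b ?k \<otimes>\<^bsub>B\<^esub> b ?m \<oplus>\<^bsub>B\<^esub> \<mu> k m \<odot>\<^bsub>B\<^esub> (b ?m \<otimes>\<^bsub>B\<^esub> b ?k) = s \<odot>\<^bsub>B\<^esub> \<one>\<^bsub>B\<^esub>" by blast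
      have "(c k * c m * s) \<odot> \<one> = (2 * q k m) \<odot> \<one>" using factorX unfolding s by (simp add: smult_assoc)
      then have "c k * c m * s = 2 * q k m" by (rule scalar_cancel)
      then show ?thesis unfolding factor s by (simp flip: B.smult_assoc)
    qed
  qed
  then show ?thesis using r bc by (simp add: skew_relations_def)
qed

end

section \<open>Skew Clifford algebras are PBW deformations\<close>

lemma alg_isomorphic_trans:
  assumes "alg_isomorphic A B" "alg_isomorphic B C"
  shows "alg_isomorphic A C"
proof -
  obtain h g where h: "h \<in> alg_iso A B" and g: "g \<in> alg_iso B C"
    using assms by (auto simp: alg_isomorphic_def)
  have "(\<lambda>a. g (h a)) \<in> alg_iso A C"
    using h g bij_betw_trans[of h "carrier A" "carrier B" g "carrier C"] alg_hom_comp[of h A B g C]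
    by (auto simp: alg_iso_def comp_def)
  then show ?thesis by (auto simp: alg_isomorphic_def)
qed

lemma alg_isomorphicI:
  assumes "f \<in> alg_hom A B" "g \<in> alg_hom B A"
    and "\<And>a. a \<in> carrier A \<Longrightarrow> g (f a) = a" "\<And>b. b \<in> carrier B \<Longrightarrow> f (g b) = b"
  shows "alg_isomorphic A B"
proof -
  have "bij_betw f (carrier A) (carrier B)"
    by (rule bij_betw_byWitness[of _ g]) (use assms alg_hom_closed in \<open>auto simp: alg_hom_closed[OF assms(1)] alg_hom_closed[OF assms(2)]\<close>)
  then show ?thesis using assms(1) by (auto simp: alg_isomorphic_def alg_iso_def)
qed

lemma nontrivial_iff:
  assumes "k_algebra A"
  shows "nontrivial A \<longleftrightarrow> \<one>\<^bsub>A\<^esub> \<noteq> \<zero>\<^bsub>A\<^esub>"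
proof -
  interpret k_algebra A by fact
  show ?thesis
    unfolding nontrivial_def using carrier_one_not_zero by simp
qed

text \<open>An operator of square zero. It satisfies the relations of a quantum exterior algebra in place of every
  generator, so it witnesses that these generators do not vanish.\<close>

definition shift_operator :: "(nat \<Rightarrow> 'k::field) \<Rightarrow> nat \<Rightarrow> 'k" where
  "shift_operator f = (\<lambda>s. if s = 0 then f 1 else 0)"

lemma shift_operator_relations: "skew_relations linear_operators J \<mu> (\<lambda>_ _. 0) (\<lambda>_. shift_operator)"
  by (auto simp: skew_relations_def linear_operators_simps shift_operator_def fun_eq_iff)

lemma shift_operator_nonzero: "shift_operator \<noteq> (\<zero>\<^bsub>linear_operators\<^esub> :: (nat \<Rightarrow> 'k::field) \<Rightarrow> nat \<Rightarrow> 'k)"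
proof
  assume "shift_operator = (\<zero>\<^bsub>linear_operators\<^esub> :: (nat \<Rightarrow> 'k) \<Rightarrow> nat \<Rightarrow> 'k)"
  then have "shift_operator (\<lambda>_. 1 :: 'k) 0 = (\<zero>\<^bsub>linear_operators\<^esub> :: (nat \<Rightarrow> 'k) \<Rightarrow> nat \<Rightarrow> 'k) (\<lambda>_. 1) 0"
    by (rule fun_cong[OF fun_cong])
  then show False by (simp add: shift_operator_def linear_operators_simps)
qed

context tensor_basis
begin

lemma sc_hom_on_gen:
  fixes B :: "('k, 'b) module"
  assumes B: "k_algebra B" and rel: "skew_relations B J \<mu> (form \<phi>) b"
  obtains h where "h \<in> alg_hom (sc \<mu> \<phi>) B" "\<And>i. i \<in> J \<Longrightarrow> h (gen \<mu> \<phi> i) = b i"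
proof -
  interpret B: k_algebra B by fact
  have b: "i \<in> J \<Longrightarrow> b i \<in> carrier B" for i using rel by (simp add: skew_relations_def)
  obtain h where h: "h \<in> alg_hom (sc \<mu> \<phi>) B"
    "\<And>f. f \<in> carrier A \<Longrightarrow> h (eta (relations \<mu> \<phi>) f) = free_hom B b f"
    using sc_universal[OF B rel] by metis
  have "h (gen \<mu> \<phi> i) = b i" if "i \<in> J" for i
    using that h(2)[of "word [i]"] free_hom_word[of B J b, OF B b, of "[i]"] b[OF that]
    by (simp add: word_closed)
  with h(1) show thesis by (rule that)
qed

lemma sc_hom_id:
  assumes h: "h \<in> alg_hom (sc \<mu> \<phi>) (sc \<mu> \<phi>)" and gen: "\<And>i. i \<in> J \<Longrightarrow> h (gen \<mu> \<phi> i) = gen \<mu> \<phi> i"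
    and a: "a \<in> carrier (sc \<mu> \<phi>)"
  shows "h a = a"
proof -
  obtain f where f: "f \<in> carrier A" "a = eta (relations \<mu> \<phi>) f"
    using a unfolding sc_eta_surj[symmetric] by blast
  have "h (eta (relations \<mu> \<phi>) f) = free_hom (sc \<mu> \<phi>) (gen \<mu> \<phi>) f"
    by (rule free_hom_unique[OF k_algebra_sc gen_closed alg_hom_comp[OF sc_eta_hom h] gen f(1)])
  then show ?thesis using f by (simp add: sc_eta_free_hom)
qed

lemma exterior_gen_nonzero:
  assumes "\<And>i j. \<lbrakk>i \<in> J; j \<in> J\<rbrakk> \<Longrightarrow> \<phi> (x i) (x j) = 0" "i \<in> J"
  shows "gen \<mu> \<phi> i \<noteq> \<zero>\<^bsub>sc \<mu> \<phi>\<^esub>"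
proof
  let ?N = "shift_operator :: (nat \<Rightarrow> 'k) \<Rightarrow> nat \<Rightarrow> 'k"
  assume zero: "gen \<mu> \<phi> i = \<zero>\<^bsub>sc \<mu> \<phi>\<^esub>"
  have "skew_relations linear_operators J \<mu> (form \<phi>) (\<lambda>_. ?N)"
    using shift_operator_relations[of J \<mu>] assms(1) by (simp add: skew_relations_def)
  then obtain h where h: "h \<in> alg_hom (sc \<mu> \<phi>) linear_operators" "h (gen \<mu> \<phi> i) = ?N"
    using sc_hom_on_gen[OF k_algebra_linear_operators] assms(2) by metis
  then show False
    using zero alg_hom_zero[OF k_algebra_sc k_algebra_linear_operators h(1)] shift_operator_nonzero[where 'k = 'k]
    by simp
qed

text \<open>If the \<open>i\<close>-th generator pairs to zero with all generators, the generators with this one replaced by zero still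
  satisfy the relations, so the universal property yields the required specialisation.\<close>

lemma skew_algebra_sc:
  assumes two: "(2::'k) \<noteq> 0" and anti: "mult_antisymmetric J \<mu>" and sym: "mu_symmetric J x \<mu> \<phi>"
    and nontriv: "nontrivial (sc \<mu> \<phi>)"
  shows "skew_algebra (sc \<mu> \<phi>) J \<mu> (form \<phi>) (gen \<mu> \<phi>)"
proof (intro skew_algebra.intro skew_algebra_axioms.intro)
  fix i assume i: "i \<in> J" and rad: "\<And>p. p \<in> J \<Longrightarrow> \<phi> (x i) (x p) = 0"
  interpret S: k_algebra "sc \<mu> \<phi>" by (rule k_algebra_sc)
  have rad': "\<phi> (x p) (x i) = 0" if "p \<in> J" for p
    using sym i that rad unfolding mu_symmetric_def by (metis mult_zero_right)
  let ?b = "(gen \<mu> \<phi>)(i := \<zero>\<^bsub>sc \<mu> \<phi>\<^esub>)"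
  have "?b k \<otimes>\<^bsub>sc \<mu> \<phi>\<^esub> ?b l \<oplus>\<^bsub>sc \<mu> \<phi>\<^esub> \<mu> k l \<odot>\<^bsub>sc \<mu> \<phi>\<^esub> (?b l \<otimes>\<^bsub>sc \<mu> \<phi>\<^esub> ?b k) =
      (2 * form \<phi> k l) \<odot>\<^bsub>sc \<mu> \<phi>\<^esub> \<one>\<^bsub>sc \<mu> \<phi>\<^esub>" if kl: "k \<in> J" "l \<in> J" for k l
  proof -
    have "gen \<mu> \<phi> k \<otimes>\<^bsub>sc \<mu> \<phi>\<^esub> gen \<mu> \<phi> l \<oplus>\<^bsub>sc \<mu> \<phi>\<^esub> \<mu> k l \<odot>\<^bsub>sc \<mu> \<phi>\<^esub> (gen \<mu> \<phi> l \<otimes>\<^bsub>sc \<mu> \<phi>\<^esub> gen \<mu> \<phi> k) =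
        (2 * form \<phi> k l) \<odot>\<^bsub>sc \<mu> \<phi>\<^esub> \<one>\<^bsub>sc \<mu> \<phi>\<^esub>"
      using sc_relations[of \<mu> \<phi>] kl unfolding skew_relations_def by blast
    then show ?thesis using kl gen_closed rad rad' by auto
  qed
  then have "skew_relations (sc \<mu> \<phi>) J \<mu> (form \<phi>) ?b"
    using gen_closed by (simp add: skew_relations_def)
  then obtain h where h: "h \<in> alg_hom (sc \<mu> \<phi>) (sc \<mu> \<phi>)" "\<And>k. k \<in> J \<Longrightarrow> h (gen \<mu> \<phi> k) = ?b k"
    using sc_hom_on_gen[OF k_algebra_sc] by metis
  show "\<exists>h\<in>alg_hom (sc \<mu> \<phi>) (sc \<mu> \<phi>). h (gen \<mu> \<phi> i) = \<zero>\<^bsub>sc \<mu> \<phi>\<^esub> \<and>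
      (\<forall>k\<in>J. k \<noteq> i \<longrightarrow> h (gen \<mu> \<phi> k) = gen \<mu> \<phi> k)"
    by (rule bexI[OF _ h(1)]) (use h(2) i in simp)
next
  show "\<phi> (x i) (x j) = \<mu> i j * \<phi> (x j) (x i)" if "i \<in> J" "j \<in> J" for i j
    using sym that unfolding mu_symmetric_def by blast
  show "\<one>\<^bsub>sc \<mu> \<phi>\<^esub> \<noteq> \<zero>\<^bsub>sc \<mu> \<phi>\<^esub>" using nontriv nontrivial_iff[OF k_algebra_sc] by blast
qed (use k_algebra_sc two anti sc_relations in simp_all)

text \<open>Keep one generator from each line of nonzero generators. Sending the other generators to the corresponding
  multiples respects the relations, so the algebra is isomorphic to the skew Clifford algebra of the
  remaining generators, whose form is invariant. Some generator is nonzero: otherwise the form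
  vanishes in the nontrivial algebra, which is then a quantum exterior algebra.\<close>

theorem sc_is_pbw_deformation:
  assumes two: "(2::'k) \<noteq> 0" and anti: "mult_antisymmetric J \<mu>" and sym: "mu_symmetric J x \<mu> \<phi>"
    and nontriv: "nontrivial (sc \<mu> \<phi>)" and ne: "J \<noteq> {}"
  shows "\<exists>K. K \<subseteq> J \<and> K \<noteq> {} \<and>
    pbw_deformation scale (Modules.module.span scale (x ` K)) K x \<mu> (sc \<mu> \<phi>)"
proof -
  interpret V: vector_space scale by (rule vs)
  interpret S: skew_algebra "sc \<mu> \<phi>" J \<mu> "form \<phi>" "gen \<mu> \<phi>"
    by (rule skew_algebra_sc[OF assms(1-4)])
  let ?K = "S.representatives" and ?X = "gen \<mu> \<phi>"
  have K: "?K \<subseteq> J" by (rule S.representatives_subset)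
  have K_ne: "?K \<noteq> {}"
  proof
    assume empty: "?K = {}"
    then have zero: "?X i = \<zero>\<^bsub>sc \<mu> \<phi>\<^esub>" if "i \<in> J" for i
      using S.representative_exists[OF that] by blast
    then have "\<phi> (x i) (x j) = 0" if "i \<in> J" "j \<in> J" for i j
      using S.form_zero(1)[OF that] that by blast
    then show False using exterior_gen_nonzero zero ne by blast
  qed
  interpret K: tensor_basis scale "V.span (x ` ?K)" ?K x
  proof
    have "V.independent (x ` ?K)"
      using indep K V.dependent_mono by blast
    then show "basis_on scale (V.span (x ` ?K)) ?K x"
      using inj K by (auto simp: basis_on_def inj_on_subset)
    show "finite ?K" using finite_J K by (rule finite_subset[rotated])
  qed
  have pbw: "pbw_deformation scale (V.span (x ` ?K)) ?K x \<mu> (K.sc \<mu> \<phi>)"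
    by (rule K.pbw_of_invariant_form[OF two mult_antisymmetric_mono[OF anti K] S.representatives_invariant])
  have "\<exists>i c. i \<in> ?K \<and> ?X k = c \<odot>\<^bsub>sc \<mu> \<phi>\<^esub> ?X i" if k: "k \<in> J" for k
  proof (cases "?X k = \<zero>\<^bsub>sc \<mu> \<phi>\<^esub>")
    case True
    obtain i where "i \<in> ?K" using K_ne by blast
    then show ?thesis using True K by (intro exI[of _ i] exI[of _ 0]) auto
  next
    case False
    then show ?thesis using S.representative_exists[OF k] by blast
  qed
  then have "\<forall>k. \<exists>i c. k \<in> J \<longrightarrow> i \<in> ?K \<and> ?X k = c \<odot>\<^bsub>sc \<mu> \<phi>\<^esub> ?X i" by blast
  then obtain r c where r: "\<And>k. k \<in> J \<Longrightarrow> r k \<in> ?K" "\<And>k. k \<in> J \<Longrightarrow> ?X k = c k \<odot>\<^bsub>sc \<mu> \<phi>\<^esub> ?X (r k)"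
    by metis
  have fixed: "r k = k" "c k = 1" if k: "k \<in> ?K" for k
  proof -
    have kJ: "k \<in> J" using k K by blast
    show rk: "r k = k" using S.representatives_independent[OF k r(1)[OF kJ]] r(2)[OF kJ] by metis
    have "c k \<odot>\<^bsub>sc \<mu> \<phi>\<^esub> ?X k = 1 \<odot>\<^bsub>sc \<mu> \<phi>\<^esub> ?X k" using r(2)[OF kJ] rk kJ by simp
    then show "c k = 1" by (rule S.smult_cancel) (use kJ S.representatives_nonzero[OF k] in auto)
  qed
  let ?b = "\<lambda>k. c k \<odot>\<^bsub>K.sc \<mu> \<phi>\<^esub> K.gen \<mu> \<phi> (r k)"
  have transfer: "skew_relations (K.sc \<mu> \<phi>) J \<mu> (form \<phi>) ?b"
    by (rule S.relations_transfer[OF K.k_algebra_sc K.sc_relations r])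
  obtain f where f: "f \<in> alg_hom (sc \<mu> \<phi>) (K.sc \<mu> \<phi>)" "\<And>k. k \<in> J \<Longrightarrow> f (?X k) = ?b k"
    by (rule sc_hom_on_gen[OF K.k_algebra_sc transfer]) (rule that)
  have "skew_relations (sc \<mu> \<phi>) ?K \<mu> (form \<phi>) ?X"
    using sc_relations[of \<mu> \<phi>] K unfolding skew_relations_def by blast
  then obtain g where g: "g \<in> alg_hom (K.sc \<mu> \<phi>) (sc \<mu> \<phi>)" "\<And>k. k \<in> ?K \<Longrightarrow> g (K.gen \<mu> \<phi> k) = ?X k"
    using K.sc_hom_on_gen[OF k_algebra_sc] by metis
  have "g (f (?X k)) = ?X k" if k: "k \<in> J" for k
    using f(2)[OF k] g(2)[OF r(1)[OF k]] r(2)[OF k] alg_hom_smult[OF g(1) K.gen_closed[OF r(1)[OF k]]] by simp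
  then have gf: "g (f a) = a" if "a \<in> carrier (sc \<mu> \<phi>)" for a
    using sc_hom_id[OF alg_hom_comp[OF f(1) g(1)]] that by blast
  interpret KS: k_algebra "K.sc \<mu> \<phi>" by (rule K.k_algebra_sc)
  have "f (g (K.gen \<mu> \<phi> k)) = K.gen \<mu> \<phi> k" if k: "k \<in> ?K" for k
  proof -
    have "k \<in> J" using k K by blast
    then show ?thesis using f(2) g(2)[OF k] fixed[OF k] K.gen_closed[OF k] by simp
  qed
  then have fg: "f (g a) = a" if "a \<in> carrier (K.sc \<mu> \<phi>)" for a
    using K.sc_hom_id[OF alg_hom_comp[OF g(1) f(1)]] that by blast
  have "alg_isomorphic (sc \<mu> \<phi>) (K.sc \<mu> \<phi>)"
    by (rule alg_isomorphicI[OF f(1) g(1) gf fg])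
  then have "pbw_deformation scale (V.span (x ` ?K)) ?K x \<mu> (sc \<mu> \<phi>)"
    using pbw k_algebra_sc alg_isomorphic_trans unfolding pbw_deformation_def by blast
  then show ?thesis using K K_ne by blast
qed

end

section \<open>Graded PBW deformations are skew Clifford algebras\<close>

context tensor_basis
begin

text \<open>The elements without components of degree below two whose component of degree two lies in \<open>D\<close>
  form an ideal, because a multiplication changes that component by a scalar factor only.\<close>

lemma quadratic_ideal:
  assumes D: "k_subspace T D" and D2: "D \<subseteq> to_tensor ` homogeneous J 2"
    and t: "t \<in> Idl\<^bsub>T\<^esub> D" "t \<in> to_tensor ` homogeneous J 2"
  shows "t \<in> D"
proof -
  obtain g where g: "g \<in> alg_hom T A" "\<And>a. a \<in> carrier A \<Longrightarrow> g (to_tensor a) = a"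
    "\<And>t. t \<in> carrier T \<Longrightarrow> to_tensor (g t) = t"
    using to_tensor_inverse_exists by metis
  let ?K = "{f \<in> carrier A. (\<forall>w. length w < 2 \<longrightarrow> f w = 0) \<and> to_tensor (component 2 f) \<in> D}"
  have D0: "\<zero>\<^bsub>T\<^esub> \<in> D" and D_add: "\<And>a b. \<lbrakk>a \<in> D; b \<in> D\<rbrakk> \<Longrightarrow> a \<oplus>\<^bsub>T\<^esub> b \<in> D"
    and D_smult: "\<And>c a. a \<in> D \<Longrightarrow> c \<odot>\<^bsub>T\<^esub> a \<in> D"
    using D by (auto simp: k_subspace_def)
  have prod: "component 2 (a \<otimes>\<^bsub>A\<^esub> f) = a [] \<odot>\<^bsub>A\<^esub> component 2 f \<and>
      component 2 (f \<otimes>\<^bsub>A\<^esub> a) = a [] \<odot>\<^bsub>A\<^esub> component 2 f \<and>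
      (\<forall>w. length w < 2 \<longrightarrow> (a \<otimes>\<^bsub>A\<^esub> f) w = 0 \<and> (f \<otimes>\<^bsub>A\<^esub> a) w = 0)"
    if low: "\<forall>w. length w < 2 \<longrightarrow> f w = 0" for a f
  proof (intro conjI ext allI impI)
    fix w :: "nat list"
    have "(\<Sum>k\<le>length w. a (take k w) * f (drop k w)) = (\<Sum>k\<in>{0}. a (take k w) * f (drop k w))"
      if "length w = 2"
      using that low by (intro sum.mono_neutral_right) auto
    then show "component 2 (a \<otimes>\<^bsub>A\<^esub> f) w = (a [] \<odot>\<^bsub>A\<^esub> component 2 f) w"
      by (simp add: component_def free_algebra_simps)
    have "(\<Sum>k\<le>length w. f (take k w) * a (drop k w)) = (\<Sum>k\<in>{2}. f (take k w) * a (drop k w))"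
      if "length w = 2"
      using that low by (intro sum.mono_neutral_right) auto
    then show "component 2 (f \<otimes>\<^bsub>A\<^esub> a) w = (a [] \<odot>\<^bsub>A\<^esub> component 2 f) w"
      by (simp add: component_def free_algebra_simps)
    assume "length w < 2"
    then show "(a \<otimes>\<^bsub>A\<^esub> f) w = 0" "(f \<otimes>\<^bsub>A\<^esub> a) w = 0"
      unfolding free_algebra_simps using low by (auto intro!: sum.neutral)
  qed
  have K_ideal: "ideal {t \<in> carrier T. g t \<in> ?K} T"
  proof (rule idealI)
    show "ring T" by (rule T.ring_axioms)
    have neg: "\<ominus>\<^bsub>T\<^esub> a = (- 1) \<odot>\<^bsub>T\<^esub> a" if "a \<in> carrier T" for a
      using that by (simp add: T.smult_uminus)
    show "subgroup {t \<in> carrier T. g t \<in> ?K} (add_monoid T)"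
    proof (rule T.add.subgroupI)
      have "\<zero>\<^bsub>T\<^esub> \<in> {t \<in> carrier T. g t \<in> ?K}"
      proof -
        have z: "g \<zero>\<^bsub>T\<^esub> = \<zero>\<^bsub>A\<^esub>" by (rule alg_hom_zero[OF T.k_algebra_axioms A.k_algebra_axioms g(1)])
        have "component 2 \<zero>\<^bsub>A\<^esub> = \<zero>\<^bsub>A\<^esub>" by (auto simp: component_def free_algebra_simps)
        then show ?thesis
          using z D0 alg_hom_zero[OF A.k_algebra_axioms T.k_algebra_axioms to_tensor_hom]
          by simp (simp add: free_algebra_simps)
      qed
      then show "{t \<in> carrier T. g t \<in> ?K} \<noteq> {}" by blast
      show "\<ominus>\<^bsub>T\<^esub> a \<in> {t \<in> carrier T. g t \<in> ?K}" if a: "a \<in> {t \<in> carrier T. g t \<in> ?K}" for a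
        using a D_smult[of "to_tensor (component 2 (g a))" "- 1"]
        by (simp add: neg alg_hom_smult[OF g(1)] component_smult alg_hom_smult[OF to_tensor_hom] component_carrier
              del: T.smult_uminus)
           (simp add: free_algebra_simps)
      show "a \<oplus>\<^bsub>T\<^esub> b \<in> {t \<in> carrier T. g t \<in> ?K}"
        if "a \<in> {t \<in> carrier T. g t \<in> ?K}" "b \<in> {t \<in> carrier T. g t \<in> ?K}" for a b
        using that D_add
        by (simp add: alg_hom_add[OF g(1)] component_add alg_hom_add[OF to_tensor_hom] component_carrier)
           (simp add: free_algebra_simps)
    qed (auto)
    show "a \<otimes>\<^bsub>T\<^esub> t \<in> {t \<in> carrier T. g t \<in> ?K}" "t \<otimes>\<^bsub>T\<^esub> a \<in> {t \<in> carrier T. g t \<in> ?K}"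
      if t: "t \<in> {t \<in> carrier T. g t \<in> ?K}" and a: "a \<in> carrier T" for a t
    proof -
      have low: "\<forall>w. length w < 2 \<longrightarrow> g t w = 0" and tc: "t \<in> carrier T" and gt: "g t \<in> carrier A"
        and D: "to_tensor (component 2 (g t)) \<in> D"
        using t by auto
      have ga: "g a \<in> carrier A" by (rule alg_hom_closed[OF g(1) a])
      show "a \<otimes>\<^bsub>T\<^esub> t \<in> {t \<in> carrier T. g t \<in> ?K}" "t \<otimes>\<^bsub>T\<^esub> a \<in> {t \<in> carrier T. g t \<in> ?K}"
        using prod[OF low, of "g a"] D_smult[OF D] a tc ga gt
        by (simp_all add: alg_hom_mult[OF g(1)] alg_hom_smult[OF to_tensor_hom] component_carrier)
    qed
  qed
  have "D \<subseteq> {t \<in> carrier T. g t \<in> ?K}"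
  proof
    fix d assume d: "d \<in> D"
    then obtain f where f: "f \<in> homogeneous J 2" "d = to_tensor f" using D2 by blast
    then have fc: "f \<in> carrier A" by (simp add: homogeneous_def)
    then show "d \<in> {t \<in> carrier T. g t \<in> ?K}"
      using d f g(2)[OF fc] component_of_homogeneous[OF f(1), of 2] homogeneousD[OF f(1)] to_tensor_closed[OF fc]
      by auto
  qed
  from T.genideal_minimal[OF K_ideal this] have "g t \<in> ?K" using t(1) by blast
  moreover obtain f where f: "f \<in> homogeneous J 2" "t = to_tensor f" using t(2) by blast
  moreover have "g t = f" using f g(2)[of f] by (simp add: homogeneous_def)
  ultimately show ?thesis using component_of_homogeneous[OF f(1), of 2] by simp
qed

text \<open>Otherwise the deformed algebra, and with it its graded algebra, would have a single element, while the
  quantum exterior algebra is nontrivial.\<close>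

lemma one_notin_pbw_ideal:
  assumes pbw: "pbw_relations scale W J x \<mu> P"
  shows "\<one>\<^bsub>T\<^esub> \<notin> Idl\<^bsub>T\<^esub> P"
proof
  assume one: "\<one>\<^bsub>T\<^esub> \<in> Idl\<^bsub>T\<^esub> P"
  let ?R = "quot_by T P" and ?F = "quot_filtration scale W P"
  have P: "P \<subseteq> carrier T"
    using pbw by (auto simp: pbw_relations_def deforms_relations_def k_subspace_def)
  interpret I: ideal "Idl\<^bsub>T\<^esub> P" T by (rule T.genideal_ideal[OF P])
  interpret R: k_algebra ?R by (rule k_algebra_quot_by[OF T.k_algebra_axioms P])
  have "Idl\<^bsub>T\<^esub> P = carrier T" using I.one_imp_carrier[OF one] .
  have zero: "Idl\<^bsub>T\<^esub> P +>\<^bsub>T\<^esub> t = \<zero>\<^bsub>?R\<^esub>" if "t \<in> carrier T" for t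
    using quot_by_eq_zero[OF T.k_algebra_axioms P that] that \<open>Idl\<^bsub>T\<^esub> P = carrier T\<close> by simp
  have F: "r = \<zero>\<^bsub>?R\<^esub>" if "r \<in> ?F i" for r i
    using that zero unfolding quot_filtration_def Let_def tensor_filtration_eq
    by (auto simp: degree_le_def to_tensor_closed)
  have gr_unique: "g = h" if "g \<in> carrier (gr ?R ?F)" "h \<in> carrier (gr ?R ?F)" for g h
  proof
    fix i
    have "\<exists>r\<in>?F i. g i = filt_pred ?R ?F i +>\<^bsub>?R\<^esub> r" "\<exists>r\<in>?F i. h i = filt_pred ?R ?F i +>\<^bsub>?R\<^esub> r"
      using that by (simp_all add: gr_def)
    then show "g i = h i" using F by metis
  qed
  obtain p where "p \<in> alg_iso (sc \<mu> (\<lambda>_ _. 0)) (gr ?R ?F)"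
    using pbw unfolding pbw_relations_def quantum_exterior_def by blast
  then have p: "p \<in> alg_hom (sc \<mu> (\<lambda>_ _. 0)) (gr ?R ?F)" "inj_on p (carrier (sc \<mu> (\<lambda>_ _. 0)))"
    by (auto simp: alg_iso_def bij_betw_def)
  interpret E: k_algebra "sc \<mu> (\<lambda>_ _. 0)" by (rule k_algebra_sc)
  have "p \<one>\<^bsub>sc \<mu> (\<lambda>_ _. 0)\<^esub> = p \<zero>\<^bsub>sc \<mu> (\<lambda>_ _. 0)\<^esub>"
    by (intro gr_unique alg_hom_closed[OF p(1)]) auto
  then have eq: "\<one>\<^bsub>sc \<mu> (\<lambda>_ _. 0)\<^esub> = \<zero>\<^bsub>sc \<mu> (\<lambda>_ _. 0)\<^esub>" using p(2) by (simp add: inj_on_def)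
  let ?L = "linear_operators :: ('k, (nat \<Rightarrow> 'k) \<Rightarrow> nat \<Rightarrow> 'k) module"
  have rel: "skew_relations ?L J \<mu> (form (\<lambda>_ _. 0)) (\<lambda>_. shift_operator)"
    by (rule shift_operator_relations)
  obtain h where h: "h \<in> alg_hom (sc \<mu> (\<lambda>_ _. 0)) ?L"
    by (rule sc_hom_on_gen[OF k_algebra_linear_operators rel])
  have "\<one>\<^bsub>?L\<^esub> = \<zero>\<^bsub>?L\<^esub>"
    using alg_hom_one[OF h] alg_hom_zero[OF k_algebra_sc k_algebra_linear_operators h] eq by simp
  then have "\<one>\<^bsub>?L\<^esub> (\<lambda>_. 1) 0 = \<zero>\<^bsub>?L\<^esub> (\<lambda>_. 1) 0" by simp
  then show False by (simp add: linear_operators_simps)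
qed

lemma basis_form:
  assumes W: "W = UNIV"
  obtains \<psi> where "bilinear_form scale \<psi>" "\<And>i j. \<lbrakk>i \<in> J; j \<in> J\<rbrakk> \<Longrightarrow> \<psi> (x i) (x j) = p i j"
proof
  interpret V: vector_space scale by (rule vs)
  define \<psi> where "\<psi> = (\<lambda>v w. \<Sum>i\<in>J. \<Sum>j\<in>J. coord v i * coord w j * p i j)"
  have self: "vector_space ((*) :: 'k \<Rightarrow> 'k \<Rightarrow> 'k)"
    by unfold_locales (simp_all add: algebra_simps)
  have add: "coord (v + w) i = coord v i + coord w i" and smult: "coord (scale c v) i = c * coord v i" for v w c i
    using coord_lin[of v w 1 1 i] coord_lin[of v v c 0 i] by (simp_all add: W)
  show "bilinear_form scale \<psi>"
    unfolding bilinear_form_def Vector_Spaces.linear_iff \<psi>_def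
    by (simp add: vs self add smult algebra_simps sum.distrib sum_distrib_left)
  show "\<psi> (x i) (x j) = p i j" if ij: "i \<in> J" "j \<in> J" for i j
  proof -
    have "\<psi> (x i) (x j) = (\<Sum>k\<in>J. \<Sum>l\<in>J. if i = k then (if j = l then p k l else 0) else 0)"
      unfolding \<psi>_def by (intro sum.cong refl) (simp add: coord_basis ij)
    also have "\<dots> = (\<Sum>k\<in>J. if i = k then (\<Sum>l\<in>J. if j = l then p k l else 0) else 0)"
      by (intro sum.cong refl) simp
    also have "\<dots> = p i j" using ij finite_J by (simp add: sum.delta')
    finally show ?thesis .
  qed
qed

text \<open>The quadratic parts of \<open>P\<close> form the span of the quadratic relations, since both spaces generate the same
  ideal and consist of quadratic elements. As \<open>P\<close> is graded, an element of \<open>P\<close> is the sum of its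
  quadratic part and a scalar, and the scalar is determined by the quadratic part because \<open>P\<close> contains no
  nonzero scalar. So \<open>P\<close> is spanned by \<open>x\<^sub>i x\<^sub>j + \<mu> i j x\<^sub>j x\<^sub>i - 2 p i j\<close> for unique scalars \<open>p i j\<close>, and proportional
  quadratic relations have proportional scalars, which is the symmetry of the form.\<close>

theorem graded_pbw_is_sc:
  assumes two: "(2::'k) \<noteq> 0" and anti: "mult_antisymmetric J \<mu>" and W: "W = UNIV"
    and pbw: "pbw_relations scale W J x \<mu> P" and graded: "Z2_graded_relations scale W P"
  shows "\<exists>\<psi>. bilinear_form scale \<psi> \<and> mu_symmetric J x \<mu> \<psi> \<and> nontrivial (sc \<mu> \<psi>) \<and>
    quot_by T P = sc \<mu> \<psi>"
proof -
  let ?qp = "quadratic_part scale W" and ?rel = "relations \<mu> (\<lambda>_ _. 0)"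
  let ?r = "\<lambda>i j. to_tensor (free_relation \<mu> (\<lambda>_ _. 0) i j)"
  have P: "k_subspace T P" and PF: "P \<subseteq> to_tensor ` degree_le J 2"
    and ext: "sc \<mu> (\<lambda>_ _. 0) = quot_by T (?qp ` P)"
    using pbw by (auto simp: pbw_relations_def deforms_relations_def quantum_exterior_def tensor_filtration_eq)
  have Pc: "P \<subseteq> carrier T" and P0: "\<zero>\<^bsub>T\<^esub> \<in> P"
    and P_add: "\<And>a b. \<lbrakk>a \<in> P; b \<in> P\<rbrakk> \<Longrightarrow> a \<oplus>\<^bsub>T\<^esub> b \<in> P"
    and P_smult: "\<And>c a. a \<in> P \<Longrightarrow> c \<odot>\<^bsub>T\<^esub> a \<in> P"
    using P by (auto simp: k_subspace_def)
  have one: "\<one>\<^bsub>T\<^esub> \<notin> Idl\<^bsub>T\<^esub> P" by (rule one_notin_pbw_ideal[OF pbw])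
  have scalar_in_P: "c = 0" if c: "c \<odot>\<^bsub>T\<^esub> \<one>\<^bsub>T\<^esub> \<in> P" for c
  proof (rule ccontr)
    assume "c \<noteq> 0"
    then have "\<one>\<^bsub>T\<^esub> \<in> P" using P_smult[OF c, of "inverse c"] by (simp flip: T.smult_assoc)
    then show False using one T.genideal_self[OF Pc] by blast
  qed
  have qp_homogeneous: "?qp p \<in> to_tensor ` homogeneous J 2" if p: "p \<in> P" for p
  proof -
    obtain f where f: "f \<in> degree_le J 2" "p = to_tensor f" using p PF by blast
    then have "f \<in> carrier A" by (simp add: degree_le_def)
    then show ?thesis using f component_homogeneous by (auto simp: quadratic_part_eq)
  qed
  then have qpc: "?qp ` P \<subseteq> carrier T"
    using to_tensor_closed by (fastforce simp: homogeneous_def)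
  have split: "\<exists>c. p = c \<odot>\<^bsub>T\<^esub> \<one>\<^bsub>T\<^esub> \<oplus>\<^bsub>T\<^esub> ?qp p" if p: "p \<in> P" for p
  proof -
    obtain c f where f: "f \<in> homogeneous J 2" "p = c \<odot>\<^bsub>T\<^esub> \<one>\<^bsub>T\<^esub> \<oplus>\<^bsub>T\<^esub> to_tensor f"
      using p graded unfolding Z2_graded_relations_def Let_def tensor_power_eq by blast
    have fc: "f \<in> carrier A" using f(1) by (simp add: homogeneous_def)
    have unit: "\<one>\<^bsub>A\<^esub> \<in> homogeneous J 0" using homogeneous_word[of "[]" J 0] by (simp add: free_algebra_simps)
    have eq: "p = to_tensor (c \<odot>\<^bsub>A\<^esub> \<one>\<^bsub>A\<^esub> \<oplus>\<^bsub>A\<^esub> f)"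
      using f(2) fc by (simp add: alg_homD[OF to_tensor_hom])
    have "k_subspace A (degree_le J 2)" by (rule degree_le_subspace)
    then have "c \<odot>\<^bsub>A\<^esub> \<one>\<^bsub>A\<^esub> \<oplus>\<^bsub>A\<^esub> f \<in> degree_le J 2"
      using homogeneous_degree_le[OF unit, of 2] homogeneous_degree_le[OF f(1), of 2]
      unfolding k_subspace_def by simp
    then have "?qp p = to_tensor (component 2 (c \<odot>\<^bsub>A\<^esub> \<one>\<^bsub>A\<^esub> \<oplus>\<^bsub>A\<^esub> f))"
      unfolding eq by (rule quadratic_part_eq)
    also have "component 2 (c \<odot>\<^bsub>A\<^esub> \<one>\<^bsub>A\<^esub> \<oplus>\<^bsub>A\<^esub> f) = f"
      unfolding component_add component_smult component_of_homogeneous[OF unit] component_of_homogeneous[OF f(1)]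
      by (simp add: free_algebra_simps)
    finally show ?thesis using f(2) by metis
  qed
  have qpP: "k_subspace T (?qp ` P)"
    unfolding k_subspace_def
  proof (intro conjI ballI allI)
    have z: "\<zero>\<^bsub>A\<^esub> \<in> degree_le J 2" using degree_le_subspace[of J 2] unfolding k_subspace_def by blast
    have "component 2 \<zero>\<^bsub>A\<^esub> = \<zero>\<^bsub>A\<^esub>" by (auto simp: component_def free_algebra_simps)
    then have "?qp \<zero>\<^bsub>T\<^esub> = \<zero>\<^bsub>T\<^esub>"
      using quadratic_part_eq[OF z] alg_hom_zero[OF A.k_algebra_axioms T.k_algebra_axioms to_tensor_hom] by simp
    then show "\<zero>\<^bsub>T\<^esub> \<in> ?qp ` P" using P0 by force
  next
    fix a b assume "a \<in> ?qp ` P" "b \<in> ?qp ` P"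
    then obtain s t where st: "s \<in> P" "t \<in> P" "a = ?qp s" "b = ?qp t" by blast
    then obtain f g where "f \<in> degree_le J 2" "g \<in> degree_le J 2" "s = to_tensor f" "t = to_tensor g"
      using PF by blast
    then have "a \<oplus>\<^bsub>T\<^esub> b = ?qp (s \<oplus>\<^bsub>T\<^esub> t)" using st quadratic_part_lin(1) by simp
    then show "a \<oplus>\<^bsub>T\<^esub> b \<in> ?qp ` P" using P_add[OF st(1,2)] by simp
  next
    fix c a assume "a \<in> ?qp ` P"
    then obtain s where s: "s \<in> P" "a = ?qp s" by blast
    then obtain f where "f \<in> degree_le J 2" "s = to_tensor f" using PF by blast
    then have "c \<odot>\<^bsub>T\<^esub> a = ?qp (c \<odot>\<^bsub>T\<^esub> s)" using s quadratic_part_lin(2) by simp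
    then show "c \<odot>\<^bsub>T\<^esub> a \<in> ?qp ` P" using P_smult[OF s(1)] by simp
  qed (rule qpc)
  have idl: "Idl\<^bsub>T\<^esub> (?qp ` P) = Idl\<^bsub>T\<^esub> ?rel"
    using ext quot_by_eq_iff[OF T.k_algebra_axioms relations_closed qpc] unfolding skew_clifford_def by metis
  have r_homogeneous: "?r i j \<in> to_tensor ` homogeneous J 2" if "i \<in> J" "j \<in> J" for i j
  proof -
    have "component 2 (free_relation \<mu> (\<lambda>_ _. 0) i j) \<in> homogeneous J 2"
      by (rule component_homogeneous[OF free_relation_closed[OF that]])
    then show ?thesis unfolding component_free_relation[OF that] by (rule imageI)
  qed
  have rel_r: "?rel = {?r i j | i j. i \<in> J \<and> j \<in> J}" by (rule relations_eq)
  have r_mem: "?r i j \<in> ?qp ` P" if ij: "i \<in> J" "j \<in> J" for i j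
  proof (rule quadratic_ideal[OF qpP])
    show "?qp ` P \<subseteq> to_tensor ` homogeneous J 2" using qp_homogeneous by blast
    have "?r i j \<in> ?rel" unfolding rel_r using ij by blast
    then show "?r i j \<in> Idl\<^bsub>T\<^esub> (?qp ` P)"
      unfolding idl by (rule subsetD[OF T.genideal_self[OF relations_closed]])
  qed (rule r_homogeneous[OF ij])
  have scalar_ex: "\<exists>c. c \<odot>\<^bsub>T\<^esub> \<one>\<^bsub>T\<^esub> \<oplus>\<^bsub>T\<^esub> ?r i j \<in> P" if ij: "i \<in> J" "j \<in> J" for i j
  proof -
    obtain p where p: "?r i j = ?qp p" "p \<in> P" using r_mem[OF ij] by (rule imageE)
    obtain c where "p = c \<odot>\<^bsub>T\<^esub> \<one>\<^bsub>T\<^esub> \<oplus>\<^bsub>T\<^esub> ?qp p" using split[OF p(2)] by blast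
    then have "c \<odot>\<^bsub>T\<^esub> \<one>\<^bsub>T\<^esub> \<oplus>\<^bsub>T\<^esub> ?r i j \<in> P" unfolding p(1) using p(2) by simp
    then show ?thesis by (rule exI)
  qed
  define c where "c i j = (SOME c. c \<odot>\<^bsub>T\<^esub> \<one>\<^bsub>T\<^esub> \<oplus>\<^bsub>T\<^esub> ?r i j \<in> P)" for i j
  have c: "c i j \<odot>\<^bsub>T\<^esub> \<one>\<^bsub>T\<^esub> \<oplus>\<^bsub>T\<^esub> ?r i j \<in> P" if ij: "i \<in> J" "j \<in> J" for i j
    unfolding c_def by (rule someI_ex) (rule scalar_ex[OF ij])
  obtain \<psi> where \<psi>: "bilinear_form scale \<psi>" "\<And>i j. \<lbrakk>i \<in> J; j \<in> J\<rbrakk> \<Longrightarrow> \<psi> (x i) (x j) = - c i j / 2"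
    by (rule basis_form[OF W, of "\<lambda>i j. - c i j / 2"]) (rule that)
  have deform: "to_tensor (free_relation \<mu> q i j) = (- (2 * q i j)) \<odot>\<^bsub>T\<^esub> \<one>\<^bsub>T\<^esub> \<oplus>\<^bsub>T\<^esub> ?r i j"
    if ij: "i \<in> J" "j \<in> J" for q i j
  proof -
    have "free_relation \<mu> q i j = (- (2 * q i j)) \<odot>\<^bsub>A\<^esub> \<one>\<^bsub>A\<^esub> \<oplus>\<^bsub>A\<^esub> free_relation \<mu> (\<lambda>_ _. 0) i j"
      by (simp add: free_relation_apply[OF ij] free_algebra_simps)
    then show ?thesis using free_relation_closed[OF ij] by (simp add: alg_homD[OF to_tensor_hom])
  qed
  have rel_P: "relations \<mu> \<psi> \<subseteq> P"
  proof
    fix t assume "t \<in> relations \<mu> \<psi>"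
    then obtain i j where ij: "i \<in> J" "j \<in> J" "t = to_tensor (free_relation \<mu> (form \<psi>) i j)"
      unfolding relations_eq by blast
    then show "t \<in> P" using deform[OF ij(1,2), of "form \<psi>"] c[OF ij(1,2)] \<psi>(2)[OF ij(1,2)] two by simp
  qed
  have sym: "\<psi> (x i) (x j) = \<mu> i j * \<psi> (x j) (x i)" if ij: "i \<in> J" "j \<in> J" for i j
  proof -
    let ?a = "free_relation \<mu> (form \<psi>) i j" and ?b = "free_relation \<mu> (form \<psi>) j i"
    have mu: "\<mu> i j * \<mu> j i = 1" using anti ij unfolding mult_antisymmetric_def by blast
    have "to_tensor ?a \<in> P" "to_tensor ?b \<in> P"
      using rel_P ij unfolding relations_eq by blast+
    then have mem: "to_tensor ?a \<oplus>\<^bsub>T\<^esub> (- \<mu> i j) \<odot>\<^bsub>T\<^esub> to_tensor ?b \<in> P" by (intro P_add P_smult)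
    have ab: "?a \<oplus>\<^bsub>A\<^esub> (- \<mu> i j) \<odot>\<^bsub>A\<^esub> ?b =
        (2 * (\<mu> i j * \<psi> (x j) (x i) - \<psi> (x i) (x j))) \<odot>\<^bsub>A\<^esub> \<one>\<^bsub>A\<^esub>"
    proof
      fix w
      have "\<mu> i j * (\<mu> j i * word [i, j] w) = word [i, j] w" using mu by (simp flip: mult.assoc)
      then show "(?a \<oplus>\<^bsub>A\<^esub> (- \<mu> i j) \<odot>\<^bsub>A\<^esub> ?b) w =
          ((2 * (\<mu> i j * \<psi> (x j) (x i) - \<psi> (x i) (x j))) \<odot>\<^bsub>A\<^esub> \<one>\<^bsub>A\<^esub>) w"
        by (simp add: free_relation_apply[OF ij] free_relation_apply[OF ij(2,1)] free_algebra_simps algebra_simps)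
    qed
    have "to_tensor ?a \<oplus>\<^bsub>T\<^esub> (- \<mu> i j) \<odot>\<^bsub>T\<^esub> to_tensor ?b = to_tensor (?a \<oplus>\<^bsub>A\<^esub> (- \<mu> i j) \<odot>\<^bsub>A\<^esub> ?b)"
      using free_relation_closed[OF ij] free_relation_closed[OF ij(2,1)]
      by (simp add: alg_homD[OF to_tensor_hom])
    also have "\<dots> = (2 * (\<mu> i j * \<psi> (x j) (x i) - \<psi> (x i) (x j))) \<odot>\<^bsub>T\<^esub> \<one>\<^bsub>T\<^esub>"
      unfolding ab by (simp only: alg_hom_smult[OF to_tensor_hom A.one_closed] alg_hom_one[OF to_tensor_hom])
    finally have "to_tensor ?a \<oplus>\<^bsub>T\<^esub> (- \<mu> i j) \<odot>\<^bsub>T\<^esub> to_tensor ?b =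
        (2 * (\<mu> i j * \<psi> (x j) (x i) - \<psi> (x i) (x j))) \<odot>\<^bsub>T\<^esub> \<one>\<^bsub>T\<^esub>" .
    with mem have "(2 * (\<mu> i j * \<psi> (x j) (x i) - \<psi> (x i) (x j))) \<odot>\<^bsub>T\<^esub> \<one>\<^bsub>T\<^esub> \<in> P"
      by (simp only:)
    then have "2 * (\<mu> i j * \<psi> (x j) (x i) - \<psi> (x i) (x j)) = 0" by (rule scalar_in_P)
    then show ?thesis using two by simp
  qed
  let ?I = "Idl\<^bsub>T\<^esub> (relations \<mu> \<psi>)"
  have I: "ideal ?I T" by (rule T.genideal_ideal[OF relations_closed])
  have I_sub: "k_subspace T ?I" by (rule ideal_k_subspace[OF T.k_algebra_axioms I])
  have span_rel: "k_subspace T (k_span T ?rel)" by (rule k_span_subspace[OF T.k_algebra_axioms relations_closed])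
  have span_hom: "k_span T ?rel \<subseteq> to_tensor ` homogeneous J 2"
    by (intro k_span_minimal image_subspace homogeneous_subspace) (use r_homogeneous rel_r in auto)
  let ?PI = "P \<inter> ?I"
  have PI_sub: "k_subspace T ?PI" using P I_sub by (auto simp: k_subspace_def)
  \<comment> \<open>Quadratic elements that become relations of the new algebra, and elements of \<open>P\<close>, by adding a scalar.\<close>
  let ?U = "{t \<in> carrier T. \<exists>c. c \<odot>\<^bsub>T\<^esub> \<one>\<^bsub>T\<^esub> \<oplus>\<^bsub>T\<^esub> t \<in> ?PI}"
  have U_sub: "k_subspace T ?U"
    unfolding k_subspace_def
  proof (intro conjI ballI allI)
    show "\<zero>\<^bsub>T\<^esub> \<in> ?U" using PI_sub by (auto simp: k_subspace_def intro!: exI[of _ 0])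
  next
    fix a b assume "a \<in> ?U" "b \<in> ?U"
    then obtain d e where ab: "a \<in> carrier T" "b \<in> carrier T"
      and de: "d \<odot>\<^bsub>T\<^esub> \<one>\<^bsub>T\<^esub> \<oplus>\<^bsub>T\<^esub> a \<in> ?PI" "e \<odot>\<^bsub>T\<^esub> \<one>\<^bsub>T\<^esub> \<oplus>\<^bsub>T\<^esub> b \<in> ?PI" by auto
    have "(d \<odot>\<^bsub>T\<^esub> \<one>\<^bsub>T\<^esub> \<oplus>\<^bsub>T\<^esub> a) \<oplus>\<^bsub>T\<^esub> (e \<odot>\<^bsub>T\<^esub> \<one>\<^bsub>T\<^esub> \<oplus>\<^bsub>T\<^esub> b) \<in> ?PI"
      using PI_sub de unfolding k_subspace_def by blast
    moreover have "(d \<odot>\<^bsub>T\<^esub> \<one>\<^bsub>T\<^esub> \<oplus>\<^bsub>T\<^esub> a) \<oplus>\<^bsub>T\<^esub> (e \<odot>\<^bsub>T\<^esub> \<one>\<^bsub>T\<^esub> \<oplus>\<^bsub>T\<^esub> b) =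
        (d + e) \<odot>\<^bsub>T\<^esub> \<one>\<^bsub>T\<^esub> \<oplus>\<^bsub>T\<^esub> (a \<oplus>\<^bsub>T\<^esub> b)"
      using ab by (simp add: T.smult_l_distr T.a_ac)
    ultimately have "(d + e) \<odot>\<^bsub>T\<^esub> \<one>\<^bsub>T\<^esub> \<oplus>\<^bsub>T\<^esub> (a \<oplus>\<^bsub>T\<^esub> b) \<in> ?PI" by (simp only:)
    then show "a \<oplus>\<^bsub>T\<^esub> b \<in> ?U" using ab by blast
  next
    fix d a assume "a \<in> ?U"
    then obtain e where a: "a \<in> carrier T" and e: "e \<odot>\<^bsub>T\<^esub> \<one>\<^bsub>T\<^esub> \<oplus>\<^bsub>T\<^esub> a \<in> ?PI" by auto
    have "d \<odot>\<^bsub>T\<^esub> (e \<odot>\<^bsub>T\<^esub> \<one>\<^bsub>T\<^esub> \<oplus>\<^bsub>T\<^esub> a) \<in> ?PI"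
      using PI_sub e unfolding k_subspace_def by blast
    then have "(d * e) \<odot>\<^bsub>T\<^esub> \<one>\<^bsub>T\<^esub> \<oplus>\<^bsub>T\<^esub> d \<odot>\<^bsub>T\<^esub> a \<in> ?PI"
      using a by (simp add: T.smult_r_distr T.smult_assoc)
    then show "d \<odot>\<^bsub>T\<^esub> a \<in> ?U" using T.smult_closed[OF a] by blast
  qed auto
  have "?rel \<subseteq> ?U"
  proof
    fix t assume t: "t \<in> ?rel"
    then obtain i j where ij: "i \<in> J" "j \<in> J" "t = ?r i j" unfolding rel_r by blast
    have "to_tensor (free_relation \<mu> (form \<psi>) i j) \<in> relations \<mu> \<psi>"
      unfolding relations_eq using ij by blast
    then have "to_tensor (free_relation \<mu> (form \<psi>) i j) \<in> ?PI"
      using rel_P T.genideal_self[OF relations_closed] by (meson IntI subsetD)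
    then have "(- (2 * form \<psi> i j)) \<odot>\<^bsub>T\<^esub> \<one>\<^bsub>T\<^esub> \<oplus>\<^bsub>T\<^esub> t \<in> ?PI"
      unfolding deform[OF ij(1,2), of "form \<psi>"] ij(3) .
    then show "t \<in> ?U" using t relations_closed by blast
  qed
  then have span_U: "k_span T ?rel \<subseteq> ?U" by (rule k_span_minimal[OF U_sub])
  have "P \<subseteq> ?I"
  proof
    fix p assume p: "p \<in> P"
    have "?qp p \<in> Idl\<^bsub>T\<^esub> ?rel"
      unfolding idl[symmetric] using T.genideal_self[OF qpc] p by blast
    then have "?qp p \<in> Idl\<^bsub>T\<^esub> (k_span T ?rel)"
      unfolding genideal_k_span[OF T.k_algebra_axioms relations_closed] .
    then have "?qp p \<in> k_span T ?rel"
      by (rule quadratic_ideal[OF span_rel span_hom _ qp_homogeneous[OF p]])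
    then have "?qp p \<in> ?U" using span_U by blast
    then obtain d where qc: "?qp p \<in> carrier T" and d: "d \<odot>\<^bsub>T\<^esub> \<one>\<^bsub>T\<^esub> \<oplus>\<^bsub>T\<^esub> ?qp p \<in> ?PI" by blast
    obtain e where e: "p = e \<odot>\<^bsub>T\<^esub> \<one>\<^bsub>T\<^esub> \<oplus>\<^bsub>T\<^esub> ?qp p" using split[OF p] by blast
    have "p \<oplus>\<^bsub>T\<^esub> (- 1) \<odot>\<^bsub>T\<^esub> (d \<odot>\<^bsub>T\<^esub> \<one>\<^bsub>T\<^esub> \<oplus>\<^bsub>T\<^esub> ?qp p) \<in> P"
      by (rule P_add[OF p P_smult[OF IntD1[OF d]]])
    moreover have "(e \<odot>\<^bsub>T\<^esub> \<one>\<^bsub>T\<^esub> \<oplus>\<^bsub>T\<^esub> ?qp p) \<oplus>\<^bsub>T\<^esub> (- 1) \<odot>\<^bsub>T\<^esub> (d \<odot>\<^bsub>T\<^esub> \<one>\<^bsub>T\<^esub> \<oplus>\<^bsub>T\<^esub> ?qp p) =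
        (e - d) \<odot>\<^bsub>T\<^esub> \<one>\<^bsub>T\<^esub>"
    proof -
      have "(e \<odot>\<^bsub>T\<^esub> \<one>\<^bsub>T\<^esub> \<oplus>\<^bsub>T\<^esub> ?qp p) \<oplus>\<^bsub>T\<^esub> (- 1) \<odot>\<^bsub>T\<^esub> (d \<odot>\<^bsub>T\<^esub> \<one>\<^bsub>T\<^esub> \<oplus>\<^bsub>T\<^esub> ?qp p) =
          (e \<odot>\<^bsub>T\<^esub> \<one>\<^bsub>T\<^esub> \<oplus>\<^bsub>T\<^esub> (- 1) \<odot>\<^bsub>T\<^esub> (d \<odot>\<^bsub>T\<^esub> \<one>\<^bsub>T\<^esub>)) \<oplus>\<^bsub>T\<^esub> (?qp p \<oplus>\<^bsub>T\<^esub> (- 1) \<odot>\<^bsub>T\<^esub> ?qp p)"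
        using qc by (simp add: T.smult_r_distr T.a_ac)
      also have "?qp p \<oplus>\<^bsub>T\<^esub> (- 1) \<odot>\<^bsub>T\<^esub> ?qp p = \<zero>\<^bsub>T\<^esub>" using qc by (simp add: T.smult_uminus T.r_neg)
      also have "(- 1) \<odot>\<^bsub>T\<^esub> (d \<odot>\<^bsub>T\<^esub> \<one>\<^bsub>T\<^esub>) = (- d) \<odot>\<^bsub>T\<^esub> \<one>\<^bsub>T\<^esub>" by (simp flip: T.smult_assoc)
      finally show ?thesis using T.smult_l_distr[OF T.one_closed, of e "- d"] by simp
    qed
    ultimately have "(e - d) \<odot>\<^bsub>T\<^esub> \<one>\<^bsub>T\<^esub> \<in> P" using e by metis
    then have "e = d" using scalar_in_P[of "e - d"] by simp
    then show "p \<in> ?I" using d e by auto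
  qed
  then have "Idl\<^bsub>T\<^esub> P \<subseteq> ?I" by (rule T.genideal_minimal[OF I])
  moreover have "?I \<subseteq> Idl\<^bsub>T\<^esub> P"
    using rel_P T.genideal_self[OF Pc] by (intro T.genideal_minimal T.genideal_ideal Pc) blast
  ultimately have eqI: "Idl\<^bsub>T\<^esub> P = ?I" by blast
  then have "quot_by T P = sc \<mu> \<psi>"
    unfolding skew_clifford_def using quot_by_eq_iff[OF T.k_algebra_axioms Pc relations_closed] by blast
  moreover have "nontrivial (sc \<mu> \<psi>)"
  proof -
    have "eta (relations \<mu> \<psi>) \<one>\<^bsub>A\<^esub> \<noteq> \<zero>\<^bsub>sc \<mu> \<psi>\<^esub>"
      unfolding skew_clifford_def eta_eq_zero[OF relations_closed A.one_closed]
      using one eqI by (simp add: alg_hom_one[OF to_tensor_hom])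
    then show ?thesis
      using nontrivial_iff[OF k_algebra_sc] alg_hom_one[OF sc_eta_hom] by simp
  qed
  moreover have "mu_symmetric J x \<mu> \<psi>" unfolding mu_symmetric_def using sym by blast
  ultimately show ?thesis using \<psi>(1) by blast
qed

end

section \<open>Nontrivial skew Clifford algebras and PBW deformations\<close>

theorem proposition4p1:
  fixes scale :: "'k::field \<Rightarrow> 'v::ab_group_add \<Rightarrow> 'v"
    and n :: nat and x :: "nat \<Rightarrow> 'v" and \<mu> :: "nat \<Rightarrow> nat \<Rightarrow> 'k" and \<phi> :: "'v \<Rightarrow> 'v \<Rightarrow> 'k"
  assumes "CHAR('k) \<noteq> 2"
    and "n \<ge> 1"
    and "vector_space scale"
    and "basis_on scale UNIV {1..n} x"
    and "mult_antisymmetric {1..n} \<mu>"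
    and "bilinear_form scale \<phi>"
    and "mu_symmetric {1..n} x \<mu> \<phi>"
    and "nontrivial (skew_clifford scale UNIV {1..n} x \<mu> \<phi>)"
  shows "(\<forall>R :: ('k, 'r) module.
            Z2_graded_pbw_deformation scale UNIV {1..n} x \<mu> R \<longrightarrow>
            (\<exists>\<psi>. bilinear_form scale \<psi> \<and> mu_symmetric {1..n} x \<mu> \<psi> \<and>
                 nontrivial (skew_clifford scale UNIV {1..n} x \<mu> \<psi>) \<and>
                 alg_isomorphic R (skew_clifford scale UNIV {1..n} x \<mu> \<psi>))) \<and>
         (\<exists>J W. J \<subseteq> {1..n} \<and> J \<noteq> {} \<and>
                W = Modules.module.span scale (x ` J) \<and>
                pbw_deformation scale W J x \<mu> (skew_clifford scale UNIV {1..n} x \<mu> \<phi>))"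
proof
  have two: "(2::'k) \<noteq> 0"
  proof
    assume "(2::'k) = 0"
    then have "CHAR('k) dvd 2" using of_nat_eq_0_iff_char_dvd[of 2, where 'a = 'k] by simp
    then have "CHAR('k) \<le> 2" "CHAR('k) \<noteq> 0" by (simp add: dvd_imp_le) (use \<open>CHAR('k) dvd 2\<close> in \<open>metis dvd_0_left zero_neq_numeral\<close>)
    then have "CHAR('k) = 1 \<or> CHAR('k) = 2" by linarith
    then show False using assms(1) CHAR_not_1[where 'a = 'k] by simp
  qed
  interpret tensor_basis scale UNIV "{1..n}" x
    by (rule tensor_basis.intro[OF assms(3,4)]) simp
  show "\<forall>R :: ('k, 'r) module.
      Z2_graded_pbw_deformation scale UNIV {1..n} x \<mu> R \<longrightarrow>
      (\<exists>\<psi>. bilinear_form scale \<psi> \<and> mu_symmetric {1..n} x \<mu> \<psi> \<and>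
           nontrivial (skew_clifford scale UNIV {1..n} x \<mu> \<psi>) \<and>
           alg_isomorphic R (skew_clifford scale UNIV {1..n} x \<mu> \<psi>))"
  proof (intro allI impI)
    fix R :: "('k, 'r) module"
    assume "Z2_graded_pbw_deformation scale UNIV {1..n} x \<mu> R"
    then obtain P where P: "pbw_relations scale UNIV {1..n} x \<mu> P" "Z2_graded_relations scale UNIV P"
      and iso: "alg_isomorphic R (quot_by T P)"
      unfolding Z2_graded_pbw_deformation_def by blast
    from graded_pbw_is_sc[OF two assms(5) refl P] iso
    show "\<exists>\<psi>. bilinear_form scale \<psi> \<and> mu_symmetric {1..n} x \<mu> \<psi> \<and>
        nontrivial (skew_clifford scale UNIV {1..n} x \<mu> \<psi>) \<and>
        alg_isomorphic R (skew_clifford scale UNIV {1..n} x \<mu> \<psi>)"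
      by auto
  qed
  have "{1..n} \<noteq> {}" using assms(2) by simp
  from sc_is_pbw_deformation[OF two assms(5,7,8) this]
  show "\<exists>J W. J \<subseteq> {1..n} \<and> J \<noteq> {} \<and> W = Modules.module.span scale (x ` J) \<and>
      pbw_deformation scale W J x \<mu> (skew_clifford scale UNIV {1..n} x \<mu> \<phi>)"
    by blast
qed

end
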